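(* Let $n\ge 1$ and let $H\in\mathbb{C}[x,y]$ be a balanced Hamiltonian of degree $n+1$. Put $\nu=n(2n-1)$, let $\Omega_1,\dots,\Omega_\nu$ be the monomial 2-forms spanning the space of polynomial 2-forms on $\mathbb{C}^2$ of degree $\le 2n$, and let $\omega_1,\dots,\omega_\nu$ be (arbitrarily chosen) monomial 1-forms with unit coefficients, of degree $\le 2n$, such that $d\omega_i$ is a nonzero constant multiple of $\Omega_i$. Then there exist constant matrices $A,B\in\mathrm{Mat}_{\nu\times\nu}(\mathbb{C})$ such that, for any continuous family of cycles $\delta(t)$ on the level curves $\{H=t\}$, the column vector $I(t)=(I_1(t),\dots,I_\nu(t))$, $I_i(t)=\oint_{\delta(t)}\omega_i$, satisfies the system of linear ordinary differential equations $$(t-A)\,\dot I=B\,I,$$ and $$\|A\|+\|B\|\le 6n(n+1)^{n+1}.$$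
   Context: Grading of polynomial forms on $\mathbb{C}^2$: the degree of a polynomial $k$-form ($k=0,1,2$) is the maximal degree of its polynomial coefficients plus $k$. The norm $\|\cdot\|$ of a polynomial or polynomial form is the sum of absolute values of all its coefficients. A monomial form is one with a single monomial term; e.g. $\pm x^ay^b\,dx$, $\pm x^ay^b\,dy$ have unit coefficient. The 2-forms of degree $\le 2n$ are $f\,dx\wedge dy$ with $\deg f\le 2n-2$, a space of dimension $n(2n-1)$. A pair of homogeneous polynomials $a,b\in\mathbb{C}[x,y]$ of degree $n$ is normalized if every homogeneous polynomial $f$ of degree $2n-1$ can be written as $f=au+bv$ with $u,v$ homogeneous of degree $n-1$ and $\|u\|+\|v\|\le\|f\|$. A polynomial $H\in\mathbb{C}[x,y]$ of degree $n+1$ with principal homogeneous part $\widehat H$ (the sum of its terms of degree $n+1$) is quasimonic if the pair $(\widehat H_x,\widehat H_y)$ is normalized, and balanced if it is quasimonic and $\|H-\widehat H\|\le 1$. A continuous family of cycles $\delta(t)$ is a locally constant (with respect to the natural topological bundle structure over the regular values of $H$) choice of classes in $H_1(\{H=t\},\mathbb{Z})$, $\{H=t\}\subset\mathbb{C}^2$, for $t$ a regular value of $H$; the integrals are (multivalued) analytic functions of $t$, and the dot is $d/dt$. In $t-A$, $t$ stands for $t$ times the identity matrix. The matrix norm is $\|A\|=\max_{j}\sum_{i}|a_{ij}|$. *)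

theory Defs
  imports
    "HOL-Analysis.Analysis"
    "HOL-Homology.Homology"
    "Jordan_Normal_Form.Matrix"
begin

text \<open>The key \<open>(i, j)\<close> stands for the monomial \<open>x^i y^j\<close>. Multiplication is the convolution
  product of the library, so this is the ring of polynomials in \<open>x\<close> and \<open>y\<close>.\<close>

type_synonym poly_xy = "(nat \<times> nat) \<Rightarrow>\<^sub>0 complex"

definition eval_xy :: "poly_xy \<Rightarrow> complex \<times> complex \<Rightarrow> complex" where
  "eval_xy p z = (\<Sum>(i, j)\<in>Poly_Mapping.keys p. Poly_Mapping.lookup p (i, j) * fst z ^ i * snd z ^ j)"

definition deg_xy :: "poly_xy \<Rightarrow> nat" where
  "deg_xy p = Max (insert 0 ((\<lambda>(i, j). i + j) ` Poly_Mapping.keys p))"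

definition norm_xy :: "poly_xy \<Rightarrow> real" where
  "norm_xy p = (\<Sum>m\<in>Poly_Mapping.keys p. cmod (Poly_Mapping.lookup p m))"

definition deriv_x :: "poly_xy \<Rightarrow> poly_xy" where
  "deriv_x p = (\<Sum>(i, j)\<in>Poly_Mapping.keys p.
      Poly_Mapping.single (i - 1, j) (of_nat i * Poly_Mapping.lookup p (i, j)))"

definition deriv_y :: "poly_xy \<Rightarrow> poly_xy" where
  "deriv_y p = (\<Sum>(i, j)\<in>Poly_Mapping.keys p.
      Poly_Mapping.single (i, j - 1) (of_nat j * Poly_Mapping.lookup p (i, j)))"

text \<open>The zero polynomial is homogeneous of every degree.\<close>

definition homogeneous :: "nat \<Rightarrow> poly_xy \<Rightarrow> bool" where
  "homogeneous d p \<longleftrightarrow> (\<forall>(i, j)\<in>Poly_Mapping.keys p. i + j = d)"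

definition principal_part :: "poly_xy \<Rightarrow> poly_xy" where
  "principal_part p = (\<Sum>(i, j)\<in>{m \<in> Poly_Mapping.keys p. fst m + snd m = deg_xy p}.
      Poly_Mapping.single (i, j) (Poly_Mapping.lookup p (i, j)))"

definition normalized_pair :: "nat \<Rightarrow> poly_xy \<Rightarrow> poly_xy \<Rightarrow> bool" where
  "normalized_pair n a b \<longleftrightarrow> homogeneous n a \<and> homogeneous n b \<and>
    (\<forall>f. homogeneous (2 * n - 1) f \<longrightarrow>
      (\<exists>u v. homogeneous (n - 1) u \<and> homogeneous (n - 1) v \<and>
        f = a * u + b * v \<and> norm_xy u + norm_xy v \<le> norm_xy f))"

definition quasimonic :: "nat \<Rightarrow> poly_xy \<Rightarrow> bool" where
  "quasimonic n H \<longleftrightarrow> deg_xy H = n + 1 \<and>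
    normalized_pair n (deriv_x (principal_part H)) (deriv_y (principal_part H))"

definition balanced :: "nat \<Rightarrow> poly_xy \<Rightarrow> bool" where
  "balanced n H \<longleftrightarrow> quasimonic n H \<and> norm_xy (H - principal_part H) \<le> 1"

text \<open>The pair \<open>(P, Q)\<close> is the 1-form \<open>P dx + Q dy\<close>; a polynomial \<open>f\<close> also stands for the
  2-form \<open>f dx \<and> dy\<close>.\<close>

type_synonym one_form = "poly_xy \<times> poly_xy"
type_synonym two_form = poly_xy

definition deg_one_form :: "one_form \<Rightarrow> nat" where
  "deg_one_form \<omega> = max (deg_xy (fst \<omega>)) (deg_xy (snd \<omega>)) + 1"

definition deg_two_form :: "two_form \<Rightarrow> nat" where
  "deg_two_form \<Omega> = deg_xy \<Omega> + 2"

definition ext_deriv :: "one_form \<Rightarrow> two_form" where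
  "ext_deriv \<omega> = deriv_x (snd \<omega>) - deriv_y (fst \<omega>)"

text \<open>Unit coefficient means a coefficient of modulus 1; signs are the basic example.\<close>

definition unit_monomial_one_form :: "one_form \<Rightarrow> bool" where
  "unit_monomial_one_form \<omega> \<longleftrightarrow> (\<exists>m c. cmod c = 1 \<and>
    (\<omega> = (Poly_Mapping.single m c, 0) \<or> \<omega> = (0, Poly_Mapping.single m c)))"

definition monomial_two_forms :: "nat \<Rightarrow> two_form set" where
  "monomial_two_forms d = {\<Omega>. (\<exists>m. \<Omega> = Poly_Mapping.single m 1) \<and> deg_two_form \<Omega> \<le> d}"

definition level_curve :: "poly_xy \<Rightarrow> complex \<Rightarrow> (complex \<times> complex) set" where
  "level_curve H t = {z. eval_xy H z = t}"

definition regular_value :: "poly_xy \<Rightarrow> complex \<Rightarrow> bool" where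
  "regular_value H t \<longleftrightarrow>
    (\<forall>z\<in>level_curve H t. eval_xy (deriv_x H) z \<noteq> 0 \<or> eval_xy (deriv_y H) z \<noteq> 0)"

abbreviation H1_level :: "poly_xy \<Rightarrow> complex \<Rightarrow> (complex \<times> complex) chain set monoid" where
  "H1_level H t \<equiv> homology_group 1 (top_of_set (level_curve H t))"

text \<open>A local trivialization, over a neighbourhood \<open>V\<close> of \<open>t0\<close>, of the bundle whose fibre over
  \<open>t\<close> is the level curve \<open>{H = t}\<close>. The model fibre is the level curve over \<open>t0\<close> itself.\<close>

definition local_trivialization ::
    "poly_xy \<Rightarrow> complex set \<Rightarrow> complex \<Rightarrow> (complex \<times> complex \<times> complex \<Rightarrow> complex \<times> complex) \<Rightarrow> bool" where
  "local_trivialization H V t0 \<Phi> \<longleftrightarrow> open V \<and> t0 \<in> V \<and>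
    (\<exists>\<Psi>. homeomorphism (V \<times> level_curve H t0) (eval_xy H -` V) \<Phi> \<Psi>) \<and>
    (\<forall>t\<in>V. \<forall>z\<in>level_curve H t0. eval_xy H (\<Phi> (t, z)) = t) \<and>
    (\<forall>z\<in>level_curve H t0. \<Phi> (t0, z) = z)"

text \<open>A single-valued branch, over the open set \<open>U\<close> of regular values, of a locally constant choice
  of homology classes. A multivalued family is given locally by such branches.\<close>

definition continuous_cycle_family ::
    "poly_xy \<Rightarrow> complex set \<Rightarrow> (complex \<Rightarrow> (complex \<times> complex) chain set) \<Rightarrow> bool" where
  "continuous_cycle_family H U \<delta> \<longleftrightarrow> open U \<and> (\<forall>t\<in>U. regular_value H t) \<and>
    (\<forall>t\<in>U. \<delta> t \<in> carrier (H1_level H t)) \<and>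
    (\<forall>t0\<in>U. \<exists>V \<Phi>. V \<subseteq> U \<and> local_trivialization H V t0 \<Phi> \<and>
      (\<forall>t\<in>V. \<delta> t = hom_induced 1 (top_of_set (level_curve H t0)) {}
                      (top_of_set (level_curve H t)) {} (\<lambda>z. \<Phi> (t, z)) (\<delta> t0)))"

text \<open>The parametrization runs from vertex 0 to vertex 1, in accordance with the orientation
  used by \<^const>\<open>chain_boundary\<close>.\<close>

definition path_of_simplex :: "((nat \<Rightarrow> real) \<Rightarrow> complex \<times> complex) \<Rightarrow> real \<Rightarrow> complex \<times> complex" where
  "path_of_simplex \<sigma> s = \<sigma> (\<lambda>j. if j = 0 then 1 - s else if j = 1 then s else 0)"

definition path_integral :: "one_form \<Rightarrow> (real \<Rightarrow> complex \<times> complex) \<Rightarrow> complex" where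
  "path_integral \<omega> \<gamma> = integral {0..1} (\<lambda>s.
      eval_xy (fst \<omega>) (\<gamma> s) * fst (vector_derivative \<gamma> (at s within {0..1})) +
      eval_xy (snd \<omega>) (\<gamma> s) * snd (vector_derivative \<gamma> (at s within {0..1})))"

definition chain_integral :: "one_form \<Rightarrow> (complex \<times> complex) chain \<Rightarrow> complex" where
  "chain_integral \<omega> c = (\<Sum>\<sigma>\<in>Poly_Mapping.keys c.
      of_int (Poly_Mapping.lookup c \<sigma>) * path_integral \<omega> (path_of_simplex \<sigma>))"

definition piecewise_C1_chain :: "(complex \<times> complex) chain \<Rightarrow> bool" where
  "piecewise_C1_chain c \<longleftrightarrow> (\<forall>\<sigma>\<in>Poly_Mapping.keys c. valid_path (path_of_simplex \<sigma>))"

text \<open>The library represents a homology class by the set of all singular cycles in it. On a regular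
  level curve a polynomial form restricts to a holomorphic, hence closed, form; its integral over a
  class is the common value of its integrals over the piecewise \<open>C\<^sup>1\<close> cycles of that class.\<close>

definition class_integral :: "one_form \<Rightarrow> (complex \<times> complex) chain set \<Rightarrow> complex" where
  "class_integral \<omega> \<delta> = (THE v. \<exists>c\<in>\<delta>. piecewise_C1_chain c \<and> v = chain_integral \<omega> c)"

definition mat_norm :: "complex mat \<Rightarrow> real" where
  "mat_norm A = Max ((\<lambda>j. \<Sum>i<dim_row A. cmod (A $$ (i, j))) ` {..<dim_col A})"

end

theory Submission
  imports Defs "HOL-Complex_Analysis.Complex_Analysis"
begin

text \<open>Write \<open>K\<close> for the principal part of \<open>H\<close>. By Euler's identity \<open>K\<close> lies in the gradient ideal
  of \<open>K\<close>, so \<open>H \<Omega>\<^sub>i\<close> can be divided by \<open>dH\<close> with a remainder of degree at most \<open>2n\<close>: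
  \<open>H \<Omega>\<^sub>i = dH \<and> \<eta>\<^sub>i + \<Sum> a\<^sub>i\<^sub>j \<Omega>\<^sub>j\<close>, where the number of division steps, hence the norm of the
  outcome, depends on the degree of \<open>\<Omega>\<^sub>i\<close>. Counting the monomials degree by degree gives the
  bound for the column sums. After rescaling, the polynomial form
  \<open>\<Theta>\<^sub>i = H \<omega>\<^sub>i - \<Sum> a\<^sub>i\<^sub>j \<omega>\<^sub>j\<close> satisfies \<open>d\<Theta>\<^sub>i = dH \<and> (\<omega>\<^sub>i + \<eta>\<^sub>i)\<close>, so that the Gelfand--Leray formula
  \<open>d/dt \<integral>\<Theta>\<^sub>i = \<integral>(\<omega>\<^sub>i + \<eta>\<^sub>i)\<close> together with \<open>\<eta>\<^sub>i = \<Sum> b\<^sub>i\<^sub>j \<omega>\<^sub>j + dG\<^sub>i\<close> is the \<open>i\<close>-th row of the system.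

  The integral of a polynomial form over a continuous cycle is described by a locally exact
  cocycle \<open>D(p, q)\<close>, the integral from \<open>p\<close> to a nearby point \<open>q\<close> of the same level curve, summed
  along a fine mesh. It vanishes on boundaries, and in the family of transported cycles the
  mesh points may be replaced by holomorphic sections of \<open>H\<close>, which makes the dependence on \<open>t\<close>
  explicit.\<close>

section \<open>Polynomials in two variables\<close>

text \<open>A form \<open>\<eta>\<close> with \<open>d\<omega> = dH \<and> \<eta>\<close> is in
  general not polynomial, so differentiating \<open>\<integral>\<omega>\<^sub>i\<close> directly
  leaves the span of the given integrals. Multiplying by \<open>H\<close> first repairs this:
  division then leaves a remainder within the same finite family, and on the curve
  \<open>H = t\<close> the factor \<open>H\<close> is just the number \<open>t\<close>, which is how
  \<open>t - A\<close> arises.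

  Two features of the setting shape the analytic half. The cycles are transported by trivializations
  that are merely continuous, so a transported path need not have a derivative in its parameter, nor
  depend differentiably on \<open>t\<close>; sums of short differences \<open>D(p, q)\<close> make
  sense for every continuous path. Moreover the integral over a class is defined through piecewise
  smooth representatives, so their existence and the independence of the choice have to be
  established as well.

  The constant has three sources: the \<open>d + 1\<close> monomials of degree \<open>d\<close>, the
  ratio of the coefficients of \<open>d\<omega>\<^sub>i\<close> and
  \<open>d\<omega>\<^sub>j\<close>, which is at most \<open>d + 1\<close> for \<open>d\<close> the
  degree of the monomial of \<open>\<Omega>\<^sub>i\<close>, and the growth \<open>n ^ k\<close> of
  norms in \<open>k\<close> division steps.\<close>

lemma poly_xy_sum: "p = (\<Sum>m\<in>Poly_Mapping.keys p. Poly_Mapping.single m (Poly_Mapping.lookup p m))"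
  for p :: "'a \<Rightarrow>\<^sub>0 'b::comm_monoid_add"
  by (rule poly_mapping_eqI)
    (auto simp: lookup_sum lookup_single when_def in_keys_iff sum.If_cases sum.delta)

text \<open>Additive identities need checking on monomials only; bilinear ones use the rule once for
  each factor. Zero is covered as a monomial with coefficient 0.\<close>

lemma poly_xy_induct [case_names single add]:
  fixes p :: "'a \<Rightarrow>\<^sub>0 'b::comm_monoid_add"
  assumes s: "\<And>m c. P (Poly_Mapping.single m c)" and a: "\<And>p q. P p \<Longrightarrow> P q \<Longrightarrow> P (p + q)"
  shows "P p"
proof -
  have 0: "P 0"
    using s[of undefined 0] by simp
  have "P (\<Sum>m\<in>A. Poly_Mapping.single m (Poly_Mapping.lookup p m))" for A
    by (induction A rule: infinite_finite_induct) (auto intro: 0 s a)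
  then show ?thesis
    using poly_xy_sum[of p] by metis
qed

lemma eval_xy_superset:
  assumes "finite S" "Poly_Mapping.keys p \<subseteq> S"
  shows "eval_xy p z = (\<Sum>m\<in>S. Poly_Mapping.lookup p m * fst z ^ fst m * snd z ^ snd m)"
  unfolding eval_xy_def case_prod_unfold prod.collapse
  by (rule sum.mono_neutral_left) (use assms in \<open>auto simp: in_keys_iff\<close>)

lemma eval_xy_add [simp]: "eval_xy (p + q) z = eval_xy p z + eval_xy q z"
proof -
  let ?S = "Poly_Mapping.keys p \<union> Poly_Mapping.keys q"
  show ?thesis
    using eval_xy_superset[of ?S p z] eval_xy_superset[of ?S q z] eval_xy_superset[of ?S "p + q" z]
    by (simp add: Poly_Mapping.keys_add lookup_add algebra_simps sum.distrib)
qed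

lemma eval_xy_single [simp]:
  "eval_xy (Poly_Mapping.single m c) z = c * fst z ^ fst m * snd z ^ snd m"
  by (subst eval_xy_superset[of "{m}"]) auto

lemma eval_xy_0 [simp]: "eval_xy 0 z = 0"
  by (simp add: eval_xy_def)

lemma eval_xy_uminus [simp]: "eval_xy (- p) z = - eval_xy p z"
  by (metis add.right_inverse eval_xy_0 eval_xy_add minus_unique)

lemma eval_xy_diff [simp]: "eval_xy (p - q) z = eval_xy p z - eval_xy q z"
  by (metis eval_xy_add eval_xy_uminus uminus_add_conv_diff diff_conv_add_uminus)

lemma eval_xy_sum: "eval_xy (sum f A) z = (\<Sum>a\<in>A. eval_xy (f a) z)"
  by (induction A rule: infinite_finite_induct) auto

lemma eval_xy_mult [simp]: "eval_xy (p * q) z = eval_xy p z * eval_xy q z"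
proof (induction p rule: poly_xy_induct)
  case (single m c)
  then show ?case
    by (induction q rule: poly_xy_induct)
      (auto simp: Poly_Mapping.mult_single power_add algebra_simps)
qed (simp add: algebra_simps)

lemma lookup_deriv_x:
  "Poly_Mapping.lookup (deriv_x p) (i, j) = of_nat (Suc i) * Poly_Mapping.lookup p (Suc i, j)"
proof -
  have "Poly_Mapping.lookup (deriv_x p) (i, j) =
    (\<Sum>m\<in>Poly_Mapping.keys p. if m = (Suc i, j) then of_nat (Suc i) * Poly_Mapping.lookup p (Suc i, j) else 0)"
    unfolding deriv_x_def lookup_sum
    \<comment> \<open>Keys with first exponent 0 also land on exponent 0, because
      \<open>0 - 1 = 0\<close>, but they carry the factor 0; only the key \<open>(Suc i, j)\<close>
      contributes.\<close>
    by (rule sum.cong) (auto simp: lookup_single when_def split: prod.splits)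
  then show ?thesis
    by (auto simp: sum.delta in_keys_iff)
qed

lemma lookup_deriv_y:
  "Poly_Mapping.lookup (deriv_y p) (i, j) = of_nat (Suc j) * Poly_Mapping.lookup p (i, Suc j)"
proof -
  have "Poly_Mapping.lookup (deriv_y p) (i, j) =
    (\<Sum>m\<in>Poly_Mapping.keys p. if m = (i, Suc j) then of_nat (Suc j) * Poly_Mapping.lookup p (i, Suc j) else 0)"
    unfolding deriv_y_def lookup_sum
    by (rule sum.cong) (auto simp: lookup_single when_def split: prod.splits)
  then show ?thesis
    by (auto simp: sum.delta in_keys_iff)
qed

lemma poly_xy_eqI:
  fixes p q :: poly_xy
  assumes "\<And>i j. Poly_Mapping.lookup p (i, j) = Poly_Mapping.lookup q (i, j)"
  shows "p = q"
  using assms by (intro poly_mapping_eqI) auto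

lemma deriv_xy_add [simp]:
  "deriv_x (p + q) = deriv_x p + deriv_x q" "deriv_y (p + q) = deriv_y p + deriv_y q"
  by (auto intro!: poly_xy_eqI simp: lookup_deriv_x lookup_deriv_y lookup_add algebra_simps)

lemma deriv_xy_diff [simp]:
  "deriv_x (p - q) = deriv_x p - deriv_x q" "deriv_y (p - q) = deriv_y p - deriv_y q"
  by (auto intro!: poly_xy_eqI simp: lookup_deriv_x lookup_deriv_y lookup_minus right_diff_distrib)

lemma deriv_xy_uminus [simp]:
  "deriv_x (- p) = - deriv_x p" "deriv_y (- p) = - deriv_y p"
  by (auto intro!: poly_xy_eqI simp: lookup_deriv_x lookup_deriv_y algebra_simps)

lemma deriv_xy_0 [simp]: "deriv_x 0 = 0" "deriv_y 0 = 0"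
  by (auto simp: deriv_x_def deriv_y_def)

lemma deriv_xy_sum:
  "deriv_x (sum f A) = (\<Sum>a\<in>A. deriv_x (f a))" "deriv_y (sum f A) = (\<Sum>a\<in>A. deriv_y (f a))"
  by (induction A rule: infinite_finite_induct, auto)+

lemma deriv_xy_single:
  "deriv_x (Poly_Mapping.single m c) = Poly_Mapping.single (fst m - 1, snd m) (of_nat (fst m) * c)"
  "deriv_y (Poly_Mapping.single m c) = Poly_Mapping.single (fst m, snd m - 1) (of_nat (snd m) * c)"
  by (cases m; auto intro!: poly_xy_eqI simp: lookup_deriv_x lookup_deriv_y lookup_single when_def)+

lemma deriv_xy_mult:
  "deriv_x (p * q) = deriv_x p * q + p * deriv_x q"
  "deriv_y (p * q) = deriv_y p * q + p * deriv_y q"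
proof -
  have "deriv_x (p * q) = deriv_x p * q + p * deriv_x q \<and> deriv_y (p * q) = deriv_y p * q + p * deriv_y q"
  proof (induction p rule: poly_xy_induct)
    case (single m c)
    then show ?case
    proof (induction q rule: poly_xy_induct)
      case (single k d)
      obtain a b a' b' where [simp]: "m = (a, b)" "k = (a', b')"
        by (metis surj_pair)
      show ?case
        \<comment> \<open>Every exponent is split at 0, where the truncated subtraction departs from
          the usual formula for the derivative of a monomial.\<close>
        by (cases a; cases a'; cases b; cases b')
          (simp_all add: deriv_xy_single Poly_Mapping.mult_single single_add[symmetric] algebra_simps)
    qed (simp add: algebra_simps)
  qed (simp add: algebra_simps)
  then show "deriv_x (p * q) = deriv_x p * q + p * deriv_x q"
    "deriv_y (p * q) = deriv_y p * q + p * deriv_y q"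
    by auto
qed

text \<open>Stating the derivative over the reals, but by a complex-linear formula, lets one rule
  serve both real curves and holomorphic sections.\<close>

lemma eval_xy_has_derivative:
  "(eval_xy p has_derivative
     (\<lambda>h. eval_xy (deriv_x p) z * fst h + eval_xy (deriv_y p) z * snd h)) (at z within S)"
proof (induction p rule: poly_xy_induct)
  case (single m c)
  have eq: "eval_xy (Poly_Mapping.single m c) = (\<lambda>z. c * fst z ^ fst m * snd z ^ snd m)"
    by auto
  show ?case
    unfolding eq deriv_xy_single eval_xy_single
    by (auto intro!: derivative_eq_intros simp: algebra_simps)
next
  case (add p q)
  have eq: "eval_xy (p + q) = (\<lambda>z. eval_xy p z + eval_xy q z)"
    by auto
  show ?case
    unfolding eq
    by (rule has_derivative_eq_rhs[OF has_derivative_add[OF add]]) (auto simp: algebra_simps)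
qed

lemma continuous_on_eval_xy [continuous_intros]:
  "continuous_on S f \<Longrightarrow> continuous_on S (\<lambda>x. eval_xy p (f x))"
proof -
  have "continuous_on UNIV (eval_xy p)"
    by (metis eval_xy_has_derivative has_derivative_continuous continuous_on_eq_continuous_within)
  then show "continuous_on S f \<Longrightarrow> continuous_on S (\<lambda>x. eval_xy p (f x))"
    by (metis continuous_on_compose2 subset_UNIV)
qed

section \<open>The coefficient norm: triangle inequality and submultiplicativity\<close>

lemma norm_xy_superset:
  assumes "finite S" "Poly_Mapping.keys p \<subseteq> S"
  shows "norm_xy p = (\<Sum>m\<in>S. cmod (Poly_Mapping.lookup p m))"
  unfolding norm_xy_def
  by (rule sum.mono_neutral_left) (use assms in \<open>auto simp: in_keys_iff\<close>)

lemma norm_xy_nonneg [simp]: "norm_xy p \<ge> 0"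
  by (simp add: norm_xy_def sum_nonneg)

lemma norm_xy_0 [simp]: "norm_xy 0 = 0"
  by (simp add: norm_xy_def)

lemma norm_xy_single [simp]: "norm_xy (Poly_Mapping.single m c) = cmod c"
  by (subst norm_xy_superset[of "{m}"]) auto

lemma norm_xy_uminus [simp]: "norm_xy (- p) = norm_xy p"
  by (simp add: norm_xy_def)

lemma norm_xy_triangle: "norm_xy (p + q) \<le> norm_xy p + norm_xy q"
proof -
  let ?S = "Poly_Mapping.keys p \<union> Poly_Mapping.keys q"
  show ?thesis
    using norm_xy_superset[of ?S p] norm_xy_superset[of ?S q] norm_xy_superset[of ?S "p + q"]
    by (simp add: Poly_Mapping.keys_add lookup_add sum.distrib[symmetric] sum_mono norm_triangle_ineq)
qed

lemma norm_xy_diff: "norm_xy (p - q) \<le> norm_xy p + norm_xy q"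
  using norm_xy_triangle[of p "- q"] by simp

lemma norm_xy_sum: "norm_xy (sum f A) \<le> (\<Sum>a\<in>A. norm_xy (f a))"
  by (induction A rule: infinite_finite_induct)
    (auto intro: order_trans[OF norm_xy_triangle])

lemma norm_xy_mult: "norm_xy (p * q) \<le> norm_xy p * norm_xy q"
proof -
  have "p * q = (\<Sum>m\<in>Poly_Mapping.keys p. \<Sum>k\<in>Poly_Mapping.keys q.
      Poly_Mapping.single (m + k) (Poly_Mapping.lookup p m * Poly_Mapping.lookup q k))"
    by (subst poly_xy_sum[of p], subst poly_xy_sum[of q])
      (simp add: sum_product Poly_Mapping.mult_single)
  also have "norm_xy \<dots> \<le> (\<Sum>m\<in>Poly_Mapping.keys p. \<Sum>k\<in>Poly_Mapping.keys q.
      cmod (Poly_Mapping.lookup p m) * cmod (Poly_Mapping.lookup q k))"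
    by (intro order_trans[OF norm_xy_sum] sum_mono) (simp add: norm_mult)
  also have "\<dots> = norm_xy p * norm_xy q"
    by (simp add: norm_xy_def sum_product)
  finally show ?thesis .
qed

section \<open>Division by the gradient of the Hamiltonian\<close>

text \<open>An upper bound on the degree survives sums, cancellation and the zero polynomial, for
  which an exact degree would force case distinctions.\<close>

definition deg_bound :: "nat \<Rightarrow> poly_xy \<Rightarrow> bool" where
  "deg_bound d p \<longleftrightarrow> (\<forall>m. d < fst m + snd m \<longrightarrow> Poly_Mapping.lookup p m = 0)"

lemma homogeneous_iff:
  "homogeneous d p \<longleftrightarrow> (\<forall>m. fst m + snd m \<noteq> d \<longrightarrow> Poly_Mapping.lookup p m = 0)"
  unfolding homogeneous_def by (auto simp: in_keys_iff)

lemma deg_boundD: "deg_bound d p \<Longrightarrow> m \<in> Poly_Mapping.keys p \<Longrightarrow> fst m + snd m \<le> d"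
  unfolding deg_bound_def in_keys_iff by (meson not_le)

lemma homogeneousD: "homogeneous d p \<Longrightarrow> m \<in> Poly_Mapping.keys p \<Longrightarrow> fst m + snd m = d"
  unfolding homogeneous_iff in_keys_iff by meson

lemma deg_bound_0 [simp]: "deg_bound d 0"
  by (simp add: deg_bound_def)

lemma deg_bound_add: "deg_bound d p \<Longrightarrow> deg_bound d q \<Longrightarrow> deg_bound d (p + q)"
  by (simp add: deg_bound_def lookup_add)

lemma deg_bound_diff: "deg_bound d p \<Longrightarrow> deg_bound d q \<Longrightarrow> deg_bound d (p - q)"
  by (simp add: deg_bound_def lookup_minus)

lemma deg_bound_mono: "deg_bound d p \<Longrightarrow> d \<le> e \<Longrightarrow> deg_bound e p"
  by (simp add: deg_bound_def)

lemma homogeneous_imp_deg_bound: "homogeneous d p \<Longrightarrow> deg_bound d p"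
  by (auto simp: deg_bound_def homogeneous_iff)

lemma keys_multD:
  assumes "m \<in> Poly_Mapping.keys (p * q)"
  obtains a b where "m = a + b" "a \<in> Poly_Mapping.keys p" "b \<in> Poly_Mapping.keys q"
  using assms Poly_Mapping.keys_mult[of p q] by auto

lemma deg_bound_mult:
  assumes "deg_bound d p" "deg_bound e q"
  shows "deg_bound (d + e) (p * q)"
  unfolding deg_bound_def
proof (intro allI impI)
  fix m :: "nat \<times> nat" assume m: "d + e < fst m + snd m"
  show "Poly_Mapping.lookup (p * q) m = 0"
  proof (rule ccontr)
    assume "Poly_Mapping.lookup (p * q) m \<noteq> 0"
    then obtain a b where "m = a + b" "a \<in> Poly_Mapping.keys p" "b \<in> Poly_Mapping.keys q"
      by (meson in_keys_iff keys_multD)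
    moreover from this have "fst a + snd a \<le> d" "fst b + snd b \<le> e"
      using assms by (auto dest: deg_boundD)
    ultimately show False
      using m by simp
  qed
qed

lemma homogeneous_mult:
  assumes "homogeneous d p" "homogeneous e q"
  shows "homogeneous (d + e) (p * q)"
  unfolding homogeneous_iff
proof (intro allI impI)
  fix m :: "nat \<times> nat" assume m: "fst m + snd m \<noteq> d + e"
  show "Poly_Mapping.lookup (p * q) m = 0"
  proof (rule ccontr)
    assume "Poly_Mapping.lookup (p * q) m \<noteq> 0"
    then obtain a b where "m = a + b" "a \<in> Poly_Mapping.keys p" "b \<in> Poly_Mapping.keys q"
      by (meson in_keys_iff keys_multD)
    moreover from this have "fst a + snd a = d" "fst b + snd b = e"
      using assms by (auto dest: homogeneousD)
    ultimately show False
      using m by simp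
  qed
qed

lemma homogeneous_sum: "(\<And>a. a \<in> A \<Longrightarrow> homogeneous d (f a)) \<Longrightarrow> homogeneous d (sum f A)"
  by (induction A rule: infinite_finite_induct) (auto simp: homogeneous_iff lookup_add)

lemma deg_bound_deriv:
  assumes "deg_bound d p"
  shows "deg_bound (d - 1) (deriv_x p)" "deg_bound (d - 1) (deriv_y p)"
  using assms by (auto simp: deg_bound_def lookup_deriv_x lookup_deriv_y)

text \<open>Differentiation multiplies each coefficient by an exponent, and no exponent exceeds the
  degree.\<close>

lemma norm_deriv_le:
  assumes "deg_bound d p"
  shows "norm_xy (deriv_x p) \<le> real d * norm_xy p" "norm_xy (deriv_y p) \<le> real d * norm_xy p"
proof -
  have b: "fst m + snd m \<le> d" if "m \<in> Poly_Mapping.keys p" for m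
    using assms that by (rule deg_boundD)
  have "norm_xy (deriv_x p) \<le> (\<Sum>m\<in>Poly_Mapping.keys p. real (fst m) * cmod (Poly_Mapping.lookup p m))"
    unfolding deriv_x_def case_prod_unfold by (rule order_trans[OF norm_xy_sum]) (simp add: norm_mult)
  also have "\<dots> \<le> (\<Sum>m\<in>Poly_Mapping.keys p. real d * cmod (Poly_Mapping.lookup p m))"
    using b by (intro sum_mono mult_right_mono) (auto dest!: b)
  also have "\<dots> = real d * norm_xy p"
    by (simp add: norm_xy_def sum_distrib_left)
  finally show "norm_xy (deriv_x p) \<le> real d * norm_xy p" .
  have "norm_xy (deriv_y p) \<le> (\<Sum>m\<in>Poly_Mapping.keys p. real (snd m) * cmod (Poly_Mapping.lookup p m))"
    unfolding deriv_y_def case_prod_unfold by (rule order_trans[OF norm_xy_sum]) (simp add: norm_mult)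
  also have "\<dots> \<le> (\<Sum>m\<in>Poly_Mapping.keys p. real d * cmod (Poly_Mapping.lookup p m))"
    using b by (intro sum_mono mult_right_mono) (auto dest!: b)
  also have "\<dots> = real d * norm_xy p"
    by (simp add: norm_xy_def sum_distrib_left)
  finally show "norm_xy (deriv_y p) \<le> real d * norm_xy p" .
qed

text \<open>Normalization speaks of degree \<open>2 * n - 1\<close> only. A monomial of higher
  degree has a monomial factor of exactly that degree, and multiplying by the complementary monomial
  does not increase the norm.\<close>

lemma normalized_pair_monomial:
  assumes "normalized_pair n a b" "2 * n - 1 \<le> fst m + snd m"
  shows "\<exists>u v. homogeneous (fst m + snd m - n) u \<and> homogeneous (fst m + snd m - n) v \<and>
    Poly_Mapping.single m c = a * u + b * v \<and> norm_xy u + norm_xy v \<le> cmod c"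
proof -
  \<comment> \<open>The factor of degree \<open>2 * n - 1\<close> takes as many powers of
    \<open>x\<close> as possible; the remainder, if any, fits into the powers of
    \<open>y\<close>.\<close>
  define i j where "i = min (fst m) (2 * n - 1)" and "j = 2 * n - 1 - i"
  define k where "k = (fst m - i, snd m - j)"
  have ij: "i + j = 2 * n - 1" "i \<le> fst m" "j \<le> snd m"
    using assms(2) by (auto simp: i_def j_def min_def)
  have "homogeneous (2 * n - 1) (Poly_Mapping.single (i, j) c)"
    using ij by (auto simp: homogeneous_iff lookup_single when_def)
  then obtain u v where uv: "homogeneous (n - 1) u" "homogeneous (n - 1) v"
    "Poly_Mapping.single (i, j) c = a * u + b * v" "norm_xy u + norm_xy v \<le> cmod c"
    using assms(1) unfolding normalized_pair_def norm_xy_single[of "(i, j)" c, symmetric] by blast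
  let ?k = "Poly_Mapping.single k (1::complex)"
  have hk: "homogeneous (fst m + snd m - (2 * n - 1)) ?k"
    using ij by (auto simp: homogeneous_iff lookup_single when_def k_def)
  have deg: "fst m + snd m - (2 * n - 1) + (n - 1) = fst m + snd m - n"
    using assms(2) by (cases n) auto
  have nk: "norm_xy (?k * w) \<le> norm_xy w" for w
    using norm_xy_mult[of ?k w] by simp
  have "Poly_Mapping.single m c = ?k * Poly_Mapping.single (i, j) c"
    using ij by (cases m) (simp add: Poly_Mapping.mult_single k_def)
  also have "\<dots> = a * (?k * u) + b * (?k * v)"
    by (simp add: uv(3) algebra_simps)
  finally have "Poly_Mapping.single m c = a * (?k * u) + b * (?k * v)" .
  moreover have "homogeneous (fst m + snd m - n) (?k * u)" "homogeneous (fst m + snd m - n) (?k * v)"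
    using homogeneous_mult[OF hk uv(1)] homogeneous_mult[OF hk uv(2)] by (simp_all only: deg)
  moreover have "norm_xy (?k * u) + norm_xy (?k * v) \<le> cmod c"
    using nk[of u] nk[of v] uv(4) by linarith
  ultimately show ?thesis
    by blast
qed

text \<open>The coefficient norm is the sum over the monomials, so the monomial estimates add up
  without loss.\<close>

lemma normalized_pair_homogeneous:
  assumes ab: "normalized_pair n a b" and g: "homogeneous d g" and d: "2 * n - 1 \<le> d"
  obtains u v where "homogeneous (d - n) u" "homogeneous (d - n) v"
    "g = a * u + b * v" "norm_xy u + norm_xy v \<le> norm_xy g"
proof -
  have deg: "fst m + snd m = d" if "m \<in> Poly_Mapping.keys g" for m
    using g that by (rule homogeneousD)
  then have "\<forall>m\<in>Poly_Mapping.keys g. \<exists>u v. homogeneous (d - n) u \<and> homogeneous (d - n) v \<and>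
    Poly_Mapping.single m (Poly_Mapping.lookup g m) = a * u + b * v \<and>
    norm_xy u + norm_xy v \<le> cmod (Poly_Mapping.lookup g m)"
    using normalized_pair_monomial[OF ab] d by metis
  then obtain u v where uv: "\<And>m. m \<in> Poly_Mapping.keys g \<Longrightarrow>
    homogeneous (d - n) (u m) \<and> homogeneous (d - n) (v m) \<and>
    Poly_Mapping.single m (Poly_Mapping.lookup g m) = a * u m + b * v m \<and>
    norm_xy (u m) + norm_xy (v m) \<le> cmod (Poly_Mapping.lookup g m)"
    by metis
  show ?thesis
  proof
    show "homogeneous (d - n) (\<Sum>m\<in>Poly_Mapping.keys g. u m)"
      "homogeneous (d - n) (\<Sum>m\<in>Poly_Mapping.keys g. v m)"
      using uv by (auto intro!: homogeneous_sum)
    show "g = a * (\<Sum>m\<in>Poly_Mapping.keys g. u m) + b * (\<Sum>m\<in>Poly_Mapping.keys g. v m)"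
      by (subst poly_xy_sum[of g]) (simp add: uv sum_distrib_left sum.distrib)
    have "norm_xy (\<Sum>m\<in>Poly_Mapping.keys g. u m) + norm_xy (\<Sum>m\<in>Poly_Mapping.keys g. v m)
      \<le> (\<Sum>m\<in>Poly_Mapping.keys g. norm_xy (u m) + norm_xy (v m))"
      using norm_xy_sum[of u] norm_xy_sum[of v] by (simp add: sum.distrib add_mono)
    also have "\<dots> \<le> norm_xy g"
      unfolding norm_xy_def[of g] using uv by (intro sum_mono) auto
    finally show "norm_xy (\<Sum>m\<in>Poly_Mapping.keys g. u m) + norm_xy (\<Sum>m\<in>Poly_Mapping.keys g. v m) \<le> norm_xy g" .
  qed
qed

definition hom_part :: "nat \<Rightarrow> poly_xy \<Rightarrow> poly_xy" where
  "hom_part d p = (\<Sum>m\<in>{m \<in> Poly_Mapping.keys p. fst m + snd m = d}.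
      Poly_Mapping.single m (Poly_Mapping.lookup p m))"

lemma lookup_hom_part:
  "Poly_Mapping.lookup (hom_part d p) m = (if fst m + snd m = d then Poly_Mapping.lookup p m else 0)"
  by (auto simp: hom_part_def lookup_sum lookup_single when_def in_keys_iff sum.delta)

lemma principal_part_eq: "principal_part p = hom_part (deg_xy p) p"
  by (simp add: principal_part_def hom_part_def case_prod_unfold)

lemma homogeneous_hom_part: "homogeneous d (hom_part d p)"
  by (simp add: homogeneous_iff lookup_hom_part)

text \<open>The two summands have disjoint supports. Equality rather than an inequality is what lets
  the division step charge the factor \<open>n\<close> to each part separately.\<close>

lemma norm_hom_part: "norm_xy (hom_part d p) + norm_xy (p - hom_part d p) = norm_xy p"
proof -
  let ?S = "Poly_Mapping.keys p"
  have "Poly_Mapping.keys (hom_part d p) \<subseteq> ?S" "Poly_Mapping.keys (p - hom_part d p) \<subseteq> ?S"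
    by (auto simp: in_keys_iff lookup_hom_part lookup_minus split: if_splits)
  then show ?thesis
    by (subst (1 2 3) norm_xy_superset[of ?S])
      (auto simp: sum.distrib[symmetric] lookup_hom_part lookup_minus intro!: sum.cong)
qed

lemma deg_bound_deg_xy: "deg_bound (deg_xy p) p"
  unfolding deg_bound_def
proof (intro allI impI)
  fix m :: "nat \<times> nat" assume "deg_xy p < fst m + snd m"
  moreover have "fst m + snd m \<le> deg_xy p" if "m \<in> Poly_Mapping.keys p"
    unfolding deg_xy_def using that by (intro Max_ge) (auto simp: case_prod_unfold)
  ultimately show "Poly_Mapping.lookup p m = 0"
    by (auto simp: in_keys_iff)
qed

text \<open>Each step divides the top homogeneous part by the gradient of the principal part; since
  the lower order terms of \<open>H\<close> have norm at most 1 and degree at most \<open>n\<close>, the norm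
  grows at most by the factor \<open>n\<close>.\<close>

lemma division_by_gradient:
  assumes n: "n \<ge> 1" and H: "H = K + h" and K: "normalized_pair n (deriv_x K) (deriv_y K)"
    and h: "deg_bound n h" "norm_xy h \<le> 1"
  shows "deg_bound (2 * n - 2 + k) g \<Longrightarrow> \<exists>u v r. g = deriv_x H * u + deriv_y H * v + r \<and>
    deg_bound (2 * n - 2) r \<and> deg_bound (n + k - 2) u \<and> deg_bound (n + k - 2) v \<and>
    norm_xy r \<le> real n ^ k * norm_xy g \<and>
    norm_xy u + norm_xy v \<le> (\<Sum>i<k. real n ^ i) * norm_xy g"
proof (induction k arbitrary: g)
  case 0
  then show ?case
    by (intro exI[of _ 0] exI[of _ g]) auto
next
  case (Suc k)
  define d where "d = 2 * n - 2 + Suc k"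
  define t where "t = hom_part d g"
  have "2 * n - 1 \<le> d" and dn: "d - n = n + k - 1"
    using n by (auto simp: d_def)
  then obtain u v where uv: "homogeneous (d - n) u" "homogeneous (d - n) v"
    "t = deriv_x K * u + deriv_y K * v" "norm_xy u + norm_xy v \<le> norm_xy t"
    using normalized_pair_homogeneous[OF K homogeneous_hom_part[of d g]] unfolding t_def by metis
  \<comment> \<open>The quotients belong to the gradient of \<open>K\<close>; using them with the
    gradient of \<open>H\<close> leaves cross terms, whose degree bound is one below the degree of
    \<open>t\<close>.\<close>
  define g' where "g' = (g - t) - (deriv_x h * u + deriv_y h * v)"
  have g': "g = deriv_x H * u + deriv_y H * v + g'"
    by (simp add: g'_def H uv(3) algebra_simps)
  have hx: "norm_xy (deriv_x h) \<le> real n" "norm_xy (deriv_y h) \<le> real n"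
    using norm_deriv_le[OF h(1)] h(2) mult_left_mono[OF h(2), of "real n"] by force+
  have "norm_xy (deriv_x h * u) \<le> real n * norm_xy u" "norm_xy (deriv_y h * v) \<le> real n * norm_xy v"
    using norm_xy_mult[of "deriv_x h" u] norm_xy_mult[of "deriv_y h" v] hx
      mult_right_mono[OF hx(1) norm_xy_nonneg[of u]] mult_right_mono[OF hx(2) norm_xy_nonneg[of v]]
    by linarith+
  then have "norm_xy (deriv_x h * u + deriv_y h * v) \<le> real n * (norm_xy u + norm_xy v)"
    using norm_xy_triangle[of "deriv_x h * u" "deriv_y h * v"] by (simp add: algebra_simps)
  also have "\<dots> \<le> real n * norm_xy t"
    using uv(4) by (rule mult_left_mono) simp
  finally have "norm_xy g' \<le> norm_xy (g - t) + real n * norm_xy t"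
    unfolding g'_def by (intro order_trans[OF norm_xy_diff] add_left_mono)
  \<comment> \<open>Because \<open>n \<ge> 1\<close>, the part untouched by this step is absorbed by
    the same factor \<open>n\<close>.\<close>
  moreover have "norm_xy (g - t) \<le> real n * norm_xy (g - t)"
    using n mult_right_mono[of 1 "real n" "norm_xy (g - t)"] by simp
  ultimately have ng': "norm_xy g' \<le> real n * norm_xy g"
    unfolding norm_hom_part[of d g, symmetric] t_def distrib_left by linarith
  have dt: "deg_bound (2 * n - 2 + k) (g - t)"
    using Suc.prems by (auto simp: deg_bound_def t_def d_def lookup_minus lookup_hom_part)
  have "deg_bound (n - 1 + (n + k - 1)) (deriv_x h * u)" "deg_bound (n - 1 + (n + k - 1)) (deriv_y h * v)"
    using deg_bound_deriv[OF h(1)] uv(1,2)[THEN homogeneous_imp_deg_bound] unfolding dn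
    by (auto intro!: deg_bound_mult)
  then have "deg_bound (2 * n - 2 + k) (deriv_x h * u + deriv_y h * v)"
    using n by (intro deg_bound_add deg_bound_mono[where e = "2 * n - 2 + k"]) auto
  then have "deg_bound (2 * n - 2 + k) g'"
    using dt unfolding g'_def by (rule deg_bound_diff[rotated])
  from Suc.IH[OF this] obtain u' v' r where IH: "g' = deriv_x H * u' + deriv_y H * v' + r"
    "deg_bound (2 * n - 2) r" "deg_bound (n + k - 2) u'" "deg_bound (n + k - 2) v'"
    "norm_xy r \<le> real n ^ k * norm_xy g'"
    "norm_xy u' + norm_xy v' \<le> (\<Sum>i<k. real n ^ i) * norm_xy g'"
    by blast
  \<comment> \<open>The present quotients cost at most \<open>norm_xy g\<close>; the later ones
    divide \<open>g'\<close>, whose norm may be \<open>n\<close> times larger.\<close>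
  have S: "(\<Sum>i<Suc k. real n ^ i) = 1 + (\<Sum>i<k. real n ^ i) * real n"
    by (simp add: sum.lessThan_Suc_shift sum_distrib_left mult.commute del: sum.lessThan_Suc)
  show ?case
  proof (intro exI conjI)
    show "g = deriv_x H * (u + u') + deriv_y H * (v + v') + r"
      by (subst g') (simp add: IH(1) algebra_simps)
    show "deg_bound (2 * n - 2) r" by fact
    show "deg_bound (n + Suc k - 2) (u + u')" "deg_bound (n + Suc k - 2) (v + v')"
      using IH(3,4) uv(1,2) dn
      by (auto intro!: deg_bound_add intro: deg_bound_mono dest!: homogeneous_imp_deg_bound)
    show "norm_xy r \<le> real n ^ Suc k * norm_xy g"
      using order_trans[OF IH(5) mult_left_mono[OF ng', of "real n ^ k"]] by (simp add: algebra_simps)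
    have "norm_xy t \<le> norm_xy g"
      using norm_hom_part[of d g] norm_xy_nonneg[of "g - t"] unfolding t_def by linarith
    moreover have "(\<Sum>i<k. real n ^ i) * norm_xy g' \<le> (\<Sum>i<k. real n ^ i) * (real n * norm_xy g)"
      by (rule mult_left_mono[OF ng']) (simp add: sum_nonneg)
    ultimately show "norm_xy (u + u') + norm_xy (v + v') \<le> (\<Sum>i<Suc k. real n ^ i) * norm_xy g"
      unfolding S using norm_xy_triangle[of u u'] norm_xy_triangle[of v v'] uv(4) IH(6)
      by (simp add: algebra_simps)
  qed
qed

section \<open>Euler's identity and the division of multiples of the Hamiltonian\<close>

definition euler_op :: "poly_xy \<Rightarrow> poly_xy" where
  "euler_op p = Poly_Mapping.single (1, 0) 1 * deriv_x p + Poly_Mapping.single (0, 1) 1 * deriv_y p"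

text \<open>Euler's identity coefficient by coefficient, without homogeneity, since it is applied to
  the lower order part of \<open>H\<close> as well as to the principal part.\<close>

lemma lookup_euler_op:
  "Poly_Mapping.lookup (euler_op p) m = of_nat (fst m + snd m) * Poly_Mapping.lookup p m"
proof (induction p rule: poly_xy_induct)
  case (single k c)
  obtain a b where [simp]: "k = (a, b)" by (metis surj_pair)
  have "euler_op (Poly_Mapping.single k c) = Poly_Mapping.single k (of_nat (a + b) * c)"
    by (cases a; cases b)
      (simp_all add: euler_op_def deriv_xy_single Poly_Mapping.mult_single single_add[symmetric] algebra_simps)
  then show ?case
    by (auto simp: lookup_single when_def)
next
  case (add p q)
  have "euler_op (p + q) = euler_op p + euler_op q"
    by (simp add: euler_op_def algebra_simps)
  then show ?case
    using add by (simp add: lookup_add algebra_simps)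
qed


text \<open>Euler's identity writes the principal part times the monomial as an explicit combination
  of the derivatives of \<open>H\<close>, up to terms from the lower part. What remains to be
  divided has degree at most \<open>d + n\<close> instead of \<open>d + n + 1\<close> and norm at
  most 1, so \<open>d + 2 - n\<close> steps suffice. With \<open>\<eta> = - v dx + u dy\<close> the
  quotient part is \<open>dH \<and> \<eta>\<close>, and \<open>deriv_x u + deriv_y v\<close> is the
  coefficient of \<open>d\<eta>\<close>; hence the bound on that sum.\<close>

lemma hamiltonian_division:
  assumes n: "n \<ge> 1" and bal: "balanced n H" and d: "d = fst m + snd m" "d \<le> 2 * n - 2"
    and k: "k = d + 2 - n"
  shows "\<exists>u v r. H * Poly_Mapping.single m 1 = deriv_x H * u + deriv_y H * v + r \<and>
    deg_bound (2 * n - 2) r \<and> deg_bound (2 * n - 1) u \<and> deg_bound (2 * n - 1) v \<and>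
    norm_xy r \<le> real n ^ k \<and>
    norm_xy (deriv_x u + deriv_y v) \<le> (real d + 2) / (real n + 1) + real d * (\<Sum>i<k. real n ^ i)"
proof -
  define K h where "K = principal_part H" and "h = H - K"
  have H: "H = K + h"
    by (simp add: h_def)
  have degH: "deg_xy H = n + 1" and K: "normalized_pair n (deriv_x K) (deriv_y K)"
    and nh: "norm_xy h \<le> 1"
    using bal by (auto simp: balanced_def quasimonic_def K_def h_def)
  have Kl: "Poly_Mapping.lookup K m = (if fst m + snd m = n + 1 then Poly_Mapping.lookup H m else 0)" for m
    by (simp add: K_def principal_part_eq lookup_hom_part degH)
  have h: "deg_bound n h"
    using deg_bound_deg_xy[of H] by (auto simp: deg_bound_def h_def lookup_minus Kl degH)
  let ?c = "1 / of_nat (n + 1) :: complex"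
  let ?C = "Poly_Mapping.single (0, 0) ?c :: poly_xy"
  have Cl: "Poly_Mapping.lookup (?C * p) m = ?c * Poly_Mapping.lookup p m" for p m
    by (induction p rule: poly_xy_induct)
      (auto simp: Poly_Mapping.mult_single lookup_single when_def lookup_add algebra_simps
        zero_prod_def[symmetric])
  have nz: "(of_nat (n + 1) :: complex) \<noteq> 0"
    by (simp only: of_nat_eq_0_iff)
  have KE: "K = ?C * euler_op K"
  proof (rule poly_mapping_eqI)
    fix m
    show "Poly_Mapping.lookup K m = Poly_Mapping.lookup (?C * euler_op K) m"
    proof (cases "fst m + snd m = n + 1")
      case True
      show ?thesis
        unfolding Cl lookup_euler_op True using nz by (simp del: of_nat_add of_nat_Suc)
    next
      case False
      show ?thesis
        unfolding Cl lookup_euler_op Kl using False by simp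
    qed
  qed
  \<comment> \<open>The error of Euler's identity when the gradient of \<open>K\<close> is replaced
    by that of \<open>H\<close>. A coefficient of degree \<open>e \<le> n\<close> is scaled by
    \<open>1 - e / (n + 1)\<close>, which lies between 0 and 1, so \<open>b\<close> is no larger
    than \<open>h\<close>.\<close>
  define b where "b = h - ?C * euler_op h"
  have bl: "Poly_Mapping.lookup b m = (1 - of_nat (fst m + snd m) / of_nat (n + 1)) * Poly_Mapping.lookup h m" for m
    unfolding b_def lookup_minus Cl lookup_euler_op by (simp add: left_diff_distrib)
  have "norm_xy b \<le> norm_xy h"
  proof -
    have "Poly_Mapping.keys b \<subseteq> Poly_Mapping.keys h"
      by (auto simp: in_keys_iff bl)
    then have "norm_xy b = (\<Sum>m\<in>Poly_Mapping.keys h. cmod (Poly_Mapping.lookup b m))"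
      by (intro norm_xy_superset) auto
    also have "\<dots> \<le> (\<Sum>m\<in>Poly_Mapping.keys h. cmod (Poly_Mapping.lookup h m))"
    proof (rule sum_mono)
      fix m assume "m \<in> Poly_Mapping.keys h"
      then have m: "fst m + snd m \<le> n"
        using h by (auto dest: deg_boundD)
      have "(1 - of_nat (fst m + snd m) / of_nat (n + 1) :: complex)
        = of_real (1 - real (fst m + snd m) / real (n + 1))"
        by simp
      then have "cmod (1 - of_nat (fst m + snd m) / of_nat (n + 1)) = \<bar>1 - real (fst m + snd m) / real (n + 1)\<bar>"
        by (metis norm_of_real)
      also have "\<dots> \<le> 1"
        using m by (simp add: abs_le_iff divide_simps)
      finally show "cmod (Poly_Mapping.lookup b m) \<le> cmod (Poly_Mapping.lookup h m)"
        unfolding bl norm_mult by (rule mult_left_le_one_le[rotated 2]) auto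
    qed
    finally show ?thesis
      by (simp add: norm_xy_def)
  qed
  then have nb: "norm_xy b \<le> 1"
    using nh by simp
  have db: "deg_bound n b"
    using h by (auto simp: deg_bound_def bl)
  let ?f = "Poly_Mapping.single m 1 :: poly_xy"
  let ?u0 = "?C * (Poly_Mapping.single (1, 0) 1 * ?f)"
  let ?v0 = "?C * (Poly_Mapping.single (0, 1) 1 * ?f)"
  have "deg_bound d ?f"
    by (simp add: deg_bound_def lookup_single when_def d)
  then have "deg_bound (d + n) (?f * b)"
    by (rule deg_bound_mult[OF _ db])
  then have "deg_bound (2 * n - 2 + k) (?f * b)"
    \<comment> \<open>Equality of the two bounds if \<open>d + 2 \<ge> n\<close>; otherwise
      \<open>k = 0\<close> and the product is already small enough to be the remainder.\<close>
    by (rule deg_bound_mono) (use d k in auto)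
  from division_by_gradient[OF n H K h nh this]
  obtain u v r where uv: "?f * b = deriv_x H * u + deriv_y H * v + r"
    "deg_bound (2 * n - 2) r" "deg_bound (n + k - 2) u" "deg_bound (n + k - 2) v"
    "norm_xy r \<le> real n ^ k * norm_xy (?f * b)"
    "norm_xy u + norm_xy v \<le> (\<Sum>i<k. real n ^ i) * norm_xy (?f * b)"
    by blast
  have nfb: "norm_xy (?f * b) \<le> 1"
    using norm_xy_mult[of ?f b] nb by simp
  have nr: "norm_xy r \<le> real n ^ k"
    using uv(5) nfb mult_left_mono[OF nfb, of "real n ^ k"] by simp
  have S: "0 \<le> (\<Sum>i<k. real n ^ i)"
    by (simp add: sum_nonneg)
  have nuv: "norm_xy u + norm_xy v \<le> (\<Sum>i<k. real n ^ i)"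
    using uv(6) mult_left_mono[OF nfb S] by simp
  have Hf: "H * ?f = deriv_x H * (?u0 + u) + deriv_y H * (?v0 + v) + r"
  proof -
    have "H * ?f = ?f * (?C * euler_op K) + ?f * h"
      using KE H by (metis mult.commute distrib_left)
    also have "\<dots> = deriv_x H * ?u0 + deriv_y H * ?v0 + ?f * b"
      by (simp add: b_def H euler_op_def algebra_simps)
    finally show ?thesis
      unfolding uv(1) by (simp add: algebra_simps)
  qed
  obtain i j where m: "m = (i, j)" by (metis surj_pair)
  \<comment> \<open>The divergence of the monomial times the vector field \<open>(x, y)\<close>:
    \<open>d\<close> comes from the monomial, 2 from the two coordinates.\<close>
  have du0: "deriv_x ?u0 + deriv_y ?v0 = Poly_Mapping.single m (of_nat (d + 2) * ?c)"
    by (simp add: m d Poly_Mapping.mult_single deriv_xy_single single_add[symmetric] algebra_simps add_divide_distrib)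
  have nd0: "norm_xy (deriv_x ?u0 + deriv_y ?v0) = (real d + 2) / (real n + 1)"
    unfolding du0 norm_xy_single norm_mult norm_divide norm_of_nat by (simp add: algebra_simps)
  have du: "norm_xy (deriv_x u + deriv_y v) \<le> real d * (\<Sum>i<k. real n ^ i)"
  proof -
    have "norm_xy (deriv_x u + deriv_y v) \<le> real (n + k - 2) * (norm_xy u + norm_xy v)"
      using norm_xy_triangle[of "deriv_x u" "deriv_y v"] norm_deriv_le(1)[OF uv(3)] norm_deriv_le(2)[OF uv(4)]
      by (simp add: distrib_left)
    also have "\<dots> \<le> real (n + k - 2) * (\<Sum>i<k. real n ^ i)"
      by (rule mult_left_mono[OF nuv]) simp
    \<comment> \<open>For \<open>k > 0\<close> the degree bound \<open>n + k - 2\<close> of the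
      quotients is exactly \<open>d\<close>; for \<open>k = 0\<close> the sum is empty.\<close>
    also have "\<dots> = real d * (\<Sum>i<k. real n ^ i)"
    proof (cases "k = 0")
      case False
      then have "n + k - 2 = d"
        using k by simp
      then show ?thesis by simp
    qed auto
    finally show ?thesis .
  qed
  have db0: "deg_bound (2 * n - 1) ?u0" "deg_bound (2 * n - 1) ?v0"
    using d n by (auto simp: m Poly_Mapping.mult_single deg_bound_def lookup_single when_def)
  have kn: "n + k - 2 \<le> 2 * n - 1"
    using d k by auto
  show ?thesis
  proof (intro exI conjI)
    show "H * ?f = deriv_x H * (?u0 + u) + deriv_y H * (?v0 + v) + r" by (rule Hf)
    show "deg_bound (2 * n - 2) r" "norm_xy r \<le> real n ^ k" by fact+
    show "deg_bound (2 * n - 1) (?u0 + u)" "deg_bound (2 * n - 1) (?v0 + v)"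
      using db0 uv(3,4) kn by (auto intro!: deg_bound_add intro: deg_bound_mono)
    have eq: "deriv_x (?u0 + u) + deriv_y (?v0 + v) = (deriv_x ?u0 + deriv_y ?v0) + (deriv_x u + deriv_y v)"
      by simp
    show "norm_xy (deriv_x (?u0 + u) + deriv_y (?v0 + v))
      \<le> (real d + 2) / (real n + 1) + real d * (\<Sum>i<k. real n ^ i)"
      unfolding eq by (rule order_trans[OF norm_xy_triangle add_mono[OF eq_refl[OF nd0] du]])
  qed
qed

text \<open>Integrate \<open>P\<close> in \<open>x\<close>. By closedness the defect in the second
  component is free of \<open>x\<close>, so integrating it in \<open>y\<close> leaves the first
  component unchanged.\<close>

lemma closed_one_form_exact:
  assumes "deriv_x Q = deriv_y P"
  obtains G where "deriv_x G = P" "deriv_y G = Q"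
proof -
  have "\<exists>F. deriv_x F = P"
  proof (induction P rule: poly_xy_induct)
    case (single m c)
    show ?case
      by (rule exI[of _ "Poly_Mapping.single (Suc (fst m), snd m) (c / of_nat (Suc (fst m)))"])
        (simp add: deriv_xy_single field_simps del: of_nat_Suc)
  next
    case (add p q)
    then show ?case
      by (metis deriv_xy_add(1))
  qed
  then obtain F where F: "deriv_x F = P" ..
  define R where "R = Q - deriv_y F"
  have "deriv_x (deriv_y F) = deriv_y (deriv_x F)"
    by (rule poly_xy_eqI) (simp add: lookup_deriv_x lookup_deriv_y mult.left_commute)
  then have dR: "deriv_x R = 0"
    using assms F by (simp add: R_def)
  have R0: "fst m = 0" if "m \<in> Poly_Mapping.keys R" for m
  proof (rule ccontr)
    assume "fst m \<noteq> 0"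
    then obtain i j where m: "m = (Suc i, j)"
      by (metis surjective_pairing not0_implies_Suc)
    have "of_nat (Suc i) * Poly_Mapping.lookup R (Suc i, j) = 0"
      using dR lookup_deriv_x[of R i j] by simp
    then show False
      using that by (simp add: m in_keys_iff del: of_nat_Suc)
  qed
  define G where "G = (\<Sum>m\<in>Poly_Mapping.keys R.
    Poly_Mapping.single (fst m, Suc (snd m)) (Poly_Mapping.lookup R m / of_nat (Suc (snd m))))"
  have "deriv_x G = 0"
    unfolding G_def deriv_xy_sum by (rule sum.neutral) (simp add: deriv_xy_single R0)
  moreover have "deriv_y G = R"
    unfolding G_def deriv_xy_sum
    by (subst (2) poly_xy_sum) (rule sum.cong, auto simp add: deriv_xy_single field_simps simp del: of_nat_Suc)
  ultimately show ?thesis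
    using that[of "F + G"] F by (simp add: R_def)
qed

section \<open>The norm estimate\<close>

text \<open>The first three terms of the binomial expansion, multiplied by \<open>x\<^sup>2\<close>
  so that no negative exponent appears for small \<open>m\<close>.\<close>

lemma power_Suc_lower_bound:
  fixes x :: real
  assumes "x \<ge> 0"
  shows "x\<^sup>2 * (x + 1) ^ m \<ge> x ^ m * (x\<^sup>2 + real m * x + real m * (real m - 1) / 2)"
proof (induction m)
  case (Suc m)
  have "x ^ Suc m * (x\<^sup>2 + real (Suc m) * x + real (Suc m) * (real (Suc m) - 1) / 2)
    = x ^ m * ((x + 1) * (x\<^sup>2 + real m * x + real m * (real m - 1) / 2) - real m * (real m - 1) / 2)"
    by (simp add: field_simps power2_eq_square)
  also have "\<dots> \<le> x ^ m * ((x + 1) * (x\<^sup>2 + real m * x + real m * (real m - 1) / 2))"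
  proof (rule mult_left_mono)
    have "0 \<le> real m * (real m - 1)"
      by (cases m) auto
    then show "(x + 1) * (x\<^sup>2 + real m * x + real m * (real m - 1) / 2) - real m * (real m - 1) / 2
      \<le> (x + 1) * (x\<^sup>2 + real m * x + real m * (real m - 1) / 2)"
      by simp
  qed (use assms in simp)
  also have "\<dots> \<le> (x + 1) * (x\<^sup>2 * (x + 1) ^ m)"
    using mult_left_mono[OF Suc, of "x + 1"] assms by (simp add: algebra_simps)
  finally show ?case
    by (simp add: algebra_simps)
qed simp

text \<open>One factor \<open>d + 1\<close> counts monomials, the other bounds the ratio of
  coefficients; \<open>n ^ (d + 2 - n)\<close> is the row of \<open>A\<close> and the remaining
  summands are the row of \<open>B\<close>. Since \<open>(d + 2) / (n + 1) \<le> 2\<close> and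
  \<open>d\<close> times the geometric sum is at most \<open>2 * (n ^ k - 1)\<close>, the two rows
  together cost at most \<open>3 * n ^ k\<close>.\<close>

lemma degree_sum_estimate:
  assumes "n \<ge> 1"
  shows "(\<Sum>d\<le>2 * n - 2. (real d + 1) * ((real d + 1) *
      (real n ^ (d + 2 - n) + ((real d + 2) / (real n + 1) + real d * (\<Sum>i<d + 2 - n. real n ^ i)))))
    \<le> 6 * real n * (real n + 1) ^ (n + 1)" (is "(\<Sum>d\<le>_. ?f d) \<le> _")
proof -
  define x where "x = real n"
  have x1: "x \<ge> 1"
    using assms by (simp add: x_def)
  have f: "?f d \<le> 3 * (2 * x - 1)\<^sup>2 * x ^ (d + 2 - n)" if "d \<in> {..2 * n - 2}" for d
  proof -
    define k where "k = d + 2 - n"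
    have d: "real d \<le> 2 * (x - 1)"
      using that assms by (simp add: x_def flip: of_nat_diff)
    have "2 * (x - 1) * (\<Sum>i<k. x ^ i) = 2 * (x ^ k - 1)"
      unfolding mult.assoc by (simp only: power_diff_1_eq)
    moreover have "real d * (\<Sum>i<k. x ^ i) \<le> 2 * (x - 1) * (\<Sum>i<k. x ^ i)"
      using x1 by (intro mult_right_mono d sum_nonneg) auto
    ultimately have "real d * (\<Sum>i<k. x ^ i) \<le> 2 * (x ^ k - 1)"
      by simp
    moreover have "(real d + 2) / (x + 1) \<le> 2"
      using d x1 by (simp add: divide_simps)
    moreover have "y + (q + s) \<le> 3 * y" if "s \<le> 2 * (y - 1)" "q \<le> 2" for y q s :: real
      using that by (simp add: algebra_simps)
    ultimately have "x ^ k + ((real d + 2) / (x + 1) + real d * (\<Sum>i<k. x ^ i)) \<le> 3 * x ^ k"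
      by blast
    then have "(real d + 1)\<^sup>2 * (x ^ k + ((real d + 2) / (x + 1) + real d * (\<Sum>i<k. x ^ i)))
      \<le> (2 * x - 1)\<^sup>2 * (3 * x ^ k)"
      using d x1 by (intro mult_mono) (auto intro!: power_mono add_nonneg_nonneg sum_nonneg mult_nonneg_nonneg)
    then show ?thesis
      by (simp add: k_def x_def power2_eq_square mult.assoc mult.left_commute)
  qed
  define P where "P = (\<Sum>d\<le>2 * n - 2. x ^ (d + 2 - n))"
  have le: "(\<Sum>d\<le>2 * n - 2. ?f d) \<le> 3 * (2 * x - 1)\<^sup>2 * P"
    unfolding P_def sum_distrib_left[of "3 * (2 * x - 1)\<^sup>2"] by (rule sum_mono) (rule f)
  \<comment> \<open>The geometric sum is evaluated after multiplication by \<open>x - 1\<close>,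
    which is why \<open>n = 1\<close> is separate.\<close>
  have "3 * (2 * x - 1)\<^sup>2 * P \<le> 6 * x * (x + 1) ^ (n + 1)"
  proof (cases "n = 1")
    case True
    then show ?thesis
      by (simp add: P_def x_def power2_eq_square)
  next
    case False
    then have n2: "n \<ge> 2" and x2: "x \<ge> 2"
      using assms by (auto simp: x_def)
    \<comment> \<open>Degrees below \<open>n - 1\<close> need no division step and contribute 1
      each; the degrees from \<open>n - 1\<close> to \<open>2 * n - 2\<close> give the exponents 1
      to \<open>n\<close>.\<close>
    have "P = (\<Sum>d<n - 1. x ^ (d + 2 - n)) + (\<Sum>d=n - 1..2 * n - 2. x ^ (d + 2 - n))"
      unfolding P_def using n2
      by (subst sum.union_disjoint[symmetric]) (auto intro!: sum.cong)
    also have "(\<Sum>d<n - 1. x ^ (d + 2 - n)) = (\<Sum>d<n - 1. 1)"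
      by (rule sum.cong) auto
    also have "\<dots> = x - 1"
      using n2 by (simp add: x_def)
    also have "(\<Sum>d=n - 1..2 * n - 2. x ^ (d + 2 - n)) = (\<Sum>i<n. x * x ^ i)"
      by (rule sum.reindex_bij_witness[of _ "\<lambda>i. i + (n - 1)" "\<lambda>d. d - (n - 1)"])
        (use n2 in \<open>auto simp flip: power_Suc intro!: arg_cong[where f = "\<lambda>k. x ^ k"]\<close>)
    also have "\<dots> = x * (\<Sum>i<n. x ^ i)"
      by (rule sum_distrib_left[symmetric])
    finally have Px: "P = (x - 1) + x * (\<Sum>i<n. x ^ i)" .
    have "(x - 1) * P = (x - 1)\<^sup>2 + x * ((x - 1) * (\<Sum>i<n. x ^ i))"
      unfolding Px by (simp add: power2_eq_square algebra_simps)
    also have "(x - 1) * (\<Sum>i<n. x ^ i) = x ^ n - 1"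
      by (simp add: power_diff_1_eq)
    finally have P: "(x - 1) * P = (x - 1)\<^sup>2 + x ^ (n + 1) - x"
      by (simp add: algebra_simps)
    have "x\<^sup>2 * (x + 1) ^ (n + 1) \<ge> x ^ (n + 1) * (x\<^sup>2 + (x + 1) * x + (x + 1) * x / 2)"
      using power_Suc_lower_bound[of x "n + 1"] x1 by (simp add: x_def algebra_simps)
    also have "x ^ (n + 1) * (x\<^sup>2 + (x + 1) * x + (x + 1) * x / 2) = x\<^sup>2 * (x ^ n * (5 * x + 3) / 2)"
      by (simp add: power2_eq_square field_simps)
    finally have bin: "(x + 1) ^ (n + 1) \<ge> x ^ n * (5 * x + 3) / 2"
      using x1 by simp
    \<comment> \<open>The polynomial \<open>x\<^sup>2 + 2 * x - 4\<close> is
      \<open>(5 * x + 3) * (x - 1) - (2 * x - 1)\<^sup>2\<close>, the room that the binomial bound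
      leaves beyond the leading term. From \<open>n = 3\<close> on, \<open>x ^ (n + 1)\<close>
      dominates \<open>x ^ 4\<close>; \<open>n = 2\<close> is computed.\<close>
    have slack: "(2 * x - 1)\<^sup>2 * (x - 1)\<^sup>2 \<le> (x\<^sup>2 + 2 * x - 4) * x ^ (n + 1)"
    proof (cases "n = 2")
      case True
      then show ?thesis by (simp add: x_def power2_eq_square)
    next
      case False
      then have "x ^ 4 \<le> x ^ (n + 1)"
        using n2 x1 by (intro power_increasing) auto
      moreover have "(2 * x - 1)\<^sup>2 * (x - 1)\<^sup>2 \<le> (2 * x)\<^sup>2 * x\<^sup>2"
        using x1 by (intro mult_mono power_mono) auto
      moreover have "(2 * x)\<^sup>2 * x\<^sup>2 = 4 * x ^ 4"
        by (simp add: power2_eq_square power4_eq_xxxx)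
      moreover have "4 * x ^ (n + 1) \<le> (x\<^sup>2 + 2 * x - 4) * x ^ (n + 1)"
        using x2 power_mono[OF x2, of 2] by (intro mult_right_mono) auto
      ultimately show ?thesis
        by linarith
    qed
    have "(x - 1) * (3 * (2 * x - 1)\<^sup>2 * P) = 3 * ((2 * x - 1)\<^sup>2 * ((x - 1) * P))"
      by (simp add: algebra_simps)
    also have "\<dots> = 3 * ((2 * x - 1)\<^sup>2 * (x - 1)\<^sup>2 + (2 * x - 1)\<^sup>2 * x ^ (n + 1) - (2 * x - 1)\<^sup>2 * x)"
      unfolding P by (simp add: algebra_simps)
    also have "\<dots> \<le> 3 * ((x\<^sup>2 + 2 * x - 4) * x ^ (n + 1) + (2 * x - 1)\<^sup>2 * x ^ (n + 1))"
    proof -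
      have "3 * (s + m - w) \<le> 3 * (r + m)" if "s \<le> r" "0 \<le> w" for s m w r :: real
        using that by simp
      moreover have "0 \<le> (2 * x - 1)\<^sup>2 * x"
        using x1 by simp
      ultimately show ?thesis
        using slack by blast
    qed
    also have "\<dots> = 3 * ((5 * x + 3) * (x - 1) * x ^ (n + 1))"
      by (simp add: power2_eq_square algebra_simps)
    also have "\<dots> = (x - 1) * (6 * x * (x ^ n * (5 * x + 3) / 2))"
      by (simp add: field_simps)
    also have "\<dots> \<le> (x - 1) * (6 * x * (x + 1) ^ (n + 1))"
      using x1 by (intro mult_left_mono bin) auto
    finally show ?thesis
      using x2 by simp
  qed
  with le show ?thesis
    unfolding x_def by (rule order_trans)
qed

section \<open>From monomials to the entries of the matrices\<close>

lemma finite_monomials: "finite {m :: nat \<times> nat. fst m + snd m \<le> N}"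
  by (rule finite_subset[of _ "{..N} \<times> {..N}"]) auto

lemma sum_monomials:
  fixes g :: "nat \<Rightarrow> real"
  shows "(\<Sum>m | fst m + snd m \<le> N. g (fst m + snd m)) = (\<Sum>d\<le>N. (real d + 1) * g d)"
proof -
  have "(\<Sum>m | fst m + snd m \<le> N. g (fst m + snd m))
    = (\<Sum>d\<le>N. \<Sum>m | m \<in> {m :: nat \<times> nat. fst m + snd m \<le> N} \<and> fst m + snd m = d. g (fst m + snd m))"
    by (rule sum.group[symmetric]) (auto simp: finite_monomials)
  also have "\<dots> = (\<Sum>d\<le>N. (real d + 1) * g d)"
  proof (rule sum.cong[OF refl])
    fix d assume d: "d \<in> {..N}"
    define S where "S = {m. m \<in> {m :: nat \<times> nat. fst m + snd m \<le> N} \<and> fst m + snd m = d}"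
    have "S = (\<lambda>i. (i, d - i)) ` {..d}"
      using d by (auto simp: image_iff S_def)
    then have card: "card S = Suc d"
      by (simp add: card_image inj_on_def)
    have "(\<Sum>m\<in>S. g (fst m + snd m)) = (\<Sum>m\<in>S. g d)"
      by (rule sum.cong) (auto simp: S_def)
    then show "(\<Sum>m | m \<in> {m :: nat \<times> nat. fst m + snd m \<le> N} \<and> fst m + snd m = d. g (fst m + snd m))
      = (real d + 1) * g d"
      unfolding S_def[symmetric] by (simp add: card)
  qed
  finally show ?thesis .
qed

lemma single_eq_single_iff:
  "b' \<noteq> 0 \<Longrightarrow> Poly_Mapping.single a b = Poly_Mapping.single a' b' \<longleftrightarrow> a = a' \<and> b = b'"
  by (metis lookup_single_eq lookup_single_not_eq)

text \<open>The coefficient is, up to a factor of modulus 1, the exponent removed by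
  differentiation. It is a positive integer as \<open>c\<close> is nonzero, and exceeds the exponent
  left in \<open>m\<close> by one.\<close>

lemma unit_monomial_form_coefficient:
  assumes "unit_monomial_one_form \<omega>" "ext_deriv \<omega> = Poly_Mapping.single m c" "c \<noteq> 0"
  shows "1 \<le> cmod c" "cmod c \<le> real (fst m + snd m) + 1"
proof -
  from assms(1) obtain k b where b: "cmod b = 1"
    "\<omega> = (Poly_Mapping.single k b, 0) \<or> \<omega> = (0, Poly_Mapping.single k b)"
    by (auto simp: unit_monomial_one_form_def)
  have "1 \<le> cmod c \<and> cmod c \<le> real (fst m + snd m) + 1"
    using b(2)
  proof
    assume "\<omega> = (Poly_Mapping.single k b, 0)"
    then have "Poly_Mapping.single (fst k, snd k - 1) (- (of_nat (snd k) * b)) = Poly_Mapping.single m c"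
      using assms(2) by (simp add: ext_deriv_def deriv_xy_single single_uminus)
    then have "m = (fst k, snd k - 1)" "c = - (of_nat (snd k) * b)"
      using single_eq_single_iff[OF assms(3)] by metis+
    then show ?thesis
      using assms(3) b(1) by (auto simp: norm_mult)
  next
    assume "\<omega> = (0, Poly_Mapping.single k b)"
    then have "Poly_Mapping.single (fst k - 1, snd k) (of_nat (fst k) * b) = Poly_Mapping.single m c"
      using assms(2) by (simp add: ext_deriv_def deriv_xy_single)
    then have "m = (fst k - 1, snd k)" "c = of_nat (fst k) * b"
      using single_eq_single_iff[OF assms(3)] by metis+
    then show ?thesis
      using assms(3) b(1) by (auto simp: norm_mult)
  qed
  then show "1 \<le> cmod c" "cmod c \<le> real (fst m + snd m) + 1"
    by auto
qed

lemma deg_xy_single: "c \<noteq> 0 \<Longrightarrow> deg_xy (Poly_Mapping.single m c) = fst m + snd m"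
  by (simp add: deg_xy_def case_prod_unfold)

text \<open>Coefficient extraction needs exponents instead of forms. The bound drops by 2 because a
  2-form has degree two more than its coefficient.\<close>

lemma monomial_two_forms_exponents:
  assumes n: "n \<ge> 1" and bij: "bij_betw \<Omega> I (monomial_two_forms (2 * n))"
  obtains m where "bij_betw m I {m. fst m + snd m \<le> 2 * n - 2}"
    "\<And>i. i \<in> I \<Longrightarrow> \<Omega> i = Poly_Mapping.single (m i) 1"
proof -
  let ?E = "{m :: nat \<times> nat. fst m + snd m \<le> 2 * n - 2}"
  let ?s = "\<lambda>m :: nat \<times> nat. Poly_Mapping.single m (1 :: complex)"
  have "?s ` ?E = monomial_two_forms (2 * n)"
    using n by (auto simp: monomial_two_forms_def deg_two_form_def deg_xy_single image_iff)
  moreover have "inj_on ?s ?E"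
    by (auto simp: inj_on_def single_eq_single_iff)
  ultimately have s: "bij_betw ?s ?E (monomial_two_forms (2 * n))"
    by (simp add: bij_betw_def)
  let ?m = "\<lambda>i. the_inv_into ?E ?s (\<Omega> i)"
  show ?thesis
  proof
    show "bij_betw ?m I ?E"
      using bij_betw_trans[OF bij bij_betw_the_inv_into[OF s]] by (simp add: o_def)
    show "\<Omega> i = ?s (?m i)" if "i \<in> I" for i
      using f_the_inv_into_f_bij_betw[OF s, of "\<Omega> i"] bij_betw_apply[OF bij that] by simp
  qed
qed

lemma poly_xy_sum_reindex:
  fixes p :: poly_xy
  assumes "bij_betw m I {m. fst m + snd m \<le> N}" "deg_bound N p"
  shows "p = (\<Sum>j\<in>I. Poly_Mapping.single (m j) (Poly_Mapping.lookup p (m j)))"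
    "(\<Sum>j\<in>I. cmod (Poly_Mapping.lookup p (m j))) = norm_xy p"
proof -
  let ?E = "{m :: nat \<times> nat. fst m + snd m \<le> N}"
  have E: "finite ?E" "Poly_Mapping.keys p \<subseteq> ?E"
    using assms(2) by (auto simp: finite_monomials dest: deg_boundD)
  have "p = (\<Sum>m\<in>?E. Poly_Mapping.single m (Poly_Mapping.lookup p m))"
    by (subst poly_xy_sum, rule sum.mono_neutral_left) (use E in \<open>auto simp: in_keys_iff\<close>)
  then show "p = (\<Sum>j\<in>I. Poly_Mapping.single (m j) (Poly_Mapping.lookup p (m j)))"
    using sum.reindex_bij_betw[OF assms(1), of "\<lambda>m. Poly_Mapping.single m (Poly_Mapping.lookup p m)"] by simp
  show "(\<Sum>j\<in>I. cmod (Poly_Mapping.lookup p (m j))) = norm_xy p"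
    using sum.reindex_bij_betw[OF assms(1), of "\<lambda>m. cmod (Poly_Mapping.lookup p m)"]
      norm_xy_superset[OF E] by simp
qed

text \<open>Division controls the row of each form, whereas the matrix norm is a maximum over
  columns; the sum of all entries dominates every column and splits into rows.\<close>

lemma mat_norm_le_sum:
  assumes "N > 0"
  shows "mat_norm (mat N N (\<lambda>(i, j). f i j)) \<le> (\<Sum>i<N. \<Sum>j<N. cmod (f i j))"
proof -
  have "(\<Sum>i<N. cmod (f i j)) \<le> (\<Sum>i<N. \<Sum>j<N. cmod (f i j))" if "j < N" for j
    using that by (intro sum_mono member_le_sum) auto
  then show ?thesis
    unfolding mat_norm_def using assms by (intro Max.boundedI) auto
qed

text \<open>The whole algebraic content: with \<open>\<eta> = - v dx + u dy\<close>, the three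
  identities say \<open>H d\<omega> = dH \<and> \<eta> + \<Sum> a d\<omega>\<close> and
  \<open>\<eta> = \<Sum> b \<omega> + dG\<close>. Cycles do not occur yet.\<close>

lemma picard_fuchs_coefficients:
  fixes \<omega> :: "nat \<Rightarrow> one_form"
  assumes n: "n \<ge> 1" and H: "balanced n H" and \<nu>: "\<nu> = n * (2 * n - 1)"
    and bij: "bij_betw \<Omega> {..<\<nu>} (monomial_two_forms (2 * n))"
    and unit: "\<And>i. i < \<nu> \<Longrightarrow> unit_monomial_one_form (\<omega> i)"
    and ext: "\<And>i. i < \<nu> \<Longrightarrow> \<exists>c. c \<noteq> 0 \<and> ext_deriv (\<omega> i) = Poly_Mapping.single 0 c * \<Omega> i"
  obtains a b :: "nat \<Rightarrow> nat \<Rightarrow> complex" and u v G :: "nat \<Rightarrow> poly_xy"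
  where "\<And>i. i < \<nu> \<Longrightarrow> H * ext_deriv (\<omega> i) = deriv_x H * u i + deriv_y H * v i +
      (\<Sum>j<\<nu>. Poly_Mapping.single 0 (a i j) * ext_deriv (\<omega> j))"
    "\<And>i. i < \<nu> \<Longrightarrow> - v i = (\<Sum>j<\<nu>. Poly_Mapping.single 0 (b i j) * fst (\<omega> j)) + deriv_x (G i)"
    "\<And>i. i < \<nu> \<Longrightarrow> u i = (\<Sum>j<\<nu>. Poly_Mapping.single 0 (b i j) * snd (\<omega> j)) + deriv_y (G i)"
    "mat_norm (mat \<nu> \<nu> (\<lambda>(i, j). a i j)) + mat_norm (mat \<nu> \<nu> (\<lambda>(i, j). b i j))
      \<le> 6 * real n * (real n + 1) ^ (n + 1)"
proof -
  obtain m where m: "bij_betw m {..<\<nu>} {m. fst m + snd m \<le> 2 * n - 2}"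
    and \<Omega>: "\<And>i. i < \<nu> \<Longrightarrow> \<Omega> i = Poly_Mapping.single (m i) 1"
    using monomial_two_forms_exponents[OF n bij] by (metis lessThan_iff)
  have "\<forall>i<\<nu>. \<exists>c. c \<noteq> 0 \<and> ext_deriv (\<omega> i) = Poly_Mapping.single (m i) c"
    using ext \<Omega> by (auto simp: Poly_Mapping.mult_single zero_prod_def[symmetric])
  then obtain c where c: "\<And>i. i < \<nu> \<Longrightarrow> c i \<noteq> 0"
    "\<And>i. i < \<nu> \<Longrightarrow> ext_deriv (\<omega> i) = Poly_Mapping.single (m i) (c i)"
    by metis
  define d where "d i = fst (m i) + snd (m i)" for i
  have d: "d i \<le> 2 * n - 2" if "i < \<nu>" for i
    using bij_betw_apply[OF m, of i] that by (simp add: d_def)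
  have c1: "1 \<le> cmod (c i)" "cmod (c i) \<le> real (d i) + 1" if "i < \<nu>" for i
    using unit_monomial_form_coefficient[OF unit[OF that] c(2)[OF that] c(1)[OF that]] by (auto simp: d_def)
  define T where "T e = (real e + 2) / (real n + 1) + real e * (\<Sum>i<e + 2 - n. real n ^ i)" for e
  have "\<forall>i<\<nu>. \<exists>u v r. H * Poly_Mapping.single (m i) 1 = deriv_x H * u + deriv_y H * v + r \<and>
    deg_bound (2 * n - 2) r \<and> deg_bound (2 * n - 1) u \<and> deg_bound (2 * n - 1) v \<and>
    norm_xy r \<le> real n ^ (d i + 2 - n) \<and> norm_xy (deriv_x u + deriv_y v) \<le> T (d i)"
    unfolding T_def using hamiltonian_division[OF n H d_def d refl] by blast
  then obtain u v r where uvr: "\<And>i. i < \<nu> \<Longrightarrow>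
    H * Poly_Mapping.single (m i) 1 = deriv_x H * u i + deriv_y H * v i + r i \<and>
    deg_bound (2 * n - 2) (r i) \<and> deg_bound (2 * n - 1) (u i) \<and> deg_bound (2 * n - 1) (v i) \<and>
    norm_xy (r i) \<le> real n ^ (d i + 2 - n) \<and> norm_xy (deriv_x (u i) + deriv_y (v i)) \<le> T (d i)"
    by metis
  \<comment> \<open>The coefficient of \<open>d\<eta>\<close> for
    \<open>\<eta> = - v dx + u dy\<close>.\<close>
  define e where "e i = deriv_x (u i) + deriv_y (v i)" for i
  have e: "deg_bound (2 * n - 2) (e i)" if "i < \<nu>" for i
    unfolding e_def using uvr[OF that] deg_bound_deriv[of "2 * n - 1"]
    by (auto intro!: deg_bound_add simp: numeral_2_eq_2)
  let ?C = "\<lambda>c. Poly_Mapping.single (0 :: nat \<times> nat) (c :: complex)"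
  \<comment> \<open>The monomial expansion of the remainder, rewritten in terms of
    \<open>d\<omega>\<close>: the factor \<open>c i\<close> turns the monomial 2-form into
    \<open>d\<omega>\<close> on the left, and \<open>1 / c j\<close> does so on the right.\<close>
  define a where "a i j = c i * Poly_Mapping.lookup (r i) (m j) / c j" for i j
  define b where "b i j = c i * Poly_Mapping.lookup (e i) (m j) / c j" for i j
  have expand: "?C (c i) * p = (\<Sum>j<\<nu>. ?C (c i * Poly_Mapping.lookup p (m j) / c j) * ext_deriv (\<omega> j))"
    if "deg_bound (2 * n - 2) p" for i p
  proof -
    have "?C (c i) * p = (\<Sum>j<\<nu>. ?C (c i) * Poly_Mapping.single (m j) (Poly_Mapping.lookup p (m j)))"
      using arg_cong[OF poly_xy_sum_reindex(1)[OF m that], of "\<lambda>q. ?C (c i) * q"]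
      by (simp only: sum_distrib_left)
    also have "\<dots> = (\<Sum>j<\<nu>. ?C (c i * Poly_Mapping.lookup p (m j) / c j) * ext_deriv (\<omega> j))"
      by (rule sum.cong) (simp_all add: c Poly_Mapping.mult_single)
    finally show ?thesis .
  qed
  have 1: "H * ext_deriv (\<omega> i) = deriv_x H * (?C (c i) * u i) + deriv_y H * (?C (c i) * v i) +
      (\<Sum>j<\<nu>. ?C (a i j) * ext_deriv (\<omega> j))" if i: "i < \<nu>" for i
  proof -
    have "H * ext_deriv (\<omega> i) = ?C (c i) * (H * Poly_Mapping.single (m i) 1)"
      by (simp add: c(2)[OF i] Poly_Mapping.mult_single mult.left_commute)
    also have "\<dots> = deriv_x H * (?C (c i) * u i) + deriv_y H * (?C (c i) * v i) + ?C (c i) * r i"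
      using uvr[OF i] by (simp add: algebra_simps)
    finally show ?thesis
      using expand[of "r i" i] uvr[OF i] by (simp add: a_def)
  qed
  have "\<forall>i. \<exists>G. i < \<nu> \<longrightarrow> - (?C (c i) * v i) = (\<Sum>j<\<nu>. ?C (b i j) * fst (\<omega> j)) + deriv_x G \<and>
    ?C (c i) * u i = (\<Sum>j<\<nu>. ?C (b i j) * snd (\<omega> j)) + deriv_y G"
  proof
    fix i
    let ?P = "- (?C (c i) * v i) - (\<Sum>j<\<nu>. ?C (b i j) * fst (\<omega> j))"
    let ?Q = "?C (c i) * u i - (\<Sum>j<\<nu>. ?C (b i j) * snd (\<omega> j))"
    have dC: "deriv_x (?C k) = 0" "deriv_y (?C k) = 0" for k
      by (simp_all add: deriv_xy_single)
    have dPQ: "deriv_x ?Q - deriv_y ?P = ?C (c i) * e i - (\<Sum>j<\<nu>. ?C (b i j) * ext_deriv (\<omega> j))"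
      by (simp add: deriv_xy_mult dC deriv_xy_sum e_def ext_deriv_def distrib_left right_diff_distrib sum_subtractf)
    have "deriv_x ?Q = deriv_y ?P" if i: "i < \<nu>"
      \<comment> \<open>By the choice of \<open>b\<close> the form
        \<open>\<eta> - \<Sum> b \<omega>\<close> is closed, hence exact; it becomes
        \<open>dG\<close>.\<close>
      using dPQ expand[OF e[OF i], of i] by (simp add: b_def)
    then have "\<exists>G. i < \<nu> \<longrightarrow> deriv_x G = ?P \<and> deriv_y G = ?Q"
      by (cases "i < \<nu>") (rule closed_one_form_exact[of ?Q ?P], auto)
    then obtain G where "i < \<nu> \<longrightarrow> deriv_x G = ?P \<and> deriv_y G = ?Q" ..
    then show "\<exists>G. i < \<nu> \<longrightarrow> - (?C (c i) * v i) = (\<Sum>j<\<nu>. ?C (b i j) * fst (\<omega> j)) + deriv_x G \<and>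
        ?C (c i) * u i = (\<Sum>j<\<nu>. ?C (b i j) * snd (\<omega> j)) + deriv_y G"
      by (intro exI[of _ G]) simp
  qed
  from choice[OF this] obtain G where G: "\<And>i. i < \<nu> \<Longrightarrow> - (?C (c i) * v i) = (\<Sum>j<\<nu>. ?C (b i j) * fst (\<omega> j)) + deriv_x (G i) \<and>
    ?C (c i) * u i = (\<Sum>j<\<nu>. ?C (b i j) * snd (\<omega> j)) + deriv_y (G i)"
    by blast
  \<comment> \<open>Because \<open>1 \<le> cmod (c j)\<close>, the ratio of the coefficients has
    modulus at most \<open>cmod (c i) \<le> d i + 1\<close>.\<close>
  have row: "(\<Sum>j<\<nu>. cmod (c i * Poly_Mapping.lookup p (m j) / c j)) \<le> (real (d i) + 1) * norm_xy p"
    if "i < \<nu>" "deg_bound (2 * n - 2) p" for i p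
  proof -
    have "(\<Sum>j<\<nu>. cmod (c i * Poly_Mapping.lookup p (m j) / c j))
      \<le> (\<Sum>j<\<nu>. (real (d i) + 1) * cmod (Poly_Mapping.lookup p (m j)))"
    proof (rule sum_mono)
      fix j assume "j \<in> {..<\<nu>}"
      then have "cmod (c i * Poly_Mapping.lookup p (m j)) / cmod (c j) \<le> cmod (c i * Poly_Mapping.lookup p (m j)) / 1"
        using c1 c by (intro divide_left_mono) auto
      also have "\<dots> \<le> (real (d i) + 1) * cmod (Poly_Mapping.lookup p (m j))"
        using c1[OF that(1)] by (simp add: norm_mult mult_right_mono)
      finally show "cmod (c i * Poly_Mapping.lookup p (m j) / c j)
        \<le> (real (d i) + 1) * cmod (Poly_Mapping.lookup p (m j))"
        by (simp add: norm_divide)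
    qed
    also have "\<dots> = (real (d i) + 1) * norm_xy p"
      using poly_xy_sum_reindex(2)[OF m that(2)] by (simp flip: sum_distrib_left)
    finally show ?thesis .
  qed
  have "\<nu> > 0"
    using n \<nu> by simp
  then have "mat_norm (mat \<nu> \<nu> (\<lambda>(i, j). a i j)) + mat_norm (mat \<nu> \<nu> (\<lambda>(i, j). b i j))
    \<le> (\<Sum>i<\<nu>. \<Sum>j<\<nu>. cmod (a i j)) + (\<Sum>i<\<nu>. \<Sum>j<\<nu>. cmod (b i j))"
    by (intro add_mono mat_norm_le_sum)
  also have "\<dots> = (\<Sum>i<\<nu>. (\<Sum>j<\<nu>. cmod (a i j)) + (\<Sum>j<\<nu>. cmod (b i j)))"
    by (rule sum.distrib[symmetric])
  also have "\<dots> \<le> (\<Sum>i<\<nu>. (real (d i) + 1) * (real n ^ (d i + 2 - n) + T (d i)))"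
  proof (rule sum_mono)
    fix i assume "i \<in> {..<\<nu>}"
    then have i: "i < \<nu>" by simp
    have "(\<Sum>j<\<nu>. cmod (a i j)) \<le> (real (d i) + 1) * real n ^ (d i + 2 - n)"
      unfolding a_def using uvr[OF i] by (intro order_trans[OF row[OF i]] mult_left_mono) auto
    moreover have "(\<Sum>j<\<nu>. cmod (b i j)) \<le> (real (d i) + 1) * T (d i)"
      unfolding b_def using uvr[OF i] e[OF i]
      by (intro order_trans[OF row[OF i]] mult_left_mono) (auto simp: e_def)
    ultimately show "(\<Sum>j<\<nu>. cmod (a i j)) + (\<Sum>j<\<nu>. cmod (b i j))
      \<le> (real (d i) + 1) * (real n ^ (d i + 2 - n) + T (d i))"
      by (simp add: distrib_left)
  qed
  also have "\<dots> = (\<Sum>m | fst m + snd m \<le> 2 * n - 2. (real (fst m + snd m) + 1) *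
      (real n ^ (fst m + snd m + 2 - n) + T (fst m + snd m)))"
    unfolding d_def by (rule sum.reindex_bij_betw[OF m])
  also have "\<dots> = (\<Sum>d\<le>2 * n - 2. (real d + 1) * ((real d + 1) * (real n ^ (d + 2 - n) + T d)))"
    by (rule sum_monomials)
  also have "\<dots> \<le> 6 * real n * (real n + 1) ^ (n + 1)"
    unfolding T_def by (rule degree_sum_estimate[OF n])
  finally have norm: "mat_norm (mat \<nu> \<nu> (\<lambda>(i, j). a i j)) + mat_norm (mat \<nu> \<nu> (\<lambda>(i, j). b i j))
    \<le> 6 * real n * (real n + 1) ^ (n + 1)" .
  show ?thesis
    by (rule that[OF 1 conjunct1[OF G] conjunct2[OF G] norm])
qed

section \<open>Primitives along the level curves\<close>

lemma deriv_xy_commute: "deriv_x (deriv_y p) = deriv_y (deriv_x p)"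
  by (rule poly_xy_eqI) (simp add: lookup_deriv_x lookup_deriv_y mult.left_commute)

abbreviation eval_dx :: "poly_xy \<Rightarrow> complex \<times> complex \<Rightarrow> complex" where
  "eval_dx p \<equiv> eval_xy (deriv_x p)"

abbreviation eval_dy :: "poly_xy \<Rightarrow> complex \<times> complex \<Rightarrow> complex" where
  "eval_dy p \<equiv> eval_xy (deriv_y p)"

text \<open>Where the \<open>y\<close>-derivative is nonzero, \<open>(x, H)\<close> are local
  coordinates and \<open>Y\<close> is the second component of the inverse map. \<open>W\<close>
  corresponds exactly to a product of two discs, so every level curve meets it either in a graph
  over the whole disc or not at all.\<close>

locale implicit_chart =
  fixes H :: poly_xy and z :: "complex \<times> complex" and r R :: real
    and Y :: "complex \<times> complex \<Rightarrow> complex" and W :: "(complex \<times> complex) set"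
  assumes open_W: "open W" and z_in_W: "z \<in> W" and r_pos: "r > 0" and R_pos: "R > 0"
    and dy_nonzero: "p \<in> W \<Longrightarrow> eval_dy H p \<noteq> 0"
    and W_coords: "p \<in> W \<Longrightarrow> fst p \<in> ball (fst z) r" "p \<in> W \<Longrightarrow> eval_xy H p \<in> ball (eval_xy H z) R"
      "p \<in> W \<Longrightarrow> Y (fst p, eval_xy H p) = snd p"
    and lift_in_W: "x \<in> ball (fst z) r \<Longrightarrow> t \<in> ball (eval_xy H z) R \<Longrightarrow> (x, Y (x, t)) \<in> W"
    and eval_lift: "x \<in> ball (fst z) r \<Longrightarrow> t \<in> ball (eval_xy H z) R \<Longrightarrow> eval_xy H (x, Y (x, t)) = t"
    and Y_deriv: "x \<in> ball (fst z) r \<Longrightarrow> t \<in> ball (eval_xy H z) R \<Longrightarrow>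
      (Y has_derivative (\<lambda>h. (snd h - eval_dx H (x, Y (x, t)) * fst h) / eval_dy H (x, Y (x, t)))) (at (x, t))"

lemma implicit_chart_exists:
  assumes z: "eval_dy H z \<noteq> 0" and e: "e > 0"
  obtains r R Y W where "implicit_chart H z r R Y W" "W \<subseteq> ball z e"
proof -
  define f where "f p = (fst p, eval_xy H p)" for p
  define f' where "f' p = Blinfun (\<lambda>h. (fst h, eval_dx H p * fst h + eval_dy H p * snd h))" for p
  have bl: "bounded_linear (\<lambda>h. (fst h, c * fst h + d * snd h))" for c d :: complex
    by (intro bounded_linear_Pair bounded_linear_add bounded_linear_fst bounded_linear_snd
        bounded_linear_compose[OF bounded_linear_mult_right])
  have f'_app: "blinfun_apply (f' p) = (\<lambda>h. (fst h, eval_dx H p * fst h + eval_dy H p * snd h))" for p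
    unfolding f'_def by (rule bounded_linear_Blinfun_apply[OF bl])
  define U where "U = ball z e \<inter> {p. eval_dy H p \<noteq> 0}"
  have "open {p. eval_dy H p \<noteq> 0}"
    by (intro open_Collect_neq continuous_intros)
  then have U: "open U" "z \<in> U" "U \<subseteq> ball z e" "\<And>p. p \<in> U \<Longrightarrow> eval_dy H p \<noteq> 0"
    using z e by (auto simp: U_def)
  have der: "(f has_derivative blinfun_apply (f' p)) (at p)" for p
    unfolding f'_app f_def
    by (intro has_derivative_Pair eval_xy_has_derivative has_derivative_fst has_derivative_ident)
  have cont: "continuous_on U f'"
  proof (rule continuous_on_blinfun_componentwise)
    show "continuous_on U (\<lambda>x. blinfun_apply (f' x) i)" for i
      unfolding f'_app by (intro continuous_intros)
  qed
  \<comment> \<open>Inverse of the Jacobian of \<open>f\<close> at \<open>z\<close>, whose rows are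
    \<open>(1, 0)\<close> and the gradient of \<open>H\<close>.\<close>
  define invf where "invf = Blinfun (\<lambda>h. (fst h, (- eval_dx H z / eval_dy H z) * fst h + (1 / eval_dy H z) * snd h))"
  have invf: "blinfun_apply invf = (\<lambda>h. (fst h, (- eval_dx H z / eval_dy H z) * fst h + (1 / eval_dy H z) * snd h))"
    unfolding invf_def by (rule bounded_linear_Blinfun_apply[OF bl])
  have inv: "invf o\<^sub>L f' z = id_blinfun"
    using z by (intro blinfun_eqI) (simp add: invf f'_app field_simps prod_eq_iff)
  obtain U' V g g' where IFT: "open U'" "U' \<subseteq> U" "z \<in> U'" "open V" "f z \<in> V" "homeomorphism U' V f g"
    "\<And>y. y \<in> V \<Longrightarrow> (g has_derivative (g' y)) (at y)"
    "\<And>y. y \<in> V \<Longrightarrow> g' y = Hilbert_Choice.inv (blinfun_apply (f' (g y)))"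
    using inverse_function_theorem[OF U(1) der cont U(2) inv] by metis
  obtain A B where AB: "open A" "open B" "f z \<in> A \<times> B" "A \<times> B \<subseteq> V"
    using open_prod_elim[OF IFT(4,5)] by metis
  obtain r R where rR: "r > 0" "R > 0" "ball (fst z) r \<subseteq> A" "ball (eval_xy H z) R \<subseteq> B"
    using AB(3) openE[OF AB(1), of "fst z"] openE[OF AB(2), of "eval_xy H z"]
    unfolding f_def mem_Times_iff fst_conv snd_conv by metis
  \<comment> \<open>Shrinking to a product of balls makes each level a graph over a convex
    set.\<close>
  define S where "S = ball (fst z) r \<times> ball (eval_xy H z) R"
  have S: "S \<subseteq> V" "open S" "f z \<in> S"
    using AB rR by (auto simp: S_def open_Times f_def)
  define Y where "Y q = snd (g q)" for q
  define W where "W = U' \<inter> f -` S"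
  have g: "g q \<in> U'" "f (g q) = q" "g q = (fst q, Y q)" if "q \<in> S" for q
  proof -
    have "q \<in> V"
      using that S by blast
    then show "g q \<in> U'" and fg: "f (g q) = q"
      using IFT(6) by (auto simp: homeomorphism_def)
    then show "g q = (fst q, Y q)"
      by (metis Y_def f_def fst_conv prod.collapse)
  qed
  have gf: "g (f p) = p" if "p \<in> U'" for p
    using IFT(6) that by (auto simp: homeomorphism_def)
  have WU: "p \<in> W \<Longrightarrow> p \<in> U" for p
    using IFT(2) by (auto simp: W_def)
  have "implicit_chart H z r R Y W"
  proof
    have "continuous_on UNIV f"
      unfolding f_def by (intro continuous_intros)
    then show "open W"
      unfolding W_def by (intro open_Int IFT(1) open_vimage S)
    show "z \<in> W"
      using IFT(3) S by (simp add: W_def)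
    show "r > 0" "R > 0" by fact+
    show "eval_dy H p \<noteq> 0" if "p \<in> W" for p
      using that by (intro U(4) WU)
    show "fst p \<in> ball (fst z) r" "eval_xy H p \<in> ball (eval_xy H z) R" if "p \<in> W" for p
      using that by (auto simp: W_def S_def f_def)
    show "Y (fst p, eval_xy H p) = snd p" if "p \<in> W" for p
      using gf[of p] that by (simp add: W_def f_def Y_def)
    fix x t assume "x \<in> ball (fst z) r" "t \<in> ball (eval_xy H z) R"
    then have q: "(x, t) \<in> S"
      by (simp add: S_def)
    show xW: "(x, Y (x, t)) \<in> W"
      using g[OF q] q by (simp add: W_def)
    show "eval_xy H (x, Y (x, t)) = t"
      using g[OF q] by (simp add: f_def)
    have dy: "eval_dy H (x, Y (x, t)) \<noteq> 0"
      using xW by (intro U(4) WU)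
    have "g' (x, t) = Hilbert_Choice.inv (blinfun_apply (f' (x, Y (x, t))))"
      using IFT(8)[of "(x, t)"] q S g[OF q] by auto
    \<comment> \<open>The inverse function theorem is applied over the reals; this formula is
      complex linear, which makes \<open>Y\<close> holomorphic in each variable.\<close>
    also have "\<dots> = (\<lambda>h. (fst h, (snd h - eval_dx H (x, Y (x, t)) * fst h) / eval_dy H (x, Y (x, t))))"
      using dy by (intro inv_unique_comp) (auto simp: f'_app fun_eq_iff field_simps)
    finally have "(g has_derivative (\<lambda>h. (fst h, (snd h - eval_dx H (x, Y (x, t)) * fst h) / eval_dy H (x, Y (x, t))))) (at (x, t))"
      using IFT(7)[of "(x, t)"] q S by auto
    from has_derivative_snd[OF this]
    show "(Y has_derivative (\<lambda>h. (snd h - eval_dx H (x, Y (x, t)) * fst h) / eval_dy H (x, Y (x, t)))) (at (x, t))"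
      by (simp add: Y_def[abs_def])
  qed
  moreover have "W \<subseteq> ball z e"
    using IFT(2) U(3) by (auto simp: W_def)
  ultimately show ?thesis
    using that by blast
qed

context implicit_chart
begin

definition "B = ball (fst z) r"
definition "T = ball (eval_xy H z) R"

definition lift :: "complex \<Rightarrow> complex \<Rightarrow> complex \<times> complex" where
  "lift t x = (x, Y (x, t))"

lemma B_T: "open B" "convex B" "fst z \<in> B" "open T" "convex T"
  using r_pos R_pos by (auto simp: B_def T_def)

lemma W_lift: "p \<in> W \<Longrightarrow> fst p \<in> B" "p \<in> W \<Longrightarrow> eval_xy H p \<in> T" "p \<in> W \<Longrightarrow> lift (eval_xy H p) (fst p) = p"
  using W_coords by (auto simp: B_def T_def lift_def)

lemma lift_W: "x \<in> B \<Longrightarrow> t \<in> T \<Longrightarrow> lift t x \<in> W" "x \<in> B \<Longrightarrow> t \<in> T \<Longrightarrow> eval_xy H (lift t x) = t"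
  "x \<in> B \<Longrightarrow> t \<in> T \<Longrightarrow> eval_dy H (lift t x) \<noteq> 0"
  using lift_in_W eval_lift dy_nonzero by (auto simp: B_def T_def lift_def)

lemma continuous_on_Y: "continuous_on (B \<times> T) Y"
  using Y_deriv has_derivative_continuous
  by (fastforce intro!: continuous_at_imp_continuous_on simp: B_def T_def)

lemma continuous_on_lift:
  assumes "continuous_on S f" "continuous_on S g" "\<And>s. s \<in> S \<Longrightarrow> f s \<in> T" "\<And>s. s \<in> S \<Longrightarrow> g s \<in> B"
  shows "continuous_on S (\<lambda>s. lift (f s) (g s))"
  unfolding lift_def
  by (intro continuous_intros continuous_on_compose2[OF continuous_on_Y]) (use assms in auto)

text \<open>Implicit differentiation: \<open>dy/dx = - H_x / H_y\<close> along a level curve, and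
  \<open>dy/dt = 1 / H_y\<close> across the level curves at fixed \<open>x\<close>.\<close>

lemma along_lift:
  assumes g: "(g has_derivative (\<lambda>h. a * fst h + b * snd h)) (at (lift t x))" and xt: "x \<in> B" "t \<in> T"
  shows "((\<lambda>x. g (lift t x)) has_field_derivative a - b * eval_dx H (lift t x) / eval_dy H (lift t x)) (at x)"
    "((\<lambda>t. g (lift t x)) has_field_derivative b / eval_dy H (lift t x)) (at t)"
proof -
  note Y = Y_deriv[OF xt[unfolded B_def T_def], folded lift_def]
  let ?Hx = "eval_dx H (lift t x)" and ?Hy = "eval_dy H (lift t x)"
  have "((\<lambda>x. (x, t)) has_derivative (\<lambda>h. (h, 0))) (at x)"
    by (intro has_derivative_Pair has_derivative_ident has_derivative_const)
  from has_derivative_compose[of "\<lambda>x. (x, t)" "\<lambda>h. (h, 0)" x UNIV Y, OF this Y]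
  have "((\<lambda>x. lift t x) has_derivative (\<lambda>h. (h, (0 - ?Hx * h) / ?Hy))) (at x)"
    unfolding lift_def fst_conv snd_conv by (rule has_derivative_Pair[OF has_derivative_ident])
  from has_derivative_compose[OF this g]
  show "((\<lambda>x. g (lift t x)) has_field_derivative a - b * ?Hx / ?Hy) (at x)"
    unfolding has_field_derivative_def by (rule has_derivative_eq_rhs) (auto simp: field_simps)
  have "((\<lambda>t. (x, t)) has_derivative (\<lambda>h. (0, h))) (at t)"
    by (intro has_derivative_Pair has_derivative_ident has_derivative_const)
  from has_derivative_compose[of "\<lambda>t. (x, t)" "\<lambda>h. (0, h)" t UNIV Y, OF this Y]
  have "((\<lambda>t. lift t x) has_derivative (\<lambda>h. (0, (h - ?Hx * 0) / ?Hy))) (at t)"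
    unfolding lift_def fst_conv snd_conv by (rule has_derivative_Pair[OF has_derivative_const])
  from has_derivative_compose[OF this g]
  show "((\<lambda>t. g (lift t x)) has_field_derivative b / ?Hy) (at t)"
    unfolding has_field_derivative_def by (rule has_derivative_eq_rhs) (auto simp: field_simps)
qed


text \<open>The restriction of \<open>\<omega>\<close> to a level curve as a multiple of
  \<open>dx\<close>, obtained by substituting \<open>dy = - (H_x / H_y) dx\<close>.\<close>

definition res :: "one_form \<Rightarrow> complex \<times> complex \<Rightarrow> complex" where
  "res \<omega> p = eval_xy (fst \<omega>) p - eval_xy (snd \<omega>) p * eval_dx H p / eval_dy H p"

text \<open>This and \<open>res_y\<close> are the partial derivatives of
  \<open>res \<omega>\<close>, expanded by the quotient rule.\<close>

definition res_x :: "one_form \<Rightarrow> complex \<times> complex \<Rightarrow> complex" where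
  "res_x \<omega> p = eval_dx (fst \<omega>) p
    - (eval_dx (snd \<omega>) p * eval_dx H p + eval_xy (snd \<omega>) p * eval_dx (deriv_x H) p) / eval_dy H p
    + eval_xy (snd \<omega>) p * eval_dx H p * eval_dx (deriv_y H) p / (eval_dy H p)\<^sup>2"

definition res_y :: "one_form \<Rightarrow> complex \<times> complex \<Rightarrow> complex" where
  "res_y \<omega> p = eval_dy (fst \<omega>) p
    - (eval_dy (snd \<omega>) p * eval_dx H p + eval_xy (snd \<omega>) p * eval_dy (deriv_x H) p) / eval_dy H p
    + eval_xy (snd \<omega>) p * eval_dx H p * eval_dy (deriv_y H) p / (eval_dy H p)\<^sup>2"

lemma res_has_derivative:
  assumes "eval_dy H p \<noteq> 0"
  shows "(res \<omega> has_derivative (\<lambda>h. res_x \<omega> p * fst h + res_y \<omega> p * snd h)) (at p)"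
  unfolding res_def[abs_def]
  by (rule has_derivative_eq_rhs, (rule derivative_intros eval_xy_has_derivative assms)+)
    (use assms in \<open>auto simp: res_x_def res_y_def fun_eq_iff field_simps power2_eq_square\<close>)

lemma continuous_on_res:
  "continuous_on S f \<Longrightarrow> (\<And>s. s \<in> S \<Longrightarrow> f s \<in> W) \<Longrightarrow> continuous_on S (\<lambda>s. res \<omega> (f s))"
  "continuous_on S f \<Longrightarrow> (\<And>s. s \<in> S \<Longrightarrow> f s \<in> W) \<Longrightarrow> continuous_on S (\<lambda>s. res_y \<omega> (f s))"
  unfolding res_def res_y_def by (auto intro!: continuous_intros simp: dy_nonzero)

lemma res_holomorphic:
  assumes "t \<in> T"
  shows "(\<lambda>x. res \<omega> (lift t x)) holomorphic_on B"
  unfolding holomorphic_on_open[OF B_T(1)]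
  using along_lift(1)[OF res_has_derivative[where \<omega> = \<omega>, OF lift_W(3)]] assms by blast

text \<open>The primitive on the curve of level \<open>t\<close> that vanishes above the centre
  \<open>fst z\<close>; its base point moves with \<open>t\<close>.\<close>

definition fprim :: "one_form \<Rightarrow> complex \<Rightarrow> complex \<Rightarrow> complex" where
  "fprim \<omega> t x = contour_integral (linepath (fst z) x) (\<lambda>x. res \<omega> (lift t x))"

lemma segment_B: "x \<in> B \<Longrightarrow> closed_segment (fst z) x \<subseteq> B"
  by (simp add: B_T closed_segment_subset)

lemma primitive_along_segment:
  assumes "\<And>x. x \<in> B \<Longrightarrow> (g has_field_derivative f x) (at x)" "x \<in> B"
  shows "(f has_contour_integral (g x - g (fst z))) (linepath (fst z) x)"
  using contour_integral_primitive[of B g f "linepath (fst z) x"] assms segment_B[OF assms(2)]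
  by (auto intro: has_field_derivative_at_within)

text \<open>A holomorphic primitive exists on the disc, and integration along radii reproduces it up
  to a constant.\<close>

lemma fprim_deriv_x:
  assumes t: "t \<in> T" and x: "x \<in> B"
  shows "(fprim \<omega> t has_field_derivative res \<omega> (lift t x)) (at x)"
proof -
  obtain g where "\<And>x. x \<in> B \<Longrightarrow> (g has_field_derivative res \<omega> (lift t x)) (at x within B)"
    using holomorphic_convex_primitive'[OF B_T(2,1) res_holomorphic[OF t]] by blast
  then have g: "\<And>x. x \<in> B \<Longrightarrow> (g has_field_derivative res \<omega> (lift t x)) (at x)"
    using B_T(1) at_within_open by metis
  have "((\<lambda>x. g x - g (fst z)) has_field_derivative res \<omega> (lift t x)) (at x)"
    using DERIV_diff[OF g[OF x] DERIV_const] by simp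
  moreover have "\<And>x. x \<in> B \<Longrightarrow> g x - g (fst z) = fprim \<omega> t x"
    unfolding fprim_def using contour_integral_unique[OF primitive_along_segment[OF g]] by simp
  ultimately show ?thesis
    using has_field_derivative_transform_within_open[OF _ B_T(1) x] by blast
qed

definition fprim_t :: "one_form \<Rightarrow> complex \<Rightarrow> complex \<Rightarrow> complex" where
  "fprim_t \<omega> t x = contour_integral (linepath (fst z) x) (\<lambda>x. res_y \<omega> (lift t x) / eval_dy H (lift t x))"

text \<open>Differentiation under the integral sign; at fixed \<open>x\<close> the integrand changes
  at the rate given by the second part of \<open>along_lift\<close>.\<close>

lemma fprim_deriv_t:
  assumes t: "t \<in> T" and x: "x \<in> B"
  shows "((\<lambda>t. fprim \<omega> t x) has_field_derivative fprim_t \<omega> t x) (at t)"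
proof -
  let ?l = "linepath (fst z) x" and ?c = "x - fst z"
  have l: "?l s \<in> B" if "s \<in> cbox 0 1" for s
    using that segment_B[OF x] linepath_in_path by fastforce
  have "((\<lambda>t. integral (cbox 0 1) (\<lambda>s. res \<omega> (lift t (?l s)) * ?c)) has_field_derivative
    integral (cbox 0 1) (\<lambda>s. res_y \<omega> (lift t (?l s)) / eval_dy H (lift t (?l s)) * ?c)) (at t within T)"
  proof (rule leibniz_rule_field_derivative)
    show "((\<lambda>t. res \<omega> (lift t (?l s)) * ?c) has_field_derivative
      res_y \<omega> (lift u (?l s)) / eval_dy H (lift u (?l s)) * ?c) (at u within T)"
      if "u \<in> T" "s \<in> cbox 0 1" for u s
      using along_lift(2)[OF res_has_derivative[OF lift_W(3)] _ that(1)] l[OF that(2)] that(1)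
      by (intro DERIV_cmult_right has_field_derivative_at_within[where s = T]) auto
    show "(\<lambda>s. res \<omega> (lift u (?l s)) * ?c) integrable_on cbox 0 1" if "u \<in> T" for u
      using that l lift_W
      by (intro integrable_continuous continuous_intros continuous_on_res continuous_on_lift) auto
    show "continuous_on (T \<times> cbox 0 1) (\<lambda>(u, s). res_y \<omega> (lift u (?l s)) / eval_dy H (lift u (?l s)) * ?c)"
      unfolding case_prod_unfold linepath_def using l lift_W unfolding linepath_def
      by (intro continuous_intros continuous_on_res continuous_on_lift) auto
  qed (use t B_T in auto)
  moreover have "at t within T = at t"
    using t B_T(4) at_within_open by blast
  ultimately show ?thesis
    unfolding fprim_def[abs_def] fprim_t_def contour_integral_integral
    by (simp add: cbox_interval)
qed

definition prim :: "one_form \<Rightarrow> complex \<times> complex \<Rightarrow> complex" where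
  "prim \<omega> p = fprim \<omega> (eval_xy H p) (fst p)"

text \<open>The fundamental theorem of calculus for the primitive composed with the
  \<open>x\<close>-coordinate of the path. It is stated for subintervals because longer paths are
  cut into pieces lying in single charts.\<close>

lemma prim_integral:
  assumes \<gamma>: "valid_path \<gamma>" and ab: "0 \<le> a" "a \<le> b" "b \<le> 1"
    and W: "\<And>s. s \<in> {a..b} \<Longrightarrow> \<gamma> s \<in> W" and t: "\<And>s. s \<in> {a..b} \<Longrightarrow> eval_xy H (\<gamma> s) = t"
  shows "((\<lambda>s. eval_xy (fst \<omega>) (\<gamma> s) * fst (vector_derivative \<gamma> (at s within {0..1})) +
      eval_xy (snd \<omega>) (\<gamma> s) * snd (vector_derivative \<gamma> (at s within {0..1})))
    has_integral (prim \<omega> (\<gamma> b) - prim \<omega> (\<gamma> a))) {a..b}"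
proof -
  obtain S where S: "finite S" "continuous_on {0..1} \<gamma>" "\<And>s. s \<in> {0..1} - S \<Longrightarrow> \<gamma> differentiable at s"
    using \<gamma> by (auto simp: valid_path_def piecewise_C1_differentiable_on_def C1_differentiable_on_eq)
  have tT: "t \<in> T"
    using W_lift(2)[OF W, of a] t[of a] ab by simp
  have lift: "lift t (fst (\<gamma> s)) = \<gamma> s" "fst (\<gamma> s) \<in> B" if "s \<in> {a..b}" for s
    using W_lift[OF W[OF that]] t[OF that] by auto
  have "((\<lambda>s. eval_xy (fst \<omega>) (\<gamma> s) * fst (vector_derivative \<gamma> (at s within {0..1})) +
      eval_xy (snd \<omega>) (\<gamma> s) * snd (vector_derivative \<gamma> (at s within {0..1})))
    has_integral (fprim \<omega> t (fst (\<gamma> b)) - fprim \<omega> t (fst (\<gamma> a)))) {a..b}"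
  proof (rule fundamental_theorem_of_calculus_interior_strong[OF S(1) ab(2)])
    have "continuous_on B (fprim \<omega> t)"
      using fprim_deriv_x[OF tT] by (meson DERIV_isCont continuous_at_imp_continuous_on)
    then show "continuous_on {a..b} (\<lambda>s. fprim \<omega> t (fst (\<gamma> s)))"
      by (rule continuous_on_compose2)
        (use ab lift in \<open>auto intro!: continuous_intros continuous_on_subset[OF S(2)]\<close>)
    fix s assume s: "s \<in> {a<..<b} - S"
    define v where "v = vector_derivative \<gamma> (at s)"
    have sab: "s \<in> {a..b}" and s01: "s \<in> {0..1}"
      using s ab by auto
    have v: "(\<gamma> has_vector_derivative v) (at s)"
      unfolding v_def using S(3)[of s] s ab by (simp add: vector_derivative_works)
    have within: "vector_derivative \<gamma> (at s within {0..1}) = v"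
      by (rule vector_derivative_at_within_ivl[OF v]) (use s ab in auto)
    \<comment> \<open>\<open>H\<close> is constant along the path, so its velocity is annihilated by
      \<open>dH\<close>; this turns the \<open>dy\<close> part of \<open>\<omega>\<close> into a
      multiple of \<open>dx\<close>, as in \<open>res\<close>.\<close>
    have H0: "((\<lambda>s. eval_xy H (\<gamma> s)) has_vector_derivative 0) (at s)"
      by (rule has_vector_derivative_transform_within_open[where S = "{a<..<b}" and f = "\<lambda>_. t"])
        (use s t in auto)
    have "((\<lambda>s. eval_xy H (\<gamma> s)) has_vector_derivative (eval_dx H (\<gamma> s) * fst v + eval_dy H (\<gamma> s) * snd v)) (at s)"
      using has_derivative_compose[OF v[unfolded has_vector_derivative_def] eval_xy_has_derivative[of H]]
      unfolding has_vector_derivative_def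
      by (rule has_derivative_eq_rhs) (auto simp: algebra_simps scaleR_conv_of_real)
    from vector_derivative_unique_at[OF H0 this] have
      tangent: "eval_dx H (\<gamma> s) * fst v + eval_dy H (\<gamma> s) * snd v = 0" by simp
    have fv: "((\<lambda>s. fst (\<gamma> s)) has_vector_derivative fst v) (at s)"
      using has_derivative_fst[OF v[unfolded has_vector_derivative_def]]
      by (simp add: has_vector_derivative_def)
    have "((\<lambda>s. fprim \<omega> t (fst (\<gamma> s))) has_vector_derivative (fst v * res \<omega> (\<gamma> s))) (at s)"
      using field_vector_diff_chain_at[OF fv, of "fprim \<omega> t" "res \<omega> (\<gamma> s)"]
        fprim_deriv_x[OF tT lift(2)[OF sab], of \<omega>] by (simp add: lift(1)[OF sab] o_def)
    moreover have "eval_dy H (\<gamma> s) \<noteq> 0"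
      using dy_nonzero[OF W[OF sab]] .
    then have "snd v = - (eval_dx H (\<gamma> s) * fst v) / eval_dy H (\<gamma> s)"
      using tangent by (metis add_eq_0_iff nonzero_mult_div_cancel_left)
    then have "fst v * res \<omega> (\<gamma> s) = eval_xy (fst \<omega>) (\<gamma> s) * fst v + eval_xy (snd \<omega>) (\<gamma> s) * snd v"
      by (simp add: res_def algebra_simps)
    ultimately show "((\<lambda>s. fprim \<omega> t (fst (\<gamma> s))) has_vector_derivative
      eval_xy (fst \<omega>) (\<gamma> s) * fst (vector_derivative \<gamma> (at s within {0..1})) +
      eval_xy (snd \<omega>) (\<gamma> s) * snd (vector_derivative \<gamma> (at s within {0..1}))) (at s)"
      by (simp add: within)
  qed
  then show ?thesis
    using t[of a] t[of b] ab by (simp add: prim_def)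
qed

end

context implicit_chart
begin

text \<open>Chain rule for the primitive as a function of \<open>(t, x)\<close>. Joint
  differentiability follows from both partial derivatives, the one in \<open>x\<close> being jointly
  continuous.\<close>

lemma prim_section_derivative:
  assumes s: "((\<lambda>t. fst (s t)) has_field_derivative a) (at t0)" "s t0 \<in> W"
    and level: "\<forall>\<^sub>F t in nhds t0. eval_xy H (s t) = t"
  shows "((\<lambda>t. prim \<omega> (s t)) has_field_derivative
    fprim_t \<omega> t0 (fst (s t0)) + res \<omega> (s t0) * a) (at t0)"
proof -
  have t0: "eval_xy H (s t0) = t0"
    using level by (rule eventually_nhds_x_imp_x)
  define x0 where "x0 = fst (s t0)"
  have T: "t0 \<in> T" and B: "x0 \<in> B" and l: "lift t0 x0 = s t0"
    using W_lift[OF s(2)] by (auto simp: t0 x0_def)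
  have "((\<lambda>(t, x). fprim \<omega> t x) has_derivative
      (\<lambda>(h, k). fprim_t \<omega> t0 x0 * h + blinfun_apply (blinfun_mult_right (res \<omega> (lift t0 x0))) k))
    (at (t0, x0) within T \<times> B)"
  proof (rule has_derivative_partialsI[where fy = "\<lambda>t x. blinfun_mult_right (res \<omega> (lift t x))"])
    show "((\<lambda>t. fprim \<omega> t x0) has_derivative (*) (fprim_t \<omega> t0 x0)) (at t0 within T)"
      using fprim_deriv_t[OF T B] has_derivative_at_withinI unfolding has_field_derivative_def by blast
    show "(fprim \<omega> t has_derivative blinfun_apply (blinfun_mult_right (res \<omega> (lift t x)))) (at x within B)"
      if "t \<in> T" "x \<in> B" for t x
      using has_derivative_at_withinI[OF fprim_deriv_x[OF that, unfolded has_field_derivative_def]]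
      by (simp add: blinfun_mult_right.rep_eq)
    have "continuous_on (T \<times> B) (\<lambda>q. blinfun_mult_right (res \<omega> (lift (fst q) (snd q))))"
      by (intro bounded_linear.continuous_on[OF bounded_linear_blinfun_mult_right]
          continuous_on_res continuous_on_lift continuous_intros) (auto intro!: lift_W)
    then show "continuous (at (t0, x0) within T \<times> B) (\<lambda>(t, x). blinfun_mult_right (res \<omega> (lift t x)))"
      using T B by (simp add: continuous_on_eq_continuous_within case_prod_unfold)
  qed (use B B_T in auto)
  moreover have "at (t0, x0) within T \<times> B = at (t0, x0)"
    using B_T T B by (intro at_within_open open_Times) auto
  ultimately have D: "((\<lambda>q. fprim \<omega> (fst q) (snd q)) has_derivative
      (\<lambda>h. fprim_t \<omega> t0 x0 * fst h + res \<omega> (s t0) * snd h)) (at (t0, x0))"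
    by (simp add: case_prod_unfold blinfun_mult_right.rep_eq l)
  have "((\<lambda>t. (t, fst (s t))) has_derivative (\<lambda>h. (h, a * h))) (at t0)"
    using s(1) by (intro has_derivative_Pair has_derivative_ident) (simp add: has_field_derivative_def)
  from has_derivative_compose[of "\<lambda>t. (t, fst (s t))" "\<lambda>h. (h, a * h)" t0 UNIV, OF this D[unfolded x0_def]]
  have "((\<lambda>t. fprim \<omega> t (fst (s t))) has_field_derivative
      fprim_t \<omega> t0 (fst (s t0)) + res \<omega> (s t0) * a) (at t0)"
    unfolding has_field_derivative_def fst_conv snd_conv
    by (rule has_derivative_eq_rhs) (auto simp: algebra_simps)
  moreover have "\<forall>\<^sub>F t in nhds t0. fprim \<omega> t (fst (s t)) = prim \<omega> (s t)"
    using level by (rule eventually_mono) (simp add: prim_def)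
  ultimately show ?thesis
    using DERIV_cong_ev[OF refl _ refl] by fast
qed

text \<open>In the coordinates \<open>(x, t)\<close> the form is
  \<open>\<omega> = res \<omega> dx + (Q / H_y) dt\<close> with \<open>Q = snd \<omega>\<close>, so
  \<open>d\<omega> = dt \<and> \<eta>\<close> says that the \<open>t\<close>-derivative of
  \<open>res \<omega>\<close> equals \<open>res \<eta>\<close> plus the \<open>x\<close>-derivative
  of \<open>Q / H_y\<close>. Integration in \<open>x\<close> gives the formula; the last term is due
  to the moving base point.\<close>

lemma fprim_t_gelfand_leray:
  assumes \<eta>: "ext_deriv \<omega> = deriv_x H * snd \<eta> - deriv_y H * fst \<eta>" and t: "t \<in> T" and x: "x \<in> B"
  shows "fprim_t \<omega> t x = fprim \<eta> t x + eval_xy (snd \<omega>) (lift t x) / eval_dy H (lift t x)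
    - eval_xy (snd \<omega>) (lift t (fst z)) / eval_dy H (lift t (fst z))"
proof -
  define g where "g x = fprim \<eta> t x + eval_xy (snd \<omega>) (lift t x) / eval_dy H (lift t x)" for x
  have "(g has_field_derivative res_y \<omega> (lift t x) / eval_dy H (lift t x)) (at x)" if x: "x \<in> B" for x
  proof -
    let ?p = "lift t x"
    note nz = lift_W(3)[OF x t]
    have "((\<lambda>p. eval_xy (snd \<omega>) p / eval_dy H p) has_derivative (\<lambda>h.
      (eval_dx (snd \<omega>) ?p / eval_dy H ?p - eval_xy (snd \<omega>) ?p * eval_dx (deriv_y H) ?p / (eval_dy H ?p)\<^sup>2) * fst h +
      (eval_dy (snd \<omega>) ?p / eval_dy H ?p - eval_xy (snd \<omega>) ?p * eval_dy (deriv_y H) ?p / (eval_dy H ?p)\<^sup>2) * snd h)) (at ?p)"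
      by (rule has_derivative_eq_rhs, (rule derivative_intros eval_xy_has_derivative nz)+)
        (use nz in \<open>auto simp: fun_eq_iff field_simps power2_eq_square\<close>)
    from DERIV_add[OF fprim_deriv_x[OF t x, of \<eta>] along_lift(1)[OF this x t]]
    have "(g has_field_derivative res \<eta> ?p +
      (eval_dx (snd \<omega>) ?p / eval_dy H ?p - eval_xy (snd \<omega>) ?p * eval_dx (deriv_y H) ?p / (eval_dy H ?p)\<^sup>2 -
      (eval_dy (snd \<omega>) ?p / eval_dy H ?p - eval_xy (snd \<omega>) ?p * eval_dy (deriv_y H) ?p / (eval_dy H ?p)\<^sup>2) *
        eval_dx H ?p / eval_dy H ?p)) (at x)" (is "(g has_field_derivative ?D) _")
      unfolding g_def[abs_def] .
    moreover have "?D = res_y \<omega> ?p / eval_dy H ?p"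
    proof -
      have "eval_xy (deriv_x (snd \<omega>) - deriv_y (fst \<omega>)) ?p = eval_xy (deriv_x H * snd \<eta> - deriv_y H * fst \<eta>) ?p"
        using \<eta> by (simp add: ext_deriv_def)
      then have e: "eval_dx (snd \<omega>) ?p = eval_dy (fst \<omega>) ?p + eval_dx H ?p * eval_xy (snd \<eta>) ?p - eval_dy H ?p * eval_xy (fst \<eta>) ?p"
        by (simp add: algebra_simps)
      show ?thesis
        unfolding res_def res_y_def e deriv_xy_commute using nz
        by (simp add: field_simps power2_eq_square)
    qed
    ultimately show ?thesis
      by simp
  qed
  from contour_integral_unique[OF primitive_along_segment[OF this x]]
  have "fprim_t \<omega> t x = g x - g (fst z)"
    unfolding fprim_t_def .
  then show ?thesis
    by (simp add: g_def fprim_def)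
qed

text \<open>The middle term is \<open>\<omega>\<close> paired with the velocity of the section. The
  last term depends on the chart and \<open>t0\<close> but not on the section, so it cancels in
  differences of primitives.\<close>

lemma prim_section_gelfand_leray:
  assumes \<eta>: "ext_deriv \<omega> = deriv_x H * snd \<eta> - deriv_y H * fst \<eta>"
    and s: "((\<lambda>t. fst (s t)) has_field_derivative a) (at t0)"
      "((\<lambda>t. snd (s t)) has_field_derivative b) (at t0)" "s t0 \<in> W"
    and level: "\<forall>\<^sub>F t in nhds t0. eval_xy H (s t) = t"
  shows "((\<lambda>t. prim \<omega> (s t)) has_field_derivative
    prim \<eta> (s t0) + (eval_xy (fst \<omega>) (s t0) * a + eval_xy (snd \<omega>) (s t0) * b)
      - eval_xy (snd \<omega>) (lift t0 (fst z)) / eval_dy H (lift t0 (fst z))) (at t0)"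
proof -
  have t0: "eval_xy H (s t0) = t0"
    using level by (rule eventually_nhds_x_imp_x)
  define x0 where "x0 = fst (s t0)"
  have T: "t0 \<in> T" and B: "x0 \<in> B" and l: "lift t0 x0 = s t0"
    using W_lift[OF s(3)] by (auto simp: t0 x0_def)
  note nz = dy_nonzero[OF s(3)]
  have "((\<lambda>t. (fst (s t), snd (s t))) has_derivative (\<lambda>h. (a * h, b * h))) (at t0)"
    using s(1,2) by (intro has_derivative_Pair) (simp_all add: has_field_derivative_def)
  then have "(s has_derivative (\<lambda>h. (a * h, b * h))) (at t0)"
    by simp
  from has_derivative_compose[OF this eval_xy_has_derivative[of H]]
  have "((\<lambda>t. eval_xy H (s t)) has_field_derivative eval_dx H (s t0) * a + eval_dy H (s t0) * b) (at t0)"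
    unfolding has_field_derivative_def by (rule has_derivative_eq_rhs) (auto simp: algebra_simps)
  moreover have "((\<lambda>t. eval_xy H (s t)) has_field_derivative 1) (at t0)"
    using DERIV_ident[of "at t0"] DERIV_cong_ev[OF refl level refl] by blast
  \<comment> \<open>Obtained by differentiating \<open>H (s t) = t\<close>; it determines
    \<open>b\<close> from \<open>a\<close>.\<close>
  ultimately have "eval_dx H (s t0) * a + eval_dy H (s t0) * b = 1"
    by (rule DERIV_unique)
  then have b: "b = (1 - eval_dx H (s t0) * a) / eval_dy H (s t0)"
    using nz by (simp add: field_simps)
  have "fprim_t \<omega> t0 x0 + res \<omega> (s t0) * a =
    prim \<eta> (s t0) + (eval_xy (fst \<omega>) (s t0) * a + eval_xy (snd \<omega>) (s t0) * b)
      - eval_xy (snd \<omega>) (lift t0 (fst z)) / eval_dy H (lift t0 (fst z))"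
    unfolding fprim_t_gelfand_leray[OF \<eta> T B] l prim_def t0 x0_def[symmetric] b res_def
    using nz by (simp add: field_simps)
  then show ?thesis
    using prim_section_derivative[OF s(1,3) level, of \<omega>] by (simp add: x0_def)
qed

lemma lift_has_derivative:
  assumes t: "t \<in> T" and x: "x \<in> B"
  shows "(lift t has_derivative (\<lambda>h. (h, (- eval_dx H (lift t x) / eval_dy H (lift t x)) * h))) (at x)"
proof -
  have "(snd has_derivative (\<lambda>h. 0 * fst h + 1 * snd h)) (at (lift t x))"
    by (rule has_derivative_eq_rhs, (rule derivative_intros)+) auto
  from along_lift(1)[OF this x t]
  have "((\<lambda>x. snd (lift t x)) has_derivative (\<lambda>h. (- eval_dx H (lift t x) / eval_dy H (lift t x)) * h)) (at x)"
    unfolding has_field_derivative_def by (rule has_derivative_eq_rhs) auto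
  from has_derivative_Pair[OF has_derivative_ident this]
  have "((\<lambda>x. (x, snd (lift t x))) has_derivative (\<lambda>h. (h, (- eval_dx H (lift t x) / eval_dy H (lift t x)) * h))) (at x)" .
  then show ?thesis
    by (simp add: lift_def[abs_def])
qed

text \<open>The straight segment between the \<open>x\<close>-coordinates stays in the disc and
  lifts to the level curve.\<close>

lemma fibre_connected:
  assumes p: "p \<in> W" and q: "q \<in> W" and pq: "eval_xy H p = eval_xy H q"
  obtains \<gamma> where "valid_path \<gamma>" "\<And>s. s \<in> {0..1} \<Longrightarrow> \<gamma> s \<in> W" "\<And>s. s \<in> {0..1} \<Longrightarrow> eval_xy H (\<gamma> s) = eval_xy H p"
    "\<gamma> 0 = p" "\<gamma> 1 = q"
proof -
  define t where "t = eval_xy H p"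
  define l where "l = linepath (fst p) (fst q)"
  define \<gamma> where "\<gamma> s = lift t (l s)" for s
  have t: "t \<in> T" and "fst p \<in> B" "fst q \<in> B"
    using W_lift p q by (auto simp: t_def)
  then have l: "l s \<in> B" if "s \<in> {0..1}" for s
    using that closed_segment_subset[of "fst p" B "fst q"] B_T linepath_in_path[OF that] by (auto simp: l_def)
  let ?c = "fst q - fst p"
  have "\<gamma> C1_differentiable_on {0..1}"
    unfolding C1_differentiable_on_def
  proof (intro exI conjI ballI)
    fix s :: real assume s: "s \<in> {0..1}"
    have "(l has_derivative (\<lambda>h. h *\<^sub>R ?c)) (at s)"
      unfolding l_def has_vector_derivative_def[symmetric] by (rule has_vector_derivative_linepath_within)
    from has_derivative_compose[OF this lift_has_derivative[OF t l[OF s]]]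
    show "(\<gamma> has_vector_derivative (?c, (- eval_dx H (\<gamma> s) / eval_dy H (\<gamma> s)) * ?c)) (at s)"
      unfolding has_vector_derivative_def \<gamma>_def by (rule has_derivative_eq_rhs) auto
  next
    have "continuous_on {0..1} \<gamma>"
      unfolding \<gamma>_def using t l
      by (intro continuous_on_lift) (auto simp: l_def intro: continuous_on_linepath)
    moreover have "eval_dy H (\<gamma> s) \<noteq> 0" if "s \<in> {0..1}" for s
      using lift_W(3)[OF l[OF that] t] by (simp add: \<gamma>_def)
    ultimately show "continuous_on {0..1} (\<lambda>s. (?c, (- eval_dx H (\<gamma> s) / eval_dy H (\<gamma> s)) * ?c))"
      by (intro continuous_intros) auto
  qed
  then have "valid_path \<gamma>"
    unfolding valid_path_def by (rule C1_differentiable_imp_piecewise)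
  moreover have "\<gamma> s \<in> W" "eval_xy H (\<gamma> s) = t" if "s \<in> {0..1}" for s
    using lift_W[OF l[OF that] t] by (auto simp: \<gamma>_def)
  moreover have "\<gamma> 0 = p" "\<gamma> 1 = q"
    using W_lift(3)[OF p] W_lift(3)[OF q] pq by (auto simp: \<gamma>_def l_def t_def linepath_def)
  ultimately show ?thesis
    using that by (auto simp: t_def)
qed

text \<open>A nonempty slice is the homeomorphic image of the disc under
  \<open>lift t\<close>.\<close>

lemma fibre_simply_connected: "simply_connected (W \<inter> level_curve H t)"
proof (cases "t \<in> T")
  case False
  then have "W \<inter> level_curve H t = {}"
    using W_lift(2) by (auto simp: level_curve_def)
  then show ?thesis
    by simp
next
  case True
  have 1: "lift t x \<in> W \<inter> level_curve H t" "fst (lift t x) = x" if "x \<in> B" for x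
    using lift_W[OF that True] by (simp_all add: level_curve_def) (simp add: lift_def)
  have 2: "fst p \<in> B" "lift t (fst p) = p" if "p \<in> W \<inter> level_curve H t" for p
    using W_lift[of p] that by (auto simp: level_curve_def)
  have "homeomorphism B (W \<inter> level_curve H t) (lift t) fst"
    unfolding homeomorphism_def
  proof (intro conjI ballI)
    show "continuous_on B (lift t)"
      using True by (intro continuous_on_lift continuous_intros) auto
    show "lift t ` B = W \<inter> level_curve H t"
      using 1 2 by (metis (no_types, lifting) image_subsetI imageI subset_antisym subsetI)
    show "fst ` (W \<inter> level_curve H t) = B"
      using 1 2 by (metis (no_types, lifting) image_subsetI imageI subset_antisym subsetI)
  qed (use 1 2 in \<open>auto intro!: continuous_intros\<close>)
  then show ?thesis
    using B_T(2) convex_imp_simply_connected homeomorphic_simply_connected_eq homeomorphic_def by blast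
qed

end

section \<open>Charts described without reference to the coordinate used\<close>

definition form_along :: "one_form \<Rightarrow> (real \<Rightarrow> complex \<times> complex) \<Rightarrow> real \<Rightarrow> complex" where
  "form_along \<omega> \<gamma> s = eval_xy (fst \<omega>) (\<gamma> s) * fst (vector_derivative \<gamma> (at s within {0..1})) +
      eval_xy (snd \<omega>) (\<gamma> s) * snd (vector_derivative \<gamma> (at s within {0..1}))"

lemma path_integral_form_along: "path_integral \<omega> \<gamma> = integral {0..1} (form_along \<omega> \<gamma>)"
  unfolding path_integral_def form_along_def[abs_def] ..

definition wedge_dH :: "poly_xy \<Rightarrow> one_form \<Rightarrow> two_form" where
  "wedge_dH H \<eta> = deriv_x H * snd \<eta> - deriv_y H * fst \<eta>"

text \<open>A local right inverse of \<open>H\<close> with velocity \<open>(a, b)\<close>. Complex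
  differentiability is required at \<open>t0\<close> alone, the point where derivatives of integrals
  are taken.\<close>

definition section_at ::
    "poly_xy \<Rightarrow> (complex \<Rightarrow> complex \<times> complex) \<Rightarrow> complex \<Rightarrow> complex \<Rightarrow> complex \<Rightarrow> bool" where
  "section_at H s t0 a b \<longleftrightarrow> ((\<lambda>t. fst (s t)) has_field_derivative a) (at t0) \<and>
    ((\<lambda>t. snd (s t)) has_field_derivative b) (at t0) \<and> (\<forall>\<^sub>F t in nhds t0. eval_xy H (s t) = t)"

text \<open>On a chart \<open>W\<close> the functions \<open>F \<omega>\<close> are primitives of the forms \<open>\<omega>\<close> along the level
  curves of \<open>H\<close>.\<close>

definition fibre_chart ::
    "poly_xy \<Rightarrow> (complex \<times> complex) set \<Rightarrow> (one_form \<Rightarrow> complex \<times> complex \<Rightarrow> complex) \<Rightarrow> bool" where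
  "fibre_chart H W F \<longleftrightarrow> open W \<and>
    (\<forall>p\<in>W. \<forall>q\<in>W. eval_xy H p = eval_xy H q \<longrightarrow> (\<exists>\<gamma>. valid_path \<gamma> \<and> \<gamma> 0 = p \<and> \<gamma> 1 = q \<and>
      (\<forall>s\<in>{0..1}. \<gamma> s \<in> W \<and> eval_xy H (\<gamma> s) = eval_xy H p))) \<and>
    (\<forall>t. simply_connected (W \<inter> level_curve H t)) \<and>
    (\<forall>\<omega> \<gamma> a b t. valid_path \<gamma> \<longrightarrow> 0 \<le> a \<longrightarrow> a \<le> b \<longrightarrow> b \<le> 1 \<longrightarrow>
      (\<forall>s\<in>{a..b}. \<gamma> s \<in> W \<and> eval_xy H (\<gamma> s) = t) \<longrightarrow>
      (form_along \<omega> \<gamma> has_integral (F \<omega> (\<gamma> b) - F \<omega> (\<gamma> a))) {a..b}) \<and>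
    (\<forall>\<omega> s t0 a b. section_at H s t0 a b \<longrightarrow> s t0 \<in> W \<longrightarrow>
      (\<lambda>t. F \<omega> (s t)) field_differentiable (at t0)) \<and>
    (\<forall>\<omega> \<eta> t0. ext_deriv \<omega> = wedge_dH H \<eta> \<longrightarrow> (\<exists>k. \<forall>s a b. section_at H s t0 a b \<longrightarrow> s t0 \<in> W \<longrightarrow>
      ((\<lambda>t. F \<omega> (s t)) has_field_derivative
        F \<eta> (s t0) + (eval_xy (fst \<omega>) (s t0) * a + eval_xy (snd \<omega>) (s t0) * b) - k) (at t0)))"

lemma fibre_chart_open: "fibre_chart H W F \<Longrightarrow> open W"
  unfolding fibre_chart_def by (erule conjunct1)

lemma fibre_chart_path:
  assumes "fibre_chart H W F" "p \<in> W" "q \<in> W" "eval_xy H p = eval_xy H q"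
  shows "\<exists>\<gamma>. valid_path \<gamma> \<and> \<gamma> 0 = p \<and> \<gamma> 1 = q \<and> (\<forall>s\<in>{0..1}. \<gamma> s \<in> W \<and> eval_xy H (\<gamma> s) = eval_xy H p)"
  using assms(1)[unfolded fibre_chart_def, THEN conjunct2, THEN conjunct1] assms(2-) by blast

lemma fibre_chart_simply_connected: "fibre_chart H W F \<Longrightarrow> simply_connected (W \<inter> level_curve H t)"
  unfolding fibre_chart_def by (drule conjunct2, drule conjunct2, drule conjunct1, erule spec)

lemma fibre_chart_integral:
  assumes "fibre_chart H W F" "valid_path \<gamma>" "0 \<le> a" "a \<le> b" "b \<le> 1"
    "\<And>s. s \<in> {a..b} \<Longrightarrow> \<gamma> s \<in> W" "\<And>s. s \<in> {a..b} \<Longrightarrow> eval_xy H (\<gamma> s) = t"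
  shows "(form_along \<omega> \<gamma> has_integral (F \<omega> (\<gamma> b) - F \<omega> (\<gamma> a))) {a..b}"
  by (rule assms(1)[unfolded fibre_chart_def, THEN conjunct2, THEN conjunct2, THEN conjunct2, THEN conjunct1,
      rule_format, OF assms(2-5), where t = t]) (use assms(6,7) in auto)

lemma fibre_chart_differentiable:
  assumes "fibre_chart H W F" "section_at H s t0 a b" "s t0 \<in> W"
  shows "(\<lambda>t. F \<omega> (s t)) field_differentiable (at t0)"
  by (rule assms(1)[unfolded fibre_chart_def, THEN conjunct2, THEN conjunct2, THEN conjunct2, THEN conjunct2,
      THEN conjunct1, rule_format, OF assms(2,3)])

lemma fibre_chart_gelfand_leray:
  assumes "fibre_chart H W F" "ext_deriv \<omega> = wedge_dH H \<eta>"
  obtains k where "\<And>s a b. section_at H s t0 a b \<Longrightarrow> s t0 \<in> W \<Longrightarrow>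
    ((\<lambda>t. F \<omega> (s t)) has_field_derivative
      F \<eta> (s t0) + (eval_xy (fst \<omega>) (s t0) * a + eval_xy (snd \<omega>) (s t0) * b) - k) (at t0)"
  using assms(1)[unfolded fibre_chart_def, THEN conjunct2, THEN conjunct2, THEN conjunct2, THEN conjunct2,
      THEN conjunct2, THEN spec[of _ \<omega>], THEN spec[of _ \<eta>], THEN spec[of _ t0], THEN mp, OF assms(2)] that
  by blast

lemma (in implicit_chart) fibre_chart_prim: "fibre_chart H W prim"
  unfolding fibre_chart_def
proof (intro conjI allI impI ballI)
  show "open W" by (rule open_W)
next
  fix p q assume "p \<in> W" "q \<in> W" "eval_xy H p = eval_xy H q"
  then show "\<exists>\<gamma>. valid_path \<gamma> \<and> \<gamma> 0 = p \<and> \<gamma> 1 = q \<and> (\<forall>s\<in>{0..1}. \<gamma> s \<in> W \<and> eval_xy H (\<gamma> s) = eval_xy H p)"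
    by (rule fibre_connected) blast
next
  show "simply_connected (W \<inter> level_curve H t)" for t
    by (rule fibre_simply_connected)
next
  fix \<omega> and \<gamma> :: "real \<Rightarrow> complex \<times> complex" and a b :: real and t
  assume "valid_path \<gamma>" "0 \<le> a" "a \<le> b" "b \<le> 1" "\<forall>s\<in>{a..b}. \<gamma> s \<in> W \<and> eval_xy H (\<gamma> s) = t"
  then show "(form_along \<omega> \<gamma> has_integral (prim \<omega> (\<gamma> b) - prim \<omega> (\<gamma> a))) {a..b}"
    unfolding form_along_def[abs_def] by (intro prim_integral[of \<gamma> a b t]) auto
next
  fix \<omega> s t0 a b assume "section_at H s t0 a b" "s t0 \<in> W"
  then show "(\<lambda>t. prim \<omega> (s t)) field_differentiable (at t0)"
    using prim_section_derivative[of s a t0 \<omega>] unfolding section_at_def field_differentiable_def by blast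
next
  fix \<omega> \<eta> t0 assume "ext_deriv \<omega> = wedge_dH H \<eta>"
  then show "\<exists>k. \<forall>s a b. section_at H s t0 a b \<longrightarrow> s t0 \<in> W \<longrightarrow>
      ((\<lambda>t. prim \<omega> (s t)) has_field_derivative
        prim \<eta> (s t0) + (eval_xy (fst \<omega>) (s t0) * a + eval_xy (snd \<omega>) (s t0) * b) - k) (at t0)"
    unfolding wedge_dH_def section_at_def using prim_section_gelfand_leray[of \<omega> \<eta> _ _ t0] by blast
qed

text \<open>The lift of the fixed coordinate \<open>fst z\<close> to the varying level.\<close>

lemma (in implicit_chart) section_exists: "\<exists>s a b. section_at H s (eval_xy H z) a b \<and> s (eval_xy H z) = z"
proof -
  define t0 x0 where "t0 = eval_xy H z" and "x0 = fst z"
  have tx: "t0 \<in> T" "x0 \<in> B" and l: "lift t0 x0 = z"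
    using W_lift[OF z_in_W] by (auto simp: t0_def x0_def)
  have "(snd has_derivative (\<lambda>h. 0 * fst h + 1 * snd h)) (at (lift t0 x0))"
    by (rule has_derivative_eq_rhs, (rule derivative_intros)+) auto
  from along_lift(2)[OF this tx(2,1)]
  have "((\<lambda>t. snd (lift t x0)) has_field_derivative (1 / eval_dy H (lift t0 x0))) (at t0)" .
  moreover have "((\<lambda>t. fst (lift t x0)) has_field_derivative 0) (at t0)"
    by (simp add: lift_def)
  moreover have "\<forall>\<^sub>F t in nhds t0. eval_xy H (lift t x0) = t"
    using eventually_nhds_in_open[OF B_T(4) tx(1)] by (rule eventually_mono) (rule lift_W(2)[OF tx(2)])
  ultimately show ?thesis
    unfolding section_at_def t0_def[symmetric] using l by (intro exI[of _ "\<lambda>t. lift t x0"]) blast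
qed

section \<open>Exchange of the variables, for regular points where only the
  \<open>x\<close>-derivative of \<open>H\<close> is nonzero\<close>

definition swap_xy :: "poly_xy \<Rightarrow> poly_xy" where
  "swap_xy p = Poly_Mapping.map_key prod.swap p"

lemma swap_xy_add: "swap_xy (p + q) = swap_xy p + swap_xy q"
  by (simp add: swap_xy_def map_key_plus)

lemma swap_xy_single: "swap_xy (Poly_Mapping.single m c) = Poly_Mapping.single (prod.swap m) c"
  using map_key_single[of prod.swap "prod.swap m" c] by (simp add: swap_xy_def)

lemma eval_swap_xy [simp]: "eval_xy (swap_xy p) z = eval_xy p (prod.swap z)"
  by (induction p rule: poly_xy_induct) (simp_all add: swap_xy_add swap_xy_single)

lemma deriv_swap_xy: "deriv_x (swap_xy p) = swap_xy (deriv_y p)" "deriv_y (swap_xy p) = swap_xy (deriv_x p)"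
  by (induction p rule: poly_xy_induct; simp add: swap_xy_add swap_xy_single deriv_xy_single prod.swap_def)+

lemma swap_xy_diff: "swap_xy (p - q) = swap_xy p - swap_xy q"
  by (metis add_diff_cancel diff_add_cancel swap_xy_add)

lemma swap_xy_mult: "swap_xy (p * q) = swap_xy p * swap_xy q"
proof (induction p rule: poly_xy_induct)
  case (single m c)
  then show ?case
    by (induction q rule: poly_xy_induct)
      (simp_all add: swap_xy_add swap_xy_single Poly_Mapping.mult_single distrib_left prod.swap_def)
qed (simp add: swap_xy_add distrib_right)

lemma swap_swap_xy [simp]: "swap_xy (swap_xy p) = p"
  by (induction p rule: poly_xy_induct) (simp_all add: swap_xy_add swap_xy_single)

definition swap_form :: "one_form \<Rightarrow> one_form" where
  "swap_form \<omega> = (swap_xy (snd \<omega>), swap_xy (fst \<omega>))"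

lemma swap_derivative:
  fixes \<gamma> :: "real \<Rightarrow> complex \<times> complex"
  assumes "(\<gamma> has_vector_derivative v) (at x within S)"
  shows "((\<lambda>s. prod.swap (\<gamma> s)) has_vector_derivative prod.swap v) (at x within S)"
  using has_derivative_Pair[OF has_derivative_snd[OF assms[unfolded has_vector_derivative_def]]
      has_derivative_fst[OF assms[unfolded has_vector_derivative_def]]]
  by (simp add: has_vector_derivative_def prod.swap_def)

lemma continuous_on_swap_comp [continuous_intros]:
  "continuous_on S f \<Longrightarrow> continuous_on S (\<lambda>s. prod.swap (f s))"
  unfolding prod.swap_def by (intro continuous_intros)

lemma valid_path_swap:
  fixes \<gamma> :: "real \<Rightarrow> complex \<times> complex"
  assumes "valid_path \<gamma>"
  shows "valid_path (\<lambda>s. prod.swap (\<gamma> s))"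
proof -
  obtain S where S: "finite S" "continuous_on {0..1} \<gamma>" "\<gamma> C1_differentiable_on ({0..1} - S)"
    using assms by (auto simp: valid_path_def piecewise_C1_differentiable_on_def)
  then obtain D where D: "\<And>x. x \<in> {0..1} - S \<Longrightarrow> (\<gamma> has_vector_derivative D x) (at x)"
    "continuous_on ({0..1} - S) D"
    unfolding C1_differentiable_on_def by blast
  have "(\<lambda>s. prod.swap (\<gamma> s)) C1_differentiable_on ({0..1} - S)"
    unfolding C1_differentiable_on_def
    by (rule exI[of _ "\<lambda>x. prod.swap (D x)"]) (use D in \<open>auto intro!: swap_derivative continuous_intros\<close>)
  moreover have "continuous_on {0..1} (\<lambda>s. prod.swap (\<gamma> s))"
    using S(2) by (intro continuous_intros)
  ultimately show ?thesis
    using S(1) by (auto simp: valid_path_def piecewise_C1_differentiable_on_def)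
qed

lemma valid_path_derivative:
  assumes "valid_path \<gamma>"
  obtains S where "finite S"
    "\<And>s. s \<in> {0..1} - S \<Longrightarrow> (\<gamma> has_vector_derivative vector_derivative \<gamma> (at s within {0..1})) (at s within {0..1})"
proof -
  obtain S where "finite S" "\<And>s. s \<in> {0..1} - S \<Longrightarrow> \<gamma> differentiable at s"
    using assms by (auto simp: valid_path_def piecewise_C1_differentiable_on_def C1_differentiable_on_eq)
  then show ?thesis
    using that differentiable_at_withinI by (metis vector_derivative_works)
qed

text \<open>At a corner of the path \<open>vector_derivative\<close> is an unspecified value, so
  agreement can be claimed only off a finite set; integrals do not notice.\<close>

lemma form_along_swap:
  assumes "valid_path \<gamma>"
  obtains S where "finite S"
    "\<And>s. s \<in> {0..1} - S \<Longrightarrow> form_along (swap_form \<omega>) (\<lambda>s. prod.swap (\<gamma> s)) s = form_along \<omega> \<gamma> s"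
proof -
  obtain S where S: "finite S"
    "\<And>s. s \<in> {0..1} - S \<Longrightarrow> (\<gamma> has_vector_derivative vector_derivative \<gamma> (at s within {0..1})) (at s within {0..1})"
    using valid_path_derivative[OF assms] by blast
  have "vector_derivative (\<lambda>s. prod.swap (\<gamma> s)) (at s within {0..1}) = prod.swap (vector_derivative \<gamma> (at s within {0..1}))"
    if "s \<in> {0..1} - S" for s
    using that by (intro vector_derivative_within_closed_interval swap_derivative S(2)) auto
  then show ?thesis
    using that[OF S(1)] by (simp add: form_along_def swap_form_def)
qed

lemma section_at_swap:
  "section_at H s t0 a b \<Longrightarrow> section_at (swap_xy H) (\<lambda>t. prod.swap (s t)) t0 b a"
  by (simp add: section_at_def)

lemma homeomorphism_swap: "homeomorphism (prod.swap ` S) S prod.swap prod.swap"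
  for S :: "(complex \<times> complex) set"
  by (auto simp: homeomorphism_def image_image intro!: continuous_intros)

lemma fibre_chart_swap:
  assumes "fibre_chart (swap_xy H) W F"
  shows "fibre_chart H (prod.swap -` W) (\<lambda>\<omega> p. F (swap_form \<omega>) (prod.swap p))"
proof -
  note chart = assms
  show ?thesis
    unfolding fibre_chart_def
  proof (intro conjI allI impI ballI)
    show "open (prod.swap -` W)"
      using fibre_chart_open[OF chart] by (intro open_vimage continuous_intros)
  next
    fix p q assume "p \<in> prod.swap -` W" "q \<in> prod.swap -` W" "eval_xy H p = eval_xy H q"
    then obtain \<gamma> where \<gamma>: "valid_path \<gamma>" "\<gamma> 0 = prod.swap p" "\<gamma> 1 = prod.swap q"
      "\<forall>s\<in>{0..1}. \<gamma> s \<in> W \<and> eval_xy H (prod.swap (\<gamma> s)) = eval_xy H p"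
      using fibre_chart_path[OF chart, of "prod.swap p" "prod.swap q"] by auto
    then show "\<exists>\<gamma>. valid_path \<gamma> \<and> \<gamma> 0 = p \<and> \<gamma> 1 = q \<and>
      (\<forall>s\<in>{0..1}. \<gamma> s \<in> prod.swap -` W \<and> eval_xy H (\<gamma> s) = eval_xy H p)"
      by (intro exI[of _ "\<lambda>s. prod.swap (\<gamma> s)"]) (simp add: valid_path_swap)
  next
    fix t
    have "prod.swap -` W \<inter> level_curve H t = prod.swap ` (W \<inter> level_curve (swap_xy H) t)"
      by (force simp: level_curve_def image_iff)
    then show "simply_connected (prod.swap -` W \<inter> level_curve H t)"
      using fibre_chart_simply_connected[OF chart, of t] homeomorphism_swap[of "W \<inter> level_curve (swap_xy H) t"]
        homeomorphic_simply_connected_eq homeomorphic_def by metis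
  next
    fix \<omega> and \<gamma> :: "real \<Rightarrow> complex \<times> complex" and a b :: real and t
    assume \<gamma>: "valid_path \<gamma>" "0 \<le> a" "a \<le> b" "b \<le> 1"
      "\<forall>s\<in>{a..b}. \<gamma> s \<in> prod.swap -` W \<and> eval_xy H (\<gamma> s) = t"
    obtain S where S: "finite S"
      "\<And>s. s \<in> {0..1} - S \<Longrightarrow> form_along (swap_form \<omega>) (\<lambda>s. prod.swap (\<gamma> s)) s = form_along \<omega> \<gamma> s"
      using form_along_swap[OF \<gamma>(1)] by metis
    have "(form_along (swap_form \<omega>) (\<lambda>s. prod.swap (\<gamma> s)) has_integral
      (F (swap_form \<omega>) (prod.swap (\<gamma> b)) - F (swap_form \<omega>) (prod.swap (\<gamma> a)))) {a..b}"
      using \<gamma> by (intro fibre_chart_integral[OF chart, where t = t] valid_path_swap) auto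
    then show "(form_along \<omega> \<gamma> has_integral
      (F (swap_form \<omega>) (prod.swap (\<gamma> b)) - F (swap_form \<omega>) (prod.swap (\<gamma> a)))) {a..b}"
      by (rule has_integral_spike_finite[OF S(1), rotated]) (use \<gamma> S(2) in auto)
  next
    fix \<omega> s t0 a b assume "section_at H s t0 a b" "s t0 \<in> prod.swap -` W"
    then show "(\<lambda>t. F (swap_form \<omega>) (prod.swap (s t))) field_differentiable (at t0)"
      using fibre_chart_differentiable[OF chart section_at_swap] by simp
  next
    fix \<omega> \<eta> t0 assume "ext_deriv \<omega> = wedge_dH H \<eta>"
    then have "swap_xy (deriv_x (snd \<omega>)) - swap_xy (deriv_y (fst \<omega>)) =
      swap_xy (deriv_x H) * swap_xy (snd \<eta>) - swap_xy (deriv_y H) * swap_xy (fst \<eta>)"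
      by (metis ext_deriv_def wedge_dH_def swap_xy_diff swap_xy_mult)
    \<comment> \<open>The exchange reverses the sign of \<open>dx \<and> dy\<close> on both sides,
      so the relation is preserved.\<close>
    then have "ext_deriv (swap_form \<omega>) = wedge_dH (swap_xy H) (swap_form \<eta>)"
      by (simp add: ext_deriv_def wedge_dH_def swap_form_def deriv_swap_xy algebra_simps)
    from fibre_chart_gelfand_leray[OF chart this, of t0] obtain k where k: "\<And>s a b. section_at (swap_xy H) s t0 a b \<Longrightarrow> s t0 \<in> W \<Longrightarrow>
      ((\<lambda>t. F (swap_form \<omega>) (s t)) has_field_derivative F (swap_form \<eta>) (s t0) +
        (eval_xy (fst (swap_form \<omega>)) (s t0) * a + eval_xy (snd (swap_form \<omega>)) (s t0) * b) - k) (at t0)"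
      by blast
    show "\<exists>k. \<forall>s a b. section_at H s t0 a b \<longrightarrow> s t0 \<in> prod.swap -` W \<longrightarrow>
      ((\<lambda>t. F (swap_form \<omega>) (prod.swap (s t))) has_field_derivative F (swap_form \<eta>) (prod.swap (s t0)) +
        (eval_xy (fst \<omega>) (s t0) * a + eval_xy (snd \<omega>) (s t0) * b) - k) (at t0)"
    proof (intro exI[of _ k] allI impI)
      fix s a b assume "section_at H s t0 a b" "s t0 \<in> prod.swap -` W"
      then show "((\<lambda>t. F (swap_form \<omega>) (prod.swap (s t))) has_field_derivative F (swap_form \<eta>) (prod.swap (s t0)) +
        (eval_xy (fst \<omega>) (s t0) * a + eval_xy (snd \<omega>) (s t0) * b) - k) (at t0)"
        using k[OF section_at_swap] by (simp add: swap_form_def add.commute)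
    qed
  qed
qed

section \<open>Charts and sections at arbitrary regular points\<close>

definition regular_point :: "poly_xy \<Rightarrow> complex \<times> complex \<Rightarrow> bool" where
  "regular_point H z \<longleftrightarrow> eval_dx H z \<noteq> 0 \<or> eval_dy H z \<noteq> 0"

lemma fibre_chart_exists:
  assumes "regular_point H z" "e > 0"
  obtains W F where "fibre_chart H W F" "z \<in> W" "W \<subseteq> ball z e"
proof (cases "eval_dy H z = 0")
  case False
  then obtain r R Y W where "implicit_chart H z r R Y W" "W \<subseteq> ball z e"
    using implicit_chart_exists[OF _ assms(2)] by metis
  then show ?thesis
    using that implicit_chart.fibre_chart_prim implicit_chart.z_in_W by blast
next
  case True
  then have "eval_dy (swap_xy H) (prod.swap z) \<noteq> 0"
    using assms(1) by (simp add: regular_point_def deriv_swap_xy)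
  then obtain r R Y W where W: "implicit_chart (swap_xy H) (prod.swap z) r R Y W" "W \<subseteq> ball (prod.swap z) e"
    using implicit_chart_exists[OF _ assms(2)] by metis
  have "dist (prod.swap z) (prod.swap p) = dist z p" for p
    by (simp add: dist_prod_def add.commute)
  then have "prod.swap -` W \<subseteq> ball z e"
    using W(2) by fastforce
  then show ?thesis
    using that[OF fibre_chart_swap[OF implicit_chart.fibre_chart_prim[OF W(1)]]] implicit_chart.z_in_W[OF W(1)]
    by auto
qed

lemma section_at_exists:
  assumes "regular_point H z"
  obtains s a b where "section_at H s (eval_xy H z) a b" "s (eval_xy H z) = z"
proof (cases "eval_dy H z = 0")
  case False
  then obtain r R Y W where "implicit_chart H z r R Y W"
    by (rule implicit_chart_exists[where e = 1]) auto
  then show ?thesis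
    using that implicit_chart.section_exists by blast
next
  case True
  then have "eval_dy (swap_xy H) (prod.swap z) \<noteq> 0"
    using assms(1) by (simp add: regular_point_def deriv_swap_xy)
  then obtain r R Y W where "implicit_chart (swap_xy H) (prod.swap z) r R Y W"
    by (rule implicit_chart_exists[where e = 1]) auto
  from implicit_chart.section_exists[OF this] obtain s a b where
    "section_at (swap_xy H) s (eval_xy H z) a b" "s (eval_xy H z) = prod.swap z"
    by auto
  then show ?thesis
    using that[of "\<lambda>t. prod.swap (s t)" b a] section_at_swap[of "swap_xy H"] by auto
qed

section \<open>The cocycle of short integrals\<close>

text \<open>On the level of \<open>p\<close>, integrals along paths inside the ball depend on the
  end points only.\<close>

definition good_radius :: "poly_xy \<Rightarrow> complex \<times> complex \<Rightarrow> real \<Rightarrow> bool" where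
  "good_radius H p r \<longleftrightarrow> (\<exists>F. \<forall>\<omega> \<gamma>. valid_path \<gamma> \<longrightarrow>
    (\<forall>s\<in>{0..1}. \<gamma> s \<in> ball p r \<and> eval_xy H (\<gamma> s) = eval_xy H p) \<longrightarrow>
    path_integral \<omega> \<gamma> = F \<omega> (\<gamma> 1) - F \<omega> (\<gamma> 0))"

text \<open>The largest good radius among \<open>1, 1/2, 1/3, ...\<close>. This canonical choice
  makes \<open>fibre_diff\<close> depend on the two points but on no chart.\<close>

definition radius_index :: "poly_xy \<Rightarrow> complex \<times> complex \<Rightarrow> nat" where
  "radius_index H p = (LEAST m. good_radius H p (1 / real (Suc m)))"

text \<open>The radius attached to \<open>p\<close> makes the choice of the path irrelevant; the value is meaningful
  only if \<open>p\<close> and \<open>q\<close> are close and on the same level curve.\<close>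

definition fibre_diff :: "poly_xy \<Rightarrow> one_form \<Rightarrow> complex \<times> complex \<Rightarrow> complex \<times> complex \<Rightarrow> complex" where
  "fibre_diff H \<omega> p q = (SOME v. \<exists>\<gamma>. valid_path \<gamma> \<and> \<gamma> 0 = p \<and> \<gamma> 1 = q \<and> v = path_integral \<omega> \<gamma> \<and>
    (\<forall>s\<in>{0..1}. \<gamma> s \<in> ball p (1 / real (Suc (radius_index H p))) \<and> eval_xy H (\<gamma> s) = eval_xy H p))"

lemma fibre_chart_path_integral:
  assumes "fibre_chart H W F" "valid_path \<gamma>"
    "\<And>s. s \<in> {0..1} \<Longrightarrow> \<gamma> s \<in> W" "\<And>s. s \<in> {0..1} \<Longrightarrow> eval_xy H (\<gamma> s) = t"
  shows "path_integral \<omega> \<gamma> = F \<omega> (\<gamma> 1) - F \<omega> (\<gamma> 0)"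
  unfolding path_integral_form_along
  by (rule integral_unique, rule fibre_chart_integral[OF assms(1,2), where t = t]) (use assms(3,4) in auto)

definition exact_chart ::
    "poly_xy \<Rightarrow> (complex \<times> complex) set \<Rightarrow> (one_form \<Rightarrow> complex \<times> complex \<Rightarrow> complex) \<Rightarrow> bool" where
  "exact_chart H W F \<longleftrightarrow> fibre_chart H W F \<and>
    (\<forall>\<omega>. \<forall>p\<in>W. \<forall>q\<in>W. eval_xy H p = eval_xy H q \<longrightarrow> fibre_diff H \<omega> p q = F \<omega> q - F \<omega> p)"

lemma exact_chart_diff:
  assumes "exact_chart H W F"
  shows "p \<in> W \<Longrightarrow> q \<in> W \<Longrightarrow> eval_xy H p = eval_xy H q \<Longrightarrow> fibre_diff H \<omega> p q = F \<omega> q - F \<omega> p"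
  using assms[unfolded exact_chart_def, THEN conjunct2, rule_format, of p q \<omega>] by simp

lemma exact_chart_fibre_chart: "exact_chart H W F \<Longrightarrow> fibre_chart H W F"
  unfolding exact_chart_def by (erule conjunct1)

text \<open>Two nested charts are used. The large one shows that all points near \<open>z\<close>
  share a lower bound for their good radius; the small one is so small that its connecting paths
  stay within that radius.\<close>

lemma exact_chart_exists:
  assumes "regular_point H z"
  obtains W F where "exact_chart H W F" "z \<in> W"
proof -
  obtain W1 F1 where W1: "fibre_chart H W1 F1" "z \<in> W1"
    by (rule fibre_chart_exists[OF assms, of 1]) auto
  obtain e where e: "e > 0" "ball z e \<subseteq> W1"
    using fibre_chart_open[OF W1(1)] W1(2) openE by blast
  obtain M where "inverse (real (Suc M)) < e / 2"
    using e(1) reals_Archimedean[of "e / 2"] by auto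
  then have M: "2 * (1 / real (Suc M)) < e"
    unfolding inverse_eq_divide by linarith
  \<comment> \<open>Points of the small chart are within \<open>\<rho> / 2\<close> of
    \<open>z\<close>, so balls of radius \<open>\<rho>\<close> around them stay in the large chart.
    The shape \<open>1 / Suc M\<close> makes \<open>\<rho>\<close> a candidate for
    \<open>radius_index\<close>.\<close>
  define \<rho> where "\<rho> = 1 / real (Suc M)"
  have \<rho>: "\<rho> > 0" "2 * \<rho> < e"
    using M unfolding \<rho>_def by auto
  obtain W F where W: "fibre_chart H W F" "z \<in> W" "W \<subseteq> ball z (\<rho> / 2)"
    by (rule fibre_chart_exists[OF assms, of "\<rho> / 2"]) (use \<rho> in auto)
  have exact: "fibre_diff H \<omega> p q = F \<omega> q - F \<omega> p" if pq: "p \<in> W" "q \<in> W" "eval_xy H p = eval_xy H q" for \<omega> p q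
  proof -
    have zp: "dist z p < \<rho> / 2"
      using pq(1) W(3) by auto
    have sub: "ball p \<rho> \<subseteq> W1"
    proof
      fix x assume "x \<in> ball p \<rho>"
      then have "dist z x < e"
        using dist_triangle[of z x p] zp \<rho> by auto
      then show "x \<in> W1"
        using e by auto
    qed
    have good: "good_radius H p (1 / real (Suc M))"
      unfolding good_radius_def \<rho>_def[symmetric]
      by (rule exI[of _ F1]) (use fibre_chart_path_integral[OF W1(1)] sub in blast)
    define \<kappa> where "\<kappa> = 1 / real (Suc (radius_index H p))"
    have "radius_index H p \<le> M"
      unfolding radius_index_def using good by (rule Least_le)
    \<comment> \<open>The radius really used at \<open>p\<close> may be larger than
      \<open>\<rho>\<close>; it is good by its own definition, and its ball contains the small
      chart.\<close>
    then have \<kappa>: "\<rho> \<le> \<kappa>"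
      by (simp add: \<rho>_def \<kappa>_def frac_le)
    have "good_radius H p \<kappa>"
      unfolding \<kappa>_def radius_index_def using good by (rule LeastI)
    then obtain G where G: "\<And>\<omega> \<gamma>. valid_path \<gamma> \<Longrightarrow>
      (\<forall>s\<in>{0..1}. \<gamma> s \<in> ball p \<kappa> \<and> eval_xy H (\<gamma> s) = eval_xy H p) \<Longrightarrow>
      path_integral \<omega> \<gamma> = G \<omega> (\<gamma> 1) - G \<omega> (\<gamma> 0)"
      unfolding good_radius_def by blast
    obtain \<gamma> where \<gamma>: "valid_path \<gamma>" "\<gamma> 0 = p" "\<gamma> 1 = q"
      "\<And>s. s \<in> {0..1} \<Longrightarrow> \<gamma> s \<in> W" "\<And>s. s \<in> {0..1} \<Longrightarrow> eval_xy H (\<gamma> s) = eval_xy H p"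
      using fibre_chart_path[OF W(1) pq] by blast
    have in_ball: "\<forall>s\<in>{0..1}. \<gamma> s \<in> ball p \<kappa> \<and> eval_xy H (\<gamma> s) = eval_xy H p"
    proof (intro ballI conjI)
      fix s :: real assume s: "s \<in> {0..1}"
      have "dist z (\<gamma> s) < \<rho> / 2"
        using \<gamma>(4)[OF s] W(3) by auto
      then show "\<gamma> s \<in> ball p \<kappa>"
        using dist_triangle2[of p "\<gamma> s" z] zp \<kappa> by (auto simp: dist_commute)
    qed (rule \<gamma>(5))
    have I: "path_integral \<omega> \<gamma> = F \<omega> q - F \<omega> p"
      using fibre_chart_path_integral[OF W(1) \<gamma>(1,4,5)] \<gamma>(2,3) by simp
    have "fibre_diff H \<omega> p q = path_integral \<omega> \<gamma>"
      unfolding fibre_diff_def \<kappa>_def[symmetric]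
    proof (rule some_equality)
      show "\<exists>\<gamma>'. valid_path \<gamma>' \<and> \<gamma>' 0 = p \<and> \<gamma>' 1 = q \<and> path_integral \<omega> \<gamma> = path_integral \<omega> \<gamma>' \<and>
        (\<forall>s\<in>{0..1}. \<gamma>' s \<in> ball p \<kappa> \<and> eval_xy H (\<gamma>' s) = eval_xy H p)"
        using \<gamma> in_ball by blast
      fix v assume "\<exists>\<gamma>'. valid_path \<gamma>' \<and> \<gamma>' 0 = p \<and> \<gamma>' 1 = q \<and> v = path_integral \<omega> \<gamma>' \<and>
        (\<forall>s\<in>{0..1}. \<gamma>' s \<in> ball p \<kappa> \<and> eval_xy H (\<gamma>' s) = eval_xy H p)"
      then obtain \<gamma>' where "valid_path \<gamma>'" "\<gamma>' 0 = p" "\<gamma>' 1 = q" "v = path_integral \<omega> \<gamma>'"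
        "\<forall>s\<in>{0..1}. \<gamma>' s \<in> ball p \<kappa> \<and> eval_xy H (\<gamma>' s) = eval_xy H p"
        by blast
      then show "v = path_integral \<omega> \<gamma>"
        using G[of \<gamma>' \<omega>] G[OF \<gamma>(1) in_ball, of \<omega>] \<gamma>(2,3) by simp
    qed
    then show ?thesis
      using I by simp
  qed
  have "exact_chart H W F"
    unfolding exact_chart_def by (intro conjI allI ballI impI W(1) exact)
  then show ?thesis
    using W(2) by (rule that)
qed

lemma exact_charts_lebesgue:
  assumes "compact K" "\<And>z. z \<in> K \<Longrightarrow> regular_point H z"
  obtains e where "e > 0" "\<And>z. z \<in> K \<Longrightarrow> \<exists>W F. exact_chart H W F \<and> ball z e \<subseteq> W"
proof -
  let ?G = "{W. \<exists>F. exact_chart H W F}"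
  have "K \<subseteq> \<Union>?G"
    using assms(2) exact_chart_exists by blast
  moreover have "\<And>W. W \<in> ?G \<Longrightarrow> open W"
    using fibre_chart_open exact_chart_fibre_chart by blast
  ultimately obtain e where "e > 0" "\<forall>z\<in>K. \<exists>W\<in>?G. ball z e \<subseteq> W"
    using Heine_Borel_lemma[OF assms(1)] by metis
  then show ?thesis
    using that by blast
qed

text \<open>Neither \<open>D\<close> nor the local potentials are required to be continuous; the
  arguments below rest on additivity alone.\<close>

definition locally_exact :: "'a::metric_space set \<Rightarrow> ('a \<Rightarrow> 'a \<Rightarrow> complex) \<Rightarrow> bool" where
  "locally_exact X D \<longleftrightarrow>
    (\<forall>z\<in>X. \<exists>N f. open N \<and> z \<in> N \<and> (\<forall>p\<in>N \<inter> X. \<forall>q\<in>N \<inter> X. D p q = f q - f p))"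

lemma locally_exact_fibre_diff:
  assumes "\<And>z. z \<in> level_curve H t \<Longrightarrow> regular_point H z"
  shows "locally_exact (level_curve H t) (fibre_diff H \<omega>)"
  unfolding locally_exact_def
proof
  fix z assume "z \<in> level_curve H t"
  then obtain W F where WF: "exact_chart H W F" "z \<in> W"
    using exact_chart_exists assms by metis
  then show "\<exists>N f. open N \<and> z \<in> N \<and>
    (\<forall>p\<in>N \<inter> level_curve H t. \<forall>q\<in>N \<inter> level_curve H t. fibre_diff H \<omega> p q = f q - f p)"
    using exact_chart_diff[OF WF(1)] fibre_chart_open[OF exact_chart_fibre_chart[OF WF(1)]] WF(2)
    by (intro exI[of _ W] exI[of _ "F \<omega>"]) (auto simp: level_curve_def)
qed

lemma locally_exact_lebesgue:
  assumes "locally_exact X D" "compact K" "K \<subseteq> X"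
  obtains e where "e > 0" "\<And>z. z \<in> K \<Longrightarrow> \<exists>f. \<forall>p\<in>ball z e \<inter> X. \<forall>q\<in>ball z e \<inter> X. D p q = f q - f p"
proof -
  define G where "G = {N. open N \<and> (\<exists>f. \<forall>p\<in>N \<inter> X. \<forall>q\<in>N \<inter> X. D p q = f q - f p)}"
  have cover: "K \<subseteq> \<Union>G"
  proof
    fix z assume "z \<in> K"
    with assms(3) have "z \<in> X" ..
    from bspec[OF assms(1)[unfolded locally_exact_def] this] obtain N f where "open N" "z \<in> N"
      "\<forall>p\<in>N \<inter> X. \<forall>q\<in>N \<inter> X. D p q = f q - f p"
      by (elim exE conjE)
    then show "z \<in> \<Union>G"
      unfolding G_def by (intro UnionI[of N] CollectI conjI exI[of _ f])
  qed
  have opens: "\<And>N. N \<in> G \<Longrightarrow> open N"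
    unfolding G_def by (erule CollectE, erule conjunct1)
  obtain e where e: "e > 0" "\<And>z. z \<in> K \<Longrightarrow> \<exists>N\<in>G. ball z e \<subseteq> N"
    using Heine_Borel_lemma[OF assms(2) cover opens] by blast
  have "\<exists>f. \<forall>p\<in>ball z e \<inter> X. \<forall>q\<in>ball z e \<inter> X. D p q = f q - f p" if z: "z \<in> K" for z
  proof -
    obtain N f where N: "ball z e \<subseteq> N" "\<forall>p\<in>N \<inter> X. \<forall>q\<in>N \<inter> X. D p q = f q - f p"
      using e(2)[OF z] unfolding G_def by (elim bexE CollectE conjE exE)
    show ?thesis
    proof (intro exI ballI)
      fix p q assume "p \<in> ball z e \<inter> X" "q \<in> ball z e \<inter> X"
      then have "p \<in> N \<inter> X" "q \<in> N \<inter> X"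
        using N(1) by auto
      then show "D p q = f q - f p"
        using N(2) by simp
    qed
  qed
  then show ?thesis
    by (rule that[OF e(1)])
qed

text \<open>On a convex parameter domain the cocycle \<open>D\<close> is summed along the segments from a base
  point; comparing the sums for two nearby points rung by rung shows that the result is a
  primitive.\<close>

lemma primitive_on_convex:
  fixes \<sigma> :: "'b::real_normed_vector \<Rightarrow> 'a::metric_space"
  assumes D: "locally_exact X D" and K: "compact K" "convex K" "K \<noteq> {}"
    and \<sigma>: "continuous_on K \<sigma>" "\<sigma> ` K \<subseteq> X"
  shows "\<exists>g. \<exists>d>0. \<forall>p\<in>K. \<forall>q\<in>K. dist p q < d \<longrightarrow> D (\<sigma> p) (\<sigma> q) = g q - g p"
proof -
  obtain e where e: "e > 0"
    "\<And>z. z \<in> \<sigma> ` K \<Longrightarrow> \<exists>f. \<forall>p\<in>ball z e \<inter> X. \<forall>q\<in>ball z e \<inter> X. D p q = f q - f p"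
    using locally_exact_lebesgue[OF D compact_continuous_image[OF \<sigma>(1) K(1)] \<sigma>(2)] by metis
  have "uniformly_continuous_on K \<sigma>"
    using \<sigma>(1) K(1) by (rule compact_uniformly_continuous)
  then obtain d where d: "d > 0" "\<And>p q. p \<in> K \<Longrightarrow> q \<in> K \<Longrightarrow> dist p q < d \<Longrightarrow> dist (\<sigma> p) (\<sigma> q) < e"
    using e(1) unfolding uniformly_continuous_on_def by (metis dist_commute)
  obtain k0 where k0: "k0 \<in> K"
    using K(3) by blast
  obtain M where M: "\<And>p. p \<in> K \<Longrightarrow> dist k0 p \<le> M"
    using compact_imp_bounded[OF K(1)] bounded_any_center by metis
  \<comment> \<open>Each segment from \<open>k0\<close> is cut into steps shorter than
    \<open>d / 2\<close>; the other half of \<open>d\<close> is left for the distance between the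
    two segments.\<close>
  obtain N :: nat where N: "M < real N * (d / 2)"
    using reals_Archimedean3[of "d / 2"] d(1) by auto
  have "0 \<le> M"
    using M[OF k0] by simp
  then have N0: "N > 0"
    using N by (cases N) auto
  define pt where "pt p k = k0 + (real k / real N) *\<^sub>R (p - k0)" for p k
  have pt_K: "pt p k \<in> K" if "p \<in> K" "k \<le> N" for p k
  proof -
    have "(1 - real k / real N) *\<^sub>R k0 + (real k / real N) *\<^sub>R p \<in> K"
      using that N0 k0 by (intro convexD[OF K(2)]) (auto simp: divide_le_eq_1)
    then show ?thesis
      by (simp add: pt_def algebra_simps)
  qed
  have pt_step: "dist (pt p k) (pt p (Suc k)) < d / 2" if "p \<in> K" for p k
  proof -
    have "pt p k - pt p (Suc k) = (real k / real N - real (Suc k) / real N) *\<^sub>R (p - k0)"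
      by (simp add: pt_def scaleR_left_diff_distrib)
    also have "real k / real N - real (Suc k) / real N = - (1 / real N)"
      by (simp add: diff_divide_distrib[symmetric])
    finally have "dist (pt p k) (pt p (Suc k)) = dist k0 p / real N"
      by (simp add: dist_norm norm_minus_commute divide_inverse mult.commute)
    also have "\<dots> \<le> M / real N"
      using M[OF that] by (simp add: divide_right_mono)
    also have "\<dots> < d / 2"
      using N N0 by (simp add: pos_divide_less_eq mult.commute)
    finally show ?thesis .
  qed
  have pt_near: "dist (pt p k) (pt q k) \<le> dist p q" if "k \<le> N" for p q k
  proof -
    have "pt p k - pt q k = (real k / real N) *\<^sub>R (p - q)"
      by (simp add: pt_def algebra_simps)
    then have "dist (pt p k) (pt q k) = (real k / real N) * dist p q"
      by (simp add: dist_norm)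
    moreover have "real k / real N \<le> 1"
      using that N0 by simp
    ultimately show ?thesis
      using mult_right_mono[of "real k / real N" 1 "dist p q"] by simp
  qed
  define g where "g m p = (\<Sum>k<m. D (\<sigma> (pt p k)) (\<sigma> (pt p (Suc k))))" for m p
  have ladder: "g m q - g m p = D (\<sigma> (pt p m)) (\<sigma> (pt q m))"
    if pq: "p \<in> K" "q \<in> K" "dist p q < d / 2" and "m \<le> N" for p q m
    using \<open>m \<le> N\<close>
  proof (induction m)
    case 0
    obtain f where "\<forall>p\<in>ball (\<sigma> k0) e \<inter> X. \<forall>q\<in>ball (\<sigma> k0) e \<inter> X. D p q = f q - f p"
      using e(2) k0 by blast
    then have "D (\<sigma> k0) (\<sigma> k0) = 0"
      using e(1) k0 \<sigma>(2) by (simp add: image_subset_iff)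
    then show ?case
      by (simp add: g_def pt_def)
  next
    case (Suc m)
    let ?a = "pt p m" and ?b = "pt q m" and ?a' = "pt p (Suc m)" and ?b' = "pt q (Suc m)"
    have K4: "?a \<in> K" "?b \<in> K" "?a' \<in> K" "?b' \<in> K"
      using pt_K pq(1,2) Suc.prems by auto
    \<comment> \<open>All four corners of the quadrilateral lie in this ball, where \<open>D\<close>
      is a coboundary, so its values around the quadrilateral cancel.\<close>
    obtain f where f: "\<forall>u\<in>ball (\<sigma> ?a) e \<inter> X. \<forall>v\<in>ball (\<sigma> ?a) e \<inter> X. D u v = f v - f u"
      using e(2) K4(1) by blast
    have "dist ?a ?b < d" "dist ?a ?a' < d"
      using pt_near[of m p q] pt_step[OF pq(1), of m] pq(3) Suc.prems d(1) by auto
    moreover have "dist ?a ?b' < d"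
      using dist_triangle[of ?a ?b' ?b] pt_near[of m p q] pt_step[OF pq(2), of m] pq(3) Suc.prems by auto
    ultimately have "\<sigma> ?b \<in> ball (\<sigma> ?a) e \<inter> X" "\<sigma> ?a' \<in> ball (\<sigma> ?a) e \<inter> X" "\<sigma> ?b' \<in> ball (\<sigma> ?a) e \<inter> X"
      "\<sigma> ?a \<in> ball (\<sigma> ?a) e \<inter> X"
      using d(2) K4 \<sigma>(2) e(1) by auto
    then have "D (\<sigma> ?a) (\<sigma> ?b) = f (\<sigma> ?b) - f (\<sigma> ?a)" "D (\<sigma> ?a) (\<sigma> ?a') = f (\<sigma> ?a') - f (\<sigma> ?a)"
      "D (\<sigma> ?b) (\<sigma> ?b') = f (\<sigma> ?b') - f (\<sigma> ?b)" "D (\<sigma> ?a') (\<sigma> ?b') = f (\<sigma> ?b') - f (\<sigma> ?a')"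
      using f by blast+
    moreover have "g (Suc m) q - g (Suc m) p = (g m q - g m p) + (D (\<sigma> ?b) (\<sigma> ?b') - D (\<sigma> ?a) (\<sigma> ?a'))"
      by (simp add: g_def)
    ultimately show ?case
      using Suc.IH Suc.prems by simp
  qed
  have "pt p N = p" for p
    using N0 by (simp add: pt_def)
  then have "D (\<sigma> p) (\<sigma> q) = g N q - g N p" if "p \<in> K" "q \<in> K" "dist p q < d / 2" for p q
    using ladder[OF that order_refl] by simp
  then show ?thesis
    using d(1) by (intro exI[of _ "g N"] exI[of _ "d / 2"] conjI ballI impI) simp_all
qed

section \<open>Summation of a locally exact cocycle along a continuous path\<close>

definition cocycle_sum :: "('a \<Rightarrow> 'a \<Rightarrow> complex) \<Rightarrow> (real \<Rightarrow> 'a) \<Rightarrow> nat \<Rightarrow> complex" where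
  "cocycle_sum D \<gamma> N = (\<Sum>k<N. D (\<gamma> (real k / real N)) (\<gamma> (real (Suc k) / real N)))"

text \<open>For a locally exact cocycle and a continuous path in its domain the sums are eventually
  constant, and the limit merely selects that value.\<close>

definition cocycle_integral :: "('a \<Rightarrow> 'a \<Rightarrow> complex) \<Rightarrow> (real \<Rightarrow> 'a) \<Rightarrow> complex" where
  "cocycle_integral D \<gamma> = lim (cocycle_sum D \<gamma>)"

lemma cocycle_integral_eventually:
  "\<forall>\<^sub>F N in sequentially. cocycle_sum D \<gamma> N = v \<Longrightarrow> cocycle_integral D \<gamma> = v"
  unfolding cocycle_integral_def by (intro limI tendsto_eventually)

text \<open>Positivity of \<open>N\<close> is listed separately because \<open>1 / 0 = 0\<close>
  would pass for a fine mesh.\<close>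

lemma eventually_mesh: "d > 0 \<Longrightarrow> \<forall>\<^sub>F N in sequentially. 1 / real N < d \<and> N > 0"
  using eventually_conj[OF order_tendstoD(2)[OF lim_1_over_n] eventually_gt_at_top[of "0::nat"]] by fastforce

lemma cocycle_sum_primitive:
  assumes g: "\<And>s s'. s \<in> {0..1} \<Longrightarrow> s' \<in> {0..1} \<Longrightarrow> dist s s' < d \<Longrightarrow> D (\<gamma> s) (\<gamma> s') = g s' - g s"
    and N: "1 / real N < d" "N > 0"
  shows "cocycle_sum D \<gamma> N = g 1 - g 0"
proof -
  have "cocycle_sum D \<gamma> N = (\<Sum>k<N. g (real (Suc k) / real N) - g (real k / real N))"
    unfolding cocycle_sum_def
  proof (rule sum.cong[OF refl])
    fix k assume k: "k \<in> {..<N}"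
    have step: "real (Suc k) / real N - real k / real N = 1 / real N"
      by (simp add: diff_divide_distrib[symmetric])
    have "dist (real k / real N) (real (Suc k) / real N) = \<bar>real (Suc k) / real N - real k / real N\<bar>"
      by (rule trans[OF dist_real_def abs_minus_commute])
    then have "dist (real k / real N) (real (Suc k) / real N) < d"
      unfolding step using N by simp
    then show "D (\<gamma> (real k / real N)) (\<gamma> (real (Suc k) / real N)) = g (real (Suc k) / real N) - g (real k / real N)"
      using k N by (intro g) (auto simp: divide_le_eq_1)
  qed
  also have "\<dots> = g 1 - g 0"
    using sum_lessThan_telescope[of "\<lambda>k. g (real k / real N)" N] N by simp
  finally show ?thesis .
qed

lemma cocycle_integral_primitive:
  assumes "d > 0" "\<And>s s'. s \<in> {0..1} \<Longrightarrow> s' \<in> {0..1} \<Longrightarrow> dist s s' < d \<Longrightarrow> D (\<gamma> s) (\<gamma> s') = g s' - g s"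
  shows "cocycle_integral D \<gamma> = g 1 - g 0"
  using eventually_mesh[OF assms(1)]
  by (intro cocycle_integral_eventually, elim eventually_mono)
    (rule cocycle_sum_primitive[where d = d and g = g and \<gamma> = \<gamma> and D = D], use assms(2) in blast, auto)

text \<open>Once the mesh is fine enough, every piece of the path lies in one exact chart, where the
  integral is the short difference. Integrability is obtained along with the value.\<close>

lemma form_along_has_integral:
  assumes \<gamma>: "valid_path \<gamma>" and X: "\<And>s. s \<in> {0..1} \<Longrightarrow> \<gamma> s \<in> level_curve H t"
    and reg: "\<And>z. z \<in> level_curve H t \<Longrightarrow> regular_point H z"
  shows "(form_along \<omega> \<gamma> has_integral cocycle_integral (fibre_diff H \<omega>) \<gamma>) {0..1}"
proof -
  have cont: "continuous_on {0..1} \<gamma>"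
    using valid_path_imp_path[OF \<gamma>] by (simp add: path_def)
  obtain e where e: "e > 0" "\<And>z. z \<in> \<gamma> ` {0..1} \<Longrightarrow> \<exists>W F. exact_chart H W F \<and> ball z e \<subseteq> W"
    using exact_charts_lebesgue[OF compact_continuous_image[OF cont compact_Icc], of H] X reg by blast
  have "uniformly_continuous_on {0..1} \<gamma>"
    using cont by (rule compact_uniformly_continuous) simp
  then obtain d where d: "d > 0"
    "\<And>p q. p \<in> {0..1} \<Longrightarrow> q \<in> {0..1} \<Longrightarrow> dist p q < d \<Longrightarrow> dist (\<gamma> p) (\<gamma> q) < e"
    using e(1) unfolding uniformly_continuous_on_def by (metis dist_commute)
  have step: "(form_along \<omega> \<gamma> has_integral fibre_diff H \<omega> (\<gamma> a) (\<gamma> b)) {a..b}"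
    if ab: "0 \<le> a" "a \<le> b" "b \<le> 1" "b - a < d" for a b
  proof -
    obtain W F where W: "exact_chart H W F" "ball (\<gamma> a) e \<subseteq> W"
      using e(2)[of "\<gamma> a"] ab by auto
    have in_W: "\<gamma> s \<in> W" if "s \<in> {a..b}" for s
      using d(2)[of a s] W(2) ab that by (auto simp: dist_real_def)
    have lev: "eval_xy H (\<gamma> s) = t" if "s \<in> {a..b}" for s
      using X[of s] ab that by (auto simp: level_curve_def)
    have "fibre_diff H \<omega> (\<gamma> a) (\<gamma> b) = F \<omega> (\<gamma> b) - F \<omega> (\<gamma> a)"
      using in_W[of a] in_W[of b] lev[of a] lev[of b] ab by (intro exact_chart_diff[OF W(1)]) auto
    then show ?thesis
      using fibre_chart_integral[OF exact_chart_fibre_chart[OF W(1)] \<gamma> ab(1-3) in_W lev, of \<omega>] by simp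
  qed
  have sum: "(form_along \<omega> \<gamma> has_integral cocycle_sum (fibre_diff H \<omega>) \<gamma> N) {0..1}"
    if N: "1 / real N < d" "N > 0" for N
  proof -
    have "(form_along \<omega> \<gamma> has_integral
      (\<Sum>k<m. fibre_diff H \<omega> (\<gamma> (real k / real N)) (\<gamma> (real (Suc k) / real N)))) {0..real m / real N}"
      if "m \<le> N" for m
      using that
    proof (induction m)
      case 0
      then show ?case
        by (simp add: has_integral_refl)
    next
      case (Suc m)
      have "real (Suc m) / real N - real m / real N = 1 / real N"
        by (simp add: diff_divide_distrib[symmetric])
      then have "(form_along \<omega> \<gamma> has_integral fibre_diff H \<omega> (\<gamma> (real m / real N)) (\<gamma> (real (Suc m) / real N)))
        {real m / real N..real (Suc m) / real N}"
        using N Suc.prems by (intro step) (auto simp: divide_right_mono)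
      then show ?case
        using has_integral_combine[OF _ _ Suc.IH] Suc.prems by (simp add: divide_right_mono)
    qed
    from this[of N] show ?thesis
      using N by (simp add: cocycle_sum_def)
  qed
  have "integral {0..1} (form_along \<omega> \<gamma>) = cocycle_integral (fibre_diff H \<omega>) \<gamma>"
    using eventually_mesh[OF d(1)]
    by (intro cocycle_integral_eventually[symmetric], elim eventually_mono) (metis integral_unique sum)
  moreover obtain N where "1 / real N < d \<and> N > 0"
    using eventually_happens'[OF _ eventually_mesh[OF d(1)]] by auto
  then have "form_along \<omega> \<gamma> integrable_on {0..1}"
    using sum by blast
  ultimately show ?thesis
    by (metis integrable_integral)
qed

section \<open>Integration over singular chains\<close>

text \<open>Linear extension from generators to integral chains, with complex values;
  \<open>frag_extend\<close> has chains as values.\<close>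

definition frag_linear :: "('a \<Rightarrow> complex) \<Rightarrow> ('a \<Rightarrow>\<^sub>0 int) \<Rightarrow> complex" where
  "frag_linear \<phi> c = (\<Sum>x\<in>Poly_Mapping.keys c. of_int (Poly_Mapping.lookup c x) * \<phi> x)"

lemma frag_linear_superset:
  assumes "finite S" "Poly_Mapping.keys c \<subseteq> S"
  shows "frag_linear \<phi> c = (\<Sum>x\<in>S. of_int (Poly_Mapping.lookup c x) * \<phi> x)"
  unfolding frag_linear_def
  by (rule sum.mono_neutral_left) (use assms in \<open>auto simp: in_keys_iff\<close>)

lemma frag_linear_diff [simp]: "frag_linear \<phi> (a - b) = frag_linear \<phi> a - frag_linear \<phi> b"
proof -
  let ?S = "Poly_Mapping.keys a \<union> Poly_Mapping.keys b"
  show ?thesis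
    using frag_linear_superset[of ?S a \<phi>] frag_linear_superset[of ?S b \<phi>] frag_linear_superset[of ?S "a - b" \<phi>]
    by (simp add: keys_diff lookup_minus sum_subtractf[symmetric] left_diff_distrib)
qed

lemma frag_linear_0 [simp]: "frag_linear \<phi> 0 = 0"
  by (simp add: frag_linear_def)

lemma frag_linear_uminus [simp]: "frag_linear \<phi> (- a) = - frag_linear \<phi> a"
  using frag_linear_diff[of \<phi> 0 a] by simp

lemma frag_linear_add [simp]: "frag_linear \<phi> (a + b) = frag_linear \<phi> a + frag_linear \<phi> b"
  using frag_linear_diff[of \<phi> a "- b"] by simp

lemma frag_linear_of [simp]: "frag_linear \<phi> (frag_of x) = \<phi> x"
  by (simp add: frag_linear_def)

lemma frag_linear_cmul [simp]: "frag_linear \<phi> (frag_cmul k a) = of_int k * frag_linear \<phi> a"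
  by (subst (1 2) frag_linear_superset[of "Poly_Mapping.keys a"])
    (auto simp: sum_distrib_left mult.assoc)

lemma frag_linear_sum: "frag_linear \<phi> (sum f A) = (\<Sum>a\<in>A. frag_linear \<phi> (f a))"
  by (induction A rule: infinite_finite_induct) auto

lemma frag_linear_extend: "frag_linear \<phi> (frag_extend f c) = frag_linear (\<lambda>x. frag_linear \<phi> (f x)) c"
  unfolding frag_extend_def by (simp add: frag_linear_sum frag_linear_def[of _ c])

lemma frag_linear_cong:
  "(\<And>x. x \<in> Poly_Mapping.keys c \<Longrightarrow> \<phi> x = \<psi> x) \<Longrightarrow> frag_linear \<phi> c = frag_linear \<psi> c"
  by (simp add: frag_linear_def)

lemma chain_integral_frag_linear:
  "chain_integral \<omega> c = frag_linear (\<lambda>\<sigma>. path_integral \<omega> (path_of_simplex \<sigma>)) c"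
  by (simp add: chain_integral_def frag_linear_def)

lemma singular_simplex_compose_continuous:
  fixes \<sigma> :: "(nat \<Rightarrow> real) \<Rightarrow> 'a::topological_space" and f :: "'b::topological_space \<Rightarrow> nat \<Rightarrow> real"
  assumes \<sigma>: "singular_simplex p (top_of_set X) \<sigma>"
    and f: "\<And>i. continuous_on K (\<lambda>x. f x i)" "\<And>x. x \<in> K \<Longrightarrow> f x \<in> standard_simplex p"
  shows "continuous_on K (\<lambda>x. \<sigma> (f x))" "\<And>x. x \<in> K \<Longrightarrow> \<sigma> (f x) \<in> X"
proof -
  have "continuous_map (top_of_set K) (subtopology (powertop_real UNIV) (standard_simplex p)) f"
    using f by (auto simp: continuous_map_in_subtopology continuous_map_componentwise_UNIV)
  from continuous_map_compose[OF this, of "top_of_set X" \<sigma>]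
  have "continuous_map (top_of_set K) (top_of_set X) (\<lambda>x. \<sigma> (f x))"
    using \<sigma> by (simp add: singular_simplex_def o_def)
  then show "continuous_on K (\<lambda>x. \<sigma> (f x))" "\<And>x. x \<in> K \<Longrightarrow> \<sigma> (f x) \<in> X"
    by auto
qed

definition segment_param :: "real \<Rightarrow> nat \<Rightarrow> real" where
  "segment_param s = (\<lambda>j. if j = 0 then 1 - s else if j = 1 then s else 0)"

lemma path_of_simplex_param: "path_of_simplex \<sigma> s = \<sigma> (segment_param s)"
  by (simp add: path_of_simplex_def segment_param_def)

lemma segment_param_simplex: "s \<in> {0..1} \<Longrightarrow> segment_param s \<in> standard_simplex 1"
  by (auto simp: standard_simplex_def segment_param_def)

lemma path_of_simplex_continuous:
  assumes "singular_simplex 1 (top_of_set X) \<sigma>"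
  shows "continuous_on {0..1} (path_of_simplex \<sigma>)" "\<And>s. s \<in> {0..1} \<Longrightarrow> path_of_simplex \<sigma> s \<in> X"
proof -
  have "continuous_on {0..1} (\<lambda>s. segment_param s i)" for i
    unfolding segment_param_def by (cases "i = 0"; cases "i = 1") (auto intro!: continuous_intros)
  from singular_simplex_compose_continuous[OF assms this segment_param_simplex]
  show "continuous_on {0..1} (path_of_simplex \<sigma>)" "\<And>s. s \<in> {0..1} \<Longrightarrow> path_of_simplex \<sigma> s \<in> X"
    by (auto simp: path_of_simplex_param[abs_def])
qed

text \<open>Planar coordinates on the 2-simplex, which turn it into a convex subset of a normed
  space as \<open>primitive_on_convex\<close> requires.\<close>

definition triangle_param :: "real \<times> real \<Rightarrow> nat \<Rightarrow> real" where
  "triangle_param q = (\<lambda>j. if j = 0 then 1 - fst q - snd q else if j = 1 then fst q else if j = 2 then snd q else 0)"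

definition param_triangle :: "(real \<times> real) set" where
  "param_triangle = {q. 0 \<le> fst q \<and> 0 \<le> snd q \<and> fst q + snd q \<le> 1}"

lemma param_triangle_compact_convex: "compact param_triangle" "convex param_triangle" "param_triangle \<noteq> {}"
proof -
  have "closed param_triangle"
    unfolding param_triangle_def by (intro closed_Collect_conj closed_Collect_le continuous_intros)
  moreover have "param_triangle \<subseteq> cbox (0, 0) (1, 1)"
    by (auto simp: param_triangle_def cbox_Pair_eq)
  ultimately show "compact param_triangle"
    by (metis bounded_cbox bounded_subset compact_eq_bounded_closed)
  show "convex param_triangle"
  proof (rule convexI)
    fix p q u v assume h: "p \<in> param_triangle" "q \<in> param_triangle" "0 \<le> u" "0 \<le> v" "u + v = (1 :: real)"
    then have "u * (fst p + snd p) + v * (fst q + snd q) \<le> u * 1 + v * 1"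
      by (intro add_mono mult_left_mono) (auto simp: param_triangle_def)
    then show "u *\<^sub>R p + v *\<^sub>R q \<in> param_triangle"
      using h by (simp add: param_triangle_def algebra_simps)
  qed
  have "(0, 0) \<in> param_triangle"
    by (simp add: param_triangle_def)
  then show "param_triangle \<noteq> {}"
    by blast
qed

lemma triangle_param_simplex: "q \<in> param_triangle \<Longrightarrow> triangle_param q \<in> standard_simplex 2"
  by (auto simp: standard_simplex_def triangle_param_def param_triangle_def numeral_2_eq_2)

text \<open>Face \<open>k\<close> omits vertex \<open>k\<close>: the edges run from vertex 1 to 2,
  from 0 to 2, and from 0 to 1.\<close>

lemma simplical_face_segment:
  assumes "s \<in> {0..1}"
  shows "path_of_simplex (singular_face 2 0 \<sigma>) s = \<sigma> (triangle_param (1 - s, s))"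
    "path_of_simplex (singular_face 2 1 \<sigma>) s = \<sigma> (triangle_param (0, s))"
    "path_of_simplex (singular_face 2 2 \<sigma>) s = \<sigma> (triangle_param (s, 0))"
proof -
  have "simplical_face 0 (segment_param s) = triangle_param (1 - s, s)"
    "simplical_face 1 (segment_param s) = triangle_param (0, s)"
    "simplical_face 2 (segment_param s) = triangle_param (s, 0)"
    by (auto simp: simplical_face_def segment_param_def triangle_param_def fun_eq_iff)
  then show "path_of_simplex (singular_face 2 0 \<sigma>) s = \<sigma> (triangle_param (1 - s, s))"
    "path_of_simplex (singular_face 2 1 \<sigma>) s = \<sigma> (triangle_param (0, s))"
    "path_of_simplex (singular_face 2 2 \<sigma>) s = \<sigma> (triangle_param (s, 0))"
    using segment_param_simplex[OF assms] by (simp_all add: path_of_simplex_param singular_face_def)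
qed

text \<open>The pulled-back cocycle has one primitive on the whole triangle, and the differences of
  its values at the vertices cancel around the boundary.\<close>

lemma cocycle_integral_triangle:
  assumes D: "locally_exact X D" and \<sigma>: "singular_simplex 2 (top_of_set X) \<sigma>"
  shows "cocycle_integral D (path_of_simplex (singular_face 2 0 \<sigma>))
    - cocycle_integral D (path_of_simplex (singular_face 2 1 \<sigma>))
    + cocycle_integral D (path_of_simplex (singular_face 2 2 \<sigma>)) = 0"
proof -
  have "continuous_on param_triangle (\<lambda>q. triangle_param q i)" for i
    unfolding triangle_param_def
    by (cases "i = 0"; cases "i = 1"; cases "i = 2") (auto intro!: continuous_intros)
  note \<sigma>c = singular_simplex_compose_continuous[OF \<sigma> this triangle_param_simplex]
  have cont: "continuous_on param_triangle (\<lambda>q. \<sigma> (triangle_param q))"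
    by (rule \<sigma>c(1))
  have "(\<lambda>q. \<sigma> (triangle_param q)) ` param_triangle \<subseteq> X"
    using \<sigma>c(2) by blast
  from primitive_on_convex[OF D param_triangle_compact_convex cont this]
  obtain g d where g: "d > 0" "\<forall>p\<in>param_triangle. \<forall>q\<in>param_triangle. dist p q < d \<longrightarrow>
    D (\<sigma> (triangle_param p)) (\<sigma> (triangle_param q)) = g q - g p"
    by (elim exE conjE)
  have edge: "cocycle_integral D \<gamma> = g (e 1) - g (e 0)"
    if \<gamma>: "\<And>s. s \<in> {0..1} \<Longrightarrow> \<gamma> s = \<sigma> (triangle_param (e s))" and e: "\<And>s. s \<in> {0..1} \<Longrightarrow> e s \<in> param_triangle"
      and L: "\<And>s s'. dist (e s) (e s') \<le> 2 * dist s s'" for e and \<gamma> :: "real \<Rightarrow> complex \<times> complex"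
  proof (rule cocycle_integral_primitive[of "d / 2"])
    fix s s' :: real assume s: "s \<in> {0..1}" "s' \<in> {0..1}" "dist s s' < d / 2"
    then have "dist (e s) (e s') < d"
      using L[of s s'] by simp
    then show "D (\<gamma> s) (\<gamma> s') = g (e s') - g (e s)"
      unfolding \<gamma>[OF s(1)] \<gamma>[OF s(2)] by (rule g(2)[rule_format, OF e[OF s(1)] e[OF s(2)]])
  qed (use g(1) in simp)
  \<comment> \<open>The factor 2 is needed for the hypotenuse, which is traversed at speed
    \<open>sqrt 2\<close>.\<close>
  have L1: "dist (1 - s, s) (1 - s', s') \<le> 2 * dist s s'" for s s' :: real
    using sqrt_sum_squares_le_sum_abs[of "dist (1 - s) (1 - s')" "dist s s'"]
    by (simp add: dist_prod_def dist_real_def abs_minus_commute[of "s'" s])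
  have "cocycle_integral D (path_of_simplex (singular_face 2 0 \<sigma>)) = g (1 - 1, 1) - g (1 - 0, 0)"
    by (rule edge[of _ "\<lambda>s. (1 - s, s)"]) (use L1 simplical_face_segment in \<open>auto simp: param_triangle_def\<close>)
  moreover have "cocycle_integral D (path_of_simplex (singular_face 2 1 \<sigma>)) = g (0, 1) - g (0, 0)"
    by (rule edge[of _ "\<lambda>s. (0, s)"])
      (use simplical_face_segment in \<open>auto simp: param_triangle_def dist_prod_def\<close>)
  moreover have "cocycle_integral D (path_of_simplex (singular_face 2 2 \<sigma>)) = g (1, 0) - g (0, 0)"
    by (rule edge[of _ "\<lambda>s. (s, 0)"])
      (use simplical_face_segment in \<open>auto simp: param_triangle_def dist_prod_def\<close>)
  ultimately show ?thesis
    by simp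
qed

definition chain_cocycle_integral :: "(complex \<times> complex \<Rightarrow> complex \<times> complex \<Rightarrow> complex) \<Rightarrow>
    (complex \<times> complex) chain \<Rightarrow> complex" where
  "chain_cocycle_integral D c = frag_linear (\<lambda>\<sigma>. cocycle_integral D (path_of_simplex \<sigma>)) c"

lemma chain_cocycle_integral_boundary:
  assumes D: "locally_exact X D" and c: "singular_chain 2 (top_of_set X) c"
  shows "chain_cocycle_integral D (chain_boundary 2 c) = 0"
proof -
  let ?J = "\<lambda>\<sigma>. cocycle_integral D (path_of_simplex \<sigma>)"
  have "frag_linear ?J (\<Sum>k\<le>2. frag_cmul ((- 1) ^ k) (frag_of (singular_face 2 k \<sigma>))) = 0"
    if "\<sigma> \<in> Poly_Mapping.keys c" for \<sigma>
  proof -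
    have "singular_simplex 2 (top_of_set X) \<sigma>"
      using that c by (auto simp: singular_chain_def)
    from cocycle_integral_triangle[OF D this] show ?thesis
      by (simp add: frag_linear_sum numeral_2_eq_2)
  qed
  then show ?thesis
    unfolding chain_cocycle_integral_def chain_boundary_def
    by (simp add: frag_linear_extend) (simp add: frag_linear_def[of _ c])
qed

text \<open>The sum is the value of \<open>E\<close> on the boundary 0-chain. No continuity of
  \<open>E\<close> is assumed, so the lemma also disposes of correction terms defined by arbitrary
  choices at each point.\<close>

lemma cycle_telescope:
  assumes "chain_boundary 1 c = 0"
  shows "frag_linear (\<lambda>\<sigma>. E (path_of_simplex \<sigma> 1) - E (path_of_simplex \<sigma> 0)) c = 0"
proof -
  \<comment> \<open>The only point of the standard 0-simplex; a singular 0-simplex is identified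
    with its value there.\<close>
  define v :: "nat \<Rightarrow> real" where "v = (\<lambda>j. if j = 0 then 1 else 0)"
  have v: "v \<in> standard_simplex 0"
    by (simp add: standard_simplex_0 v_def)
  have "simplical_face 0 v = segment_param 1" "simplical_face 1 v = segment_param 0"
    by (auto simp: simplical_face_def segment_param_def v_def fun_eq_iff)
  then have "frag_linear (\<lambda>\<tau>. E (\<tau> v)) (\<Sum>k\<le>1. frag_cmul ((- 1) ^ k) (frag_of (singular_face 1 k \<sigma>)))
    = E (path_of_simplex \<sigma> 1) - E (path_of_simplex \<sigma> 0)" for \<sigma>
    using v by (simp add: frag_linear_sum singular_face_def path_of_simplex_param)
  then have "frag_linear (\<lambda>\<sigma>. E (path_of_simplex \<sigma> 1) - E (path_of_simplex \<sigma> 0)) c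
    = frag_linear (\<lambda>\<tau>. E (\<tau> v)) (chain_boundary 1 c)"
    by (simp add: chain_boundary_def frag_linear_extend)
  then show ?thesis
    using assms by simp
qed

lemma homology_class_cycle:
  assumes "\<delta> \<in> carrier (H1_level H t)" "c \<in> \<delta>"
  shows "singular_chain 1 (top_of_set (level_curve H t)) c" "chain_boundary 1 c = 0"
    "\<delta> = homologous_rel_set 1 (top_of_set (level_curve H t)) {} c"
proof -
  let ?X = "top_of_set (level_curve H t)"
  obtain c0 where c0: "singular_relcycle 1 ?X {} c0" "\<delta> = homologous_rel_set 1 ?X {} c0"
    using assms(1) carrier_relative_homology_group[of 1 ?X "{}"] by auto
  then have h: "homologous_rel 1 ?X {} c0 c"
    using assms(2) by simp
  then have "singular_relcycle 1 ?X {} c"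
    using c0(1) homologous_rel_singular_relcycle by blast
  then show "singular_chain 1 ?X c" "chain_boundary 1 c = 0"
    by (auto simp: singular_cycle)
  show "\<delta> = homologous_rel_set 1 ?X {} c"
    using h c0(2) homologous_rel_set_eq by metis
qed

lemma chain_cocycle_integral_homologous:
  assumes D: "locally_exact X D" and "homologous_rel 1 (top_of_set X) {} a b"
  shows "chain_cocycle_integral D a = chain_cocycle_integral D b"
proof -
  obtain e where "singular_chain 2 (top_of_set X) e" "chain_boundary 2 e = a - b"
    using assms(2) by (auto simp: homologous_rel_def singular_boundary numeral_2_eq_2)
  then have "chain_cocycle_integral D (a - b) = 0"
    using chain_cocycle_integral_boundary[OF D] by metis
  then show ?thesis
    by (simp add: chain_cocycle_integral_def)
qed

lemma chain_integral_eq_cocycle: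
  assumes reg: "\<And>z. z \<in> level_curve H t \<Longrightarrow> regular_point H z"
    and c: "singular_chain 1 (top_of_set (level_curve H t)) c" "piecewise_C1_chain c"
  shows "chain_integral \<omega> c = chain_cocycle_integral (fibre_diff H \<omega>) c"
  unfolding chain_integral_frag_linear chain_cocycle_integral_def
proof (rule frag_linear_cong)
  fix \<sigma> assume \<sigma>: "\<sigma> \<in> Poly_Mapping.keys c"
  then have "singular_simplex 1 (top_of_set (level_curve H t)) \<sigma>" "valid_path (path_of_simplex \<sigma>)"
    using c by (auto simp: singular_chain_def piecewise_C1_chain_def)
  then show "path_integral \<omega> (path_of_simplex \<sigma>) = cocycle_integral (fibre_diff H \<omega>) (path_of_simplex \<sigma>)"
    unfolding path_integral_form_along
    by (intro integral_unique form_along_has_integral[OF _ _ reg] path_of_simplex_continuous(2))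
qed

section \<open>Piecewise smooth representatives\<close>

text \<open>The derivatives in question are two-sided, so values outside the unit interval matter at
  0 and 1; both points are added to the exceptional set.\<close>

lemma valid_path_eq_on:
  assumes \<gamma>: "valid_path \<gamma>" and eq: "\<And>s. s \<in> {0..1} \<Longrightarrow> f s = \<gamma> s"
  shows "valid_path f"
proof -
  obtain S where S: "finite S" "continuous_on {0..1} \<gamma>" "\<gamma> C1_differentiable_on ({0..1} - S)"
    using \<gamma> by (auto simp: valid_path_def piecewise_C1_differentiable_on_def)
  then obtain D where D: "\<And>x. x \<in> {0..1} - S \<Longrightarrow> (\<gamma> has_vector_derivative D x) (at x)"
    "continuous_on ({0..1} - S) D"
    unfolding C1_differentiable_on_def by blast
  have "(f has_vector_derivative D x) (at x)" if "x \<in> {0..1} - (S \<union> {0, 1})" for x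
    by (rule has_vector_derivative_transform_within_open[OF D(1), where S = "{0<..<1}"])
      (use that eq in auto)
  moreover have "continuous_on ({0..1} - (S \<union> {0, 1})) D"
    using D(2) by (rule continuous_on_subset) auto
  ultimately have "f C1_differentiable_on ({0..1} - (S \<union> {0, 1}))"
    unfolding C1_differentiable_on_def by blast
  moreover have "continuous_on {0..1} f"
    using S(2) eq continuous_on_cong by metis
  moreover have "finite (S \<union> {0, 1})"
    using S(1) by simp
  ultimately show ?thesis
    unfolding valid_path_def piecewise_C1_differentiable_on_def by blast
qed

lemma valid_path_const: "valid_path (\<lambda>_. a)"
  unfolding valid_path_def by (intro C1_differentiable_imp_piecewise) simp

text \<open>Induction over mesh intervals: each short piece lies in a simply connected slice of a
  level curve and is homotopic there to a smooth path with the same ends.\<close>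

lemma homotopic_to_valid_path:
  assumes reg: "\<And>z. z \<in> level_curve H t \<Longrightarrow> regular_point H z"
    and \<gamma>: "path \<gamma>" "path_image \<gamma> \<subseteq> level_curve H t"
  obtains \<gamma>' where "valid_path \<gamma>'" "homotopic_paths (level_curve H t) \<gamma> \<gamma>'"
proof -
  let ?X = "level_curve H t"
  have cont: "continuous_on {0..1} \<gamma>"
    using \<gamma>(1) by (simp add: path_def)
  obtain e where e: "e > 0" "\<And>z. z \<in> \<gamma> ` {0..1} \<Longrightarrow> \<exists>W F. exact_chart H W F \<and> ball z e \<subseteq> W"
    using exact_charts_lebesgue[OF compact_continuous_image[OF cont compact_Icc], of H] \<gamma>(2) reg
    by (metis path_image_def subset_iff)
  have "uniformly_continuous_on {0..1} \<gamma>"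
    using cont by (rule compact_uniformly_continuous) simp
  then obtain d where d: "d > 0"
    "\<And>p q. p \<in> {0..1} \<Longrightarrow> q \<in> {0..1} \<Longrightarrow> dist p q < d \<Longrightarrow> dist (\<gamma> p) (\<gamma> q) < e"
    using e(1) unfolding uniformly_continuous_on_def by (metis dist_commute)
  obtain N where N: "1 / real N < d" "N > 0"
    using eventually_happens'[OF _ eventually_mesh[OF d(1)]] by auto
  have "\<exists>\<gamma>'. valid_path \<gamma>' \<and> homotopic_paths ?X (subpath 0 (real m / real N) \<gamma>) \<gamma>'" if "m \<le> N" for m
    using that
  proof (induction m)
    case 0
    have "subpath 0 0 \<gamma> = (\<lambda>_. \<gamma> 0)"
      by (simp add: subpath_def fun_eq_iff)
    moreover have "\<gamma> 0 \<in> ?X"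
      using \<gamma>(2) by (auto simp: path_image_def)
    ultimately show ?case
      using valid_path_const[of "\<gamma> 0"]
      by (intro exI[of _ "\<lambda>_. \<gamma> 0"]) (auto simp: homotopic_paths_refl path_def path_image_def)
  next
    case (Suc m)
    then obtain \<gamma>' where \<gamma>': "valid_path \<gamma>'" "homotopic_paths ?X (subpath 0 (real m / real N) \<gamma>) \<gamma>'"
      by auto
    define a b where "a = real m / real N" and "b = real (Suc m) / real N"
    have "b - a = 1 / real N"
      by (simp add: a_def b_def diff_divide_distrib[symmetric])
    then have ab: "0 \<le> a" "a \<le> b" "b \<le> 1" "b - a < d"
      using N Suc.prems by (auto simp: a_def b_def divide_right_mono)
    then have ab01: "a \<in> {0..1}" "b \<in> {0..1}"
      by auto
    obtain W F where W: "exact_chart H W F" "ball (\<gamma> a) e \<subseteq> W"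
      using e(2)[of "\<gamma> a"] ab by auto
    note chart = exact_chart_fibre_chart[OF W(1)]
    have in_W: "\<gamma> s \<in> W \<inter> ?X" if "s \<in> {a..b}" for s
      using d(2)[of a s] W(2) ab that \<gamma>(2) by (auto simp: dist_real_def path_image_def)
    have "eval_xy H (\<gamma> a) = t" "eval_xy H (\<gamma> b) = t"
      using in_W[of a] in_W[of b] ab by (auto simp: level_curve_def)
    moreover have "\<gamma> a \<in> W" "\<gamma> b \<in> W"
      using in_W[of a] in_W[of b] ab by auto
    ultimately obtain \<psi> where \<psi>: "valid_path \<psi>" "\<psi> 0 = \<gamma> a" "\<psi> 1 = \<gamma> b"
      "\<forall>s\<in>{0..1}. \<psi> s \<in> W \<and> eval_xy H (\<psi> s) = t"
      using fibre_chart_path[OF chart, of "\<gamma> a" "\<gamma> b"] by auto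
    let ?b = "subpath a b \<gamma>"
    have "path ?b" "path_image ?b \<subseteq> W \<inter> ?X"
      using \<gamma>(1) ab ab01 in_W by (auto simp: path_image_subpath)
    moreover have "path \<psi>" "path_image \<psi> \<subseteq> W \<inter> ?X"
      using \<psi> valid_path_imp_path by (auto simp: path_image_def level_curve_def)
    moreover have "pathstart \<psi> = pathstart ?b" "pathfinish \<psi> = pathfinish ?b"
      using \<psi>(2,3) by (auto simp: pathstart_def pathfinish_def subpath_def)
    ultimately have "homotopic_paths (W \<inter> ?X) ?b \<psi>"
      using fibre_chart_simply_connected[OF chart, of t] unfolding simply_connected_eq_homotopic_paths by blast
    then have h: "homotopic_paths ?X ?b \<psi>"
      by (rule homotopic_paths_subset) auto
    have "homotopic_paths ?X (subpath 0 a \<gamma> +++ ?b) (\<gamma>' +++ \<psi>)"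
      using \<gamma>'(2) h by (intro homotopic_paths_join) (auto simp: a_def)
    moreover have "homotopic_paths ?X (subpath 0 a \<gamma> +++ ?b) (subpath 0 b \<gamma>)"
      using \<gamma> ab01 by (intro homotopic_join_subpaths) auto
    ultimately have "homotopic_paths ?X (subpath 0 b \<gamma>) (\<gamma>' +++ \<psi>)"
      using homotopic_paths_sym homotopic_paths_trans by blast
    moreover have "pathfinish \<gamma>' = pathstart \<psi>"
      using homotopic_paths_imp_pathfinish[OF \<gamma>'(2)] \<psi>(2) by (simp add: a_def pathstart_def)
    then have "valid_path (\<gamma>' +++ \<psi>)"
      using \<gamma>'(1) \<psi>(1) by (intro valid_path_join)
    ultimately show ?case
      unfolding b_def by blast
  qed
  from this[of N] show ?thesis
    using N that by (auto simp: subpath_trivial)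
qed

text \<open>The restriction supplies the extensionality that singular simplices must have.\<close>

definition simplex_of_path :: "(real \<Rightarrow> complex \<times> complex) \<Rightarrow> (nat \<Rightarrow> real) \<Rightarrow> complex \<times> complex" where
  "simplex_of_path \<gamma> = restrict (\<lambda>x. \<gamma> (x 1)) (standard_simplex 1)"

lemma standard_simplex_1D:
  assumes "x \<in> standard_simplex 1"
  shows "x = segment_param (x 1)" "x 1 \<in> {0..1}"
proof -
  have "x 0 + x 1 = 1" "\<And>i. i > 1 \<Longrightarrow> x i = 0"
    using assms by (auto simp: standard_simplex_def)
  then show "x = segment_param (x 1)"
    by (auto simp: segment_param_def fun_eq_iff)
  show "x 1 \<in> {0..1}"
    using assms by (auto simp: standard_simplex_def)
qed

lemma path_of_simplex_of_path: "s \<in> {0..1} \<Longrightarrow> path_of_simplex (simplex_of_path \<gamma>) s = \<gamma> s"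
  using segment_param_simplex[of s] by (simp add: path_of_simplex_param simplex_of_path_def segment_param_def)

lemma simplex_of_path_of_simplex:
  assumes "singular_simplex 1 X \<sigma>"
  shows "simplex_of_path (path_of_simplex \<sigma>) = \<sigma>"
proof
  fix x show "simplex_of_path (path_of_simplex \<sigma>) x = \<sigma> x"
  proof (cases "x \<in> standard_simplex 1")
    case True
    then show ?thesis
      using standard_simplex_1D(1)[OF True] by (simp add: simplex_of_path_def path_of_simplex_param)
  next
    case False
    have "\<sigma> \<in> extensional (standard_simplex 1)"
      using assms unfolding singular_simplex_def by (rule conjunct2)
    from extensional_arb[OF this False] show ?thesis
      using False by (simp add: simplex_of_path_def)
  qed
qed

text \<open>The tautological simplex is a relative cycle of the interval modulo its ends. A homotopy
  with fixed ends is a homotopy of maps of pairs, so homotopy invariance replaces an explicit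
  subdivision of the square.\<close>

lemma homotopic_paths_homologous:
  assumes h: "homotopic_paths X \<gamma> \<gamma>'"
  shows "homologous_rel 1 (top_of_set X) {\<gamma> 0, \<gamma> 1} (frag_of (simplex_of_path \<gamma>)) (frag_of (simplex_of_path \<gamma>'))"
proof -
  define \<iota> :: "(nat \<Rightarrow> real) \<Rightarrow> real" where "\<iota> = restrict (\<lambda>x. x 1) (standard_simplex 1)"
  let ?I = "top_of_set {0..1 :: real}"
  have \<iota>: "singular_simplex 1 ?I \<iota>"
  proof -
    have "continuous_map (powertop_real UNIV) euclideanreal (\<lambda>x. x (1 :: nat))"
      by (rule continuous_map_product_projection) simp
    then have "continuous_map (subtopology (powertop_real UNIV) (standard_simplex 1)) euclideanreal (\<lambda>x. x (1 :: nat))"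
      by (rule continuous_map_from_subtopology)
    then have "continuous_map (subtopology (powertop_real UNIV) (standard_simplex 1)) ?I (\<lambda>x. x (1 :: nat))"
      using standard_simplex_1D(2) by (auto simp: continuous_map_in_subtopology)
    then have "continuous_map (subtopology (powertop_real UNIV) (standard_simplex 1)) ?I \<iota>"
      by (rule continuous_map_eq) (auto simp: \<iota>_def)
    then show ?thesis
      by (simp add: singular_simplex_def \<iota>_def)
  qed
  have face: "singular_simplex 0 (subtopology ?I {0, 1}) (singular_face 1 k \<iota>)" if "k \<le> 1" for k
  proof (rule singular_simplex_subtopology[THEN iffD2], rule conjI)
    show "singular_simplex 0 ?I (singular_face 1 k \<iota>)"
      using singular_simplex_singular_face[OF \<iota> _ that] by simp
    show "singular_face 1 k \<iota> ` standard_simplex 0 \<subseteq> {0, 1}"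
    proof -
      have "simplical_face k (\<lambda>j. if j = 0 then 1 else 0 :: real) \<in> standard_simplex 1"
        using that by (intro simplical_face_in_standard_simplex) (auto simp: standard_simplex_0)
      then show ?thesis
        by (auto simp: singular_face_def standard_simplex_0 \<iota>_def simplical_face_def)
    qed
  qed
  have "singular_chain 0 (subtopology ?I {0, 1}) (frag_of (singular_face 1 0 \<iota>) - frag_of (singular_face 1 1 \<iota>))"
    using face by (intro singular_chain_diff) (simp_all add: singular_chain_of)
  moreover have "chain_boundary 1 (frag_of \<iota>) = frag_of (singular_face 1 0 \<iota>) - frag_of (singular_face 1 1 \<iota>)"
    by (simp add: chain_boundary_of)
  ultimately have cyc: "singular_relcycle 1 ?I {0, 1} (frag_of \<iota>)"
    using \<iota> by (simp add: singular_relcycle singular_chain_of)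
  have "homotopic_with (\<lambda>h. h \<in> {0, 1} \<rightarrow> {\<gamma> 0, \<gamma> 1}) ?I (top_of_set X) \<gamma> \<gamma>'"
    using h unfolding homotopic_paths_def
    by (rule homotopic_with_mono) (auto simp: pathstart_def pathfinish_def)
  from homotopic_imp_homologous_rel_chain_maps[OF this cyc]
  show ?thesis
    by (simp add: simplex_map_def simplex_of_path_def \<iota>_def o_def cong: restrict_cong)
qed

text \<open>A connected finite image is a single point. This makes the remainder terms supported at
  end points harmless.\<close>

lemma singular_simplex_finite_valid_path:
  assumes \<tau>: "singular_simplex 1 (top_of_set V) \<tau>" and V: "finite V"
  shows "valid_path (path_of_simplex \<tau>)"
proof -
  have "connected (path_of_simplex \<tau> ` {0..1})"
    by (intro connected_continuous_image path_of_simplex_continuous[OF \<tau>]) simp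
  moreover have "finite (path_of_simplex \<tau> ` {0..1})"
    using path_of_simplex_continuous(2)[OF \<tau>] V by (meson finite_subset image_subsetI)
  ultimately obtain a where "path_of_simplex \<tau> ` {0..1} = {a}"
    using connected_finite_iff_sing by (metis atLeastatMost_empty_iff2 image_is_empty not_one_le_zero zero_le_one)
  then have "path_of_simplex \<tau> s = a" if "s \<in> {0..1}" for s
    using that by blast
  then show ?thesis
    by (rule valid_path_eq_on[OF valid_path_const])
qed

text \<open>Each simplex is replaced by a smooth path homotopic to it. The relative homology leaves
  a remainder chain in the two end points, which consists of constant simplices and may stay in the
  representative.\<close>

lemma piecewise_C1_representative:
  assumes reg: "\<And>z. z \<in> level_curve H t \<Longrightarrow> regular_point H z"
    and \<delta>: "\<delta> \<in> carrier (H1_level H t)"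
  obtains c where "c \<in> \<delta>" "piecewise_C1_chain c"
proof -
  let ?X = "level_curve H t"
  obtain c where "\<delta> = homologous_rel_set 1 (top_of_set ?X) {} c"
    using \<delta> carrier_relative_homology_group[of 1 "top_of_set ?X" "{}"] by auto
  then have "c \<in> \<delta>"
    by simp
  note c = this homology_class_cycle[OF \<delta> this]
  define good where "good \<sigma> q \<longleftrightarrow> valid_path (fst q) \<and> singular_chain 2 (top_of_set ?X) (fst (snd q)) \<and>
      (\<exists>V. finite V \<and> singular_chain 1 (top_of_set V) (snd (snd q))) \<and>
      chain_boundary 2 (fst (snd q)) = frag_of \<sigma> - frag_of (simplex_of_path (fst q)) + snd (snd q)" for \<sigma> q
  have "\<exists>q. good \<sigma> q" if "\<sigma> \<in> Poly_Mapping.keys c" for \<sigma>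
  proof -
    have \<sigma>: "singular_simplex 1 (top_of_set ?X) \<sigma>"
      using c(2) that by (auto simp: singular_chain_def)
    let ?\<gamma> = "path_of_simplex \<sigma>"
    have p: "path ?\<gamma>" "path_image ?\<gamma> \<subseteq> ?X"
      using path_of_simplex_continuous[OF \<sigma>] by (auto simp: path_def path_image_def)
    obtain \<gamma> where \<gamma>: "valid_path \<gamma>" "homotopic_paths ?X ?\<gamma> \<gamma>"
      by (rule homotopic_to_valid_path[OF reg p])
    have "homologous_rel 1 (top_of_set ?X) {?\<gamma> 0, ?\<gamma> 1} (frag_of \<sigma>) (frag_of (simplex_of_path \<gamma>))"
      using homotopic_paths_homologous[OF \<gamma>(2)] by (simp add: simplex_of_path_of_simplex[OF \<sigma>])
    then obtain d e where de: "singular_chain (Suc 1) (top_of_set ?X) d"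
      "singular_chain 1 (subtopology (top_of_set ?X) {?\<gamma> 0, ?\<gamma> 1}) e"
      "chain_boundary (Suc 1) d = frag_of \<sigma> - frag_of (simplex_of_path \<gamma>) + e"
      unfolding homologous_rel_def singular_relboundary_alt by (elim exE conjE)
    have "singular_chain 1 (top_of_set (?X \<inter> {?\<gamma> 0, ?\<gamma> 1})) e"
      using de(2) by (simp only: subtopology_subtopology)
    moreover have "finite (?X \<inter> {?\<gamma> 0, ?\<gamma> 1})"
      by simp
    ultimately have "good \<sigma> (\<gamma>, d, e)"
      unfolding good_def fst_conv snd_conv using \<gamma>(1) de(1,3) Suc_1 by metis
    then show ?thesis ..
  qed
  then have "\<forall>\<sigma>\<in>Poly_Mapping.keys c. \<exists>q. good \<sigma> q"
    by (rule ballI)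
  from bchoice[OF this] obtain q where q: "\<And>\<sigma>. \<sigma> \<in> Poly_Mapping.keys c \<Longrightarrow> good \<sigma> (q \<sigma>)"
    by auto
  define \<gamma> d e where "\<gamma> \<sigma> = fst (q \<sigma>)" and "d \<sigma> = fst (snd (q \<sigma>))" and "e \<sigma> = snd (snd (q \<sigma>))" for \<sigma>
  note * = q[unfolded good_def, folded \<gamma>_def d_def e_def, THEN conjunct1]
    q[unfolded good_def, folded \<gamma>_def d_def e_def, THEN conjunct2, THEN conjunct1]
    q[unfolded good_def, folded \<gamma>_def d_def e_def, THEN conjunct2, THEN conjunct2, THEN conjunct1]
    q[unfolded good_def, folded \<gamma>_def d_def e_def, THEN conjunct2, THEN conjunct2, THEN conjunct2]
  \<comment> \<open>Subtracting the remainders makes \<open>c - c'\<close> an absolute boundary, so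
    \<open>c'\<close> lies in the same absolute class.\<close>
  define c' where "c' = frag_extend (\<lambda>\<sigma>. frag_of (simplex_of_path (\<gamma> \<sigma>)) - e \<sigma>) c"
  have "chain_boundary 2 (frag_extend d c) = frag_extend (\<lambda>\<sigma>. chain_boundary 2 (d \<sigma>)) c"
    by (simp add: frag_extend_def chain_boundary_sum chain_boundary_cmul)
  also have "\<dots> = frag_extend (\<lambda>\<sigma>. frag_of \<sigma> - (frag_of (simplex_of_path (\<gamma> \<sigma>)) - e \<sigma>)) c"
    by (rule frag_extend_eq) (simp add: *(4))
  also have "\<dots> = c - c'"
  proof -
    have "frag_cmul k (a - b) = frag_cmul k a - frag_cmul k b" for k and a b :: "(complex \<times> complex) chain"
      by (rule poly_mapping_eqI) (simp add: lookup_minus right_diff_distrib)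
    then have "frag_extend (\<lambda>\<sigma>. frag_of \<sigma> - f \<sigma>) c = frag_extend frag_of c - frag_extend f c" for f
      by (simp add: frag_extend_def sum_subtractf)
    moreover have "frag_extend frag_of c = c"
      using frag_expansion[of c] by simp
    ultimately show ?thesis
      by (simp add: c'_def)
  qed
  finally have bd: "chain_boundary 2 (frag_extend d c) = c - c'" .
  have "singular_chain 2 (top_of_set ?X) (frag_extend d c)"
    by (rule singular_chain_extend) (rule *(2))
  then have "homologous_rel 1 (top_of_set ?X) {} c c'"
    using bd unfolding homologous_rel_def singular_boundary Suc_1[symmetric] by blast
  then have "c' \<in> \<delta>"
    using c(4) by simp
  moreover have "piecewise_C1_chain c'"
    unfolding piecewise_C1_chain_def
  proof
    fix \<tau> assume "\<tau> \<in> Poly_Mapping.keys c'"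
    from subsetD[OF keys_frag_extend this[unfolded c'_def]] obtain \<sigma> where \<sigma>: "\<sigma> \<in> Poly_Mapping.keys c"
      "\<tau> \<in> Poly_Mapping.keys (frag_of (simplex_of_path (\<gamma> \<sigma>)) - e \<sigma>)"
      by (elim UN_E)
    then consider "\<tau> = simplex_of_path (\<gamma> \<sigma>)" | "\<tau> \<in> Poly_Mapping.keys (e \<sigma>)"
      using keys_diff[of "frag_of (simplex_of_path (\<gamma> \<sigma>))" "e \<sigma>"] by auto
    then show "valid_path (path_of_simplex \<tau>)"
    proof cases
      case 1
      then show ?thesis
        using *(1)[OF \<sigma>(1)] path_of_simplex_of_path by (auto intro: valid_path_eq_on)
    next
      case 2
      obtain V where "finite V" "singular_chain 1 (top_of_set V) (e \<sigma>)"
        using *(3)[OF \<sigma>(1)] by blast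
      then show ?thesis
        using 2 singular_simplex_finite_valid_path by (auto simp: singular_chain_def)
    qed
  qed
  ultimately show ?thesis
    using that by blast
qed

section \<open>Dependence on the parameter\<close>

text \<open>The limit is replaced by one given mesh, so that a mesh chosen at \<open>t0\<close> can
  serve all nearby \<open>t\<close>. On each piece the local potential and the global primitive
  differ by a locally constant function, hence by a constant.\<close>

lemma cocycle_integral_mesh:
  fixes \<beta> :: "real \<Rightarrow> 'a::metric_space"
  assumes D: "locally_exact X D" and \<beta>: "continuous_on {0..1} \<beta>" "\<beta> ` {0..1} \<subseteq> X" and N: "N > 0"
    and piece: "\<And>k. k < N \<Longrightarrow> \<exists>F. \<forall>s\<in>{real k / real N..real (Suc k) / real N}.
      \<forall>s'\<in>{real k / real N..real (Suc k) / real N}. D (\<beta> s) (\<beta> s') = F (\<beta> s') - F (\<beta> s)"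
  shows "cocycle_integral D \<beta> = cocycle_sum D \<beta> N"
proof -
  have "compact {0..1 :: real}" "convex {0..1 :: real}" "{0..1 :: real} \<noteq> {}"
    by auto
  from primitive_on_convex[OF D this \<beta>]
  obtain g d where g: "d > 0" "\<forall>p\<in>{0..1}. \<forall>q\<in>{0..1}. dist p q < d \<longrightarrow> D (\<beta> p) (\<beta> q) = g q - g p"
    by (elim exE conjE)
  have "D (\<beta> (real k / real N)) (\<beta> (real (Suc k) / real N)) = g (real (Suc k) / real N) - g (real k / real N)"
    if k: "k < N" for k
  proof -
    define a b where "a = real k / real N" and "b = real (Suc k) / real N"
    have ab: "0 \<le> a" "a \<le> b" "b \<le> 1"
      using k by (auto simp: a_def b_def divide_right_mono)
    obtain F where F: "\<forall>s\<in>{a..b}. \<forall>s'\<in>{a..b}. D (\<beta> s) (\<beta> s') = F (\<beta> s') - F (\<beta> s)"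
      using piece[OF k] unfolding a_def b_def by blast
    have "F (\<beta> a) - g a = F (\<beta> b) - g b"
    proof (rule connected_local_const[where f = "\<lambda>s. F (\<beta> s) - g s" and A = "{a..b}"])
      show "\<forall>s\<in>{a..b}. \<forall>\<^sub>F s' in at s within {a..b}. F (\<beta> s) - g s = F (\<beta> s') - g s'"
      proof
        fix s assume s: "s \<in> {a..b}"
        have "F (\<beta> s) - g s = F (\<beta> s') - g s'" if "s' \<in> {a..b}" "dist s' s < d" for s'
        proof -
          have "D (\<beta> s) (\<beta> s') = g s' - g s"
            using g(2) s that ab by (auto simp: dist_commute)
          moreover have "D (\<beta> s) (\<beta> s') = F (\<beta> s') - F (\<beta> s)"
            using F s that(1) by blast
          ultimately show ?thesis
            by (simp add: algebra_simps)
        qed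
        then show "\<forall>\<^sub>F s' in at s within {a..b}. F (\<beta> s) - g s = F (\<beta> s') - g s'"
          unfolding eventually_at using g(1) by blast
      qed
    qed (use ab in auto)
    then have "F (\<beta> b) - F (\<beta> a) = g b - g a"
      by (simp add: algebra_simps)
    moreover have "D (\<beta> a) (\<beta> b) = F (\<beta> b) - F (\<beta> a)"
      using F ab by auto
    ultimately show ?thesis
      unfolding a_def[symmetric] b_def[symmetric] by simp
  qed
  then have "cocycle_sum D \<beta> N = (\<Sum>k<N. g (real (Suc k) / real N) - g (real k / real N))"
    unfolding cocycle_sum_def by (intro sum.cong) auto
  also have "\<dots> = g 1 - g 0"
    using sum_lessThan_telescope[of "\<lambda>k. g (real k / real N)" N] N by simp
  also have "\<dots> = cocycle_integral D \<beta>"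
    using g by (intro cocycle_integral_primitive[symmetric, of d]) auto
  finally show ?thesis ..
qed

lemma cocycle_integral_cong:
  assumes "\<And>s. s \<in> {0..1} \<Longrightarrow> \<beta> s = \<gamma> s"
  shows "cocycle_integral D \<beta> = cocycle_integral D \<gamma>"
proof -
  have "cocycle_sum D \<beta> = cocycle_sum D \<gamma>"
    unfolding cocycle_sum_def using assms by (intro ext sum.cong arg_cong2[where f = D]) auto
  then show ?thesis
    by (simp add: cocycle_integral_def)
qed

text \<open>The definite description is justified: homologous piecewise smooth cycles have equal
  cocycle integrals, and these are their line integrals.\<close>

lemma class_integral_representative:
  assumes reg: "\<And>z. z \<in> level_curve H t \<Longrightarrow> regular_point H z"
    and \<delta>: "\<delta> \<in> carrier (H1_level H t)" and c: "c \<in> \<delta>" "piecewise_C1_chain c"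
  shows "class_integral \<omega> \<delta> = chain_integral \<omega> c"
  unfolding class_integral_def
proof (rule the_equality)
  show "\<exists>c'\<in>\<delta>. piecewise_C1_chain c' \<and> chain_integral \<omega> c = chain_integral \<omega> c'"
    using c by blast
  fix v assume "\<exists>c'\<in>\<delta>. piecewise_C1_chain c' \<and> v = chain_integral \<omega> c'"
  then obtain c' where c': "c' \<in> \<delta>" "piecewise_C1_chain c'" "v = chain_integral \<omega> c'"
    by blast
  have "homologous_rel 1 (top_of_set (level_curve H t)) {} c' c"
    using homology_class_cycle(3)[OF \<delta> c'(1)] c(1) by simp
  then show "v = chain_integral \<omega> c"
    using chain_cocycle_integral_homologous[OF locally_exact_fibre_diff[OF reg]]
      chain_integral_eq_cocycle[OF reg] homology_class_cycle(1)[OF \<delta>] c c' by metis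
qed

text \<open>Here \<open>c\<close> may be any cycle of the class, even one made of merely continuous
  simplices, as transport produces.\<close>

lemma class_integral_cocycle:
  assumes reg: "\<And>z. z \<in> level_curve H t \<Longrightarrow> regular_point H z"
    and \<delta>: "\<delta> \<in> carrier (H1_level H t)" and c: "c \<in> \<delta>"
  shows "class_integral \<omega> \<delta> = chain_cocycle_integral (fibre_diff H \<omega>) c"
proof -
  obtain c' where c': "c' \<in> \<delta>" "piecewise_C1_chain c'"
    by (rule piecewise_C1_representative[OF reg \<delta>])
  have "homologous_rel 1 (top_of_set (level_curve H t)) {} c' c"
    using homology_class_cycle(3)[OF \<delta> c'(1)] c by simp
  then show ?thesis
    using class_integral_representative[OF reg \<delta> c'] chain_integral_eq_cocycle[OF reg _ c'(2)]
      homology_class_cycle(1)[OF \<delta> c'(1)] chain_cocycle_integral_homologous[OF locally_exact_fibre_diff[OF reg]]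
    by metis
qed

lemma regular_value_regular_point:
  "regular_value H t \<Longrightarrow> z \<in> level_curve H t \<Longrightarrow> regular_point H z"
  by (auto simp: regular_value_def regular_point_def)

lemma uniform_mesh:
  fixes \<gamma> :: "'i \<Rightarrow> real \<Rightarrow> 'a::metric_space"
  assumes "finite I" "\<And>i. i \<in> I \<Longrightarrow> continuous_on {0..1} (\<gamma> i)" "e > 0"
  obtains N where "N > 0"
    "\<And>i s s'. i \<in> I \<Longrightarrow> s \<in> {0..1} \<Longrightarrow> s' \<in> {0..1} \<Longrightarrow> dist s s' \<le> 1 / real N \<Longrightarrow> dist (\<gamma> i s) (\<gamma> i s') < e"
proof -
  have "\<forall>\<^sub>F N in sequentially. \<forall>i\<in>I. N > 0 \<and> (\<forall>s\<in>{0..1}. \<forall>s'\<in>{0..1}.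
    dist s s' \<le> 1 / real N \<longrightarrow> dist (\<gamma> i s) (\<gamma> i s') < e)"
  proof (rule eventually_ball_finite[OF assms(1)], rule ballI)
    fix i assume "i \<in> I"
    then have "uniformly_continuous_on {0..1} (\<gamma> i)"
      using assms(2) by (intro compact_uniformly_continuous) auto
    then obtain d where d: "d > 0"
      "\<And>s s'. s \<in> {0..1} \<Longrightarrow> s' \<in> {0..1} \<Longrightarrow> dist s s' < d \<Longrightarrow> dist (\<gamma> i s) (\<gamma> i s') < e"
      using assms(3) unfolding uniformly_continuous_on_def by (metis dist_commute)
    show "\<forall>\<^sub>F N in sequentially. N > 0 \<and> (\<forall>s\<in>{0..1}. \<forall>s'\<in>{0..1}.
      dist s s' \<le> 1 / real N \<longrightarrow> dist (\<gamma> i s) (\<gamma> i s') < e)"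
      using eventually_mesh[OF d(1)] by (rule eventually_mono) (use d(2) in auto)
  qed
  moreover have "\<forall>\<^sub>F N in sequentially. N > (0 :: nat)"
    by (rule eventually_gt_at_top)
  ultimately have "\<forall>\<^sub>F N in sequentially. N > 0 \<and> (\<forall>i\<in>I. N > 0 \<and> (\<forall>s\<in>{0..1}. \<forall>s'\<in>{0..1}.
    dist s s' \<le> 1 / real N \<longrightarrow> dist (\<gamma> i s) (\<gamma> i s') < e))"
    by (rule eventually_conj[rotated])
  from eventually_happens'[OF _ this] obtain N where "N > 0" "\<forall>i\<in>I. N > 0 \<and> (\<forall>s\<in>{0..1}. \<forall>s'\<in>{0..1}.
    dist s s' \<le> 1 / real N \<longrightarrow> dist (\<gamma> i s) (\<gamma> i s') < e)"
    by auto
  then show ?thesis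
    by (intro that[of N]) auto
qed

text \<open>Uniform continuity on the product of a closed disc with the compact set, since the
  trivialization is the identity at \<open>t0\<close>.\<close>

lemma trivialization_near_identity:
  fixes \<Phi> :: "complex \<times> (complex \<times> complex) \<Rightarrow> complex \<times> complex"
  assumes \<Phi>: "continuous_on (V \<times> X) \<Phi>" "\<And>z. z \<in> X \<Longrightarrow> \<Phi> (t0, z) = z"
    and V: "open V" "t0 \<in> V" and K: "compact K" "K \<subseteq> X" and e: "e > 0"
  shows "\<forall>\<^sub>F t in nhds t0. t \<in> V \<and> (\<forall>z\<in>K. dist z (\<Phi> (t, z)) < e)"
proof -
  obtain r where r: "r > 0" "cball t0 r \<subseteq> V"
    using V open_contains_cball by blast
  have "uniformly_continuous_on (cball t0 r \<times> K) \<Phi>"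
    using K r by (intro compact_uniformly_continuous continuous_on_subset[OF \<Phi>(1)] compact_Times) auto
  then obtain d where d: "d > 0"
    "\<And>p q. p \<in> cball t0 r \<times> K \<Longrightarrow> q \<in> cball t0 r \<times> K \<Longrightarrow> dist p q < d \<Longrightarrow> dist (\<Phi> p) (\<Phi> q) < e"
    using e unfolding uniformly_continuous_on_def by (metis dist_commute)
  have "\<forall>\<^sub>F t in nhds t0. dist t t0 < min r d"
    using r(1) d(1) by (intro eventually_nhds_metric[THEN iffD2] exI[of _ "min r d"]) auto
  then show ?thesis
  proof (rule eventually_mono)
    fix t assume t: "dist t t0 < min r d"
    have "dist z (\<Phi> (t, z)) < e" if z: "z \<in> K" for z
    proof -
      have "dist (t0, z) (t, z) < d"
        using t by (simp add: dist_Pair_Pair dist_commute)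
      then have "dist (\<Phi> (t0, z)) (\<Phi> (t, z)) < e"
        using t z r by (intro d(2)) (auto simp: dist_commute)
      then show ?thesis
        using \<Phi>(2)[of z] z K by auto
    qed
    moreover have "t \<in> V"
      using t r by (auto simp: dist_commute)
    ultimately show "t \<in> V \<and> (\<forall>z\<in>K. dist z (\<Phi> (t, z)) < e)"
      by blast
  qed
qed

lemma section_at_near:
  assumes "section_at H s t0 a b" "e > 0"
  shows "\<forall>\<^sub>F t in nhds t0. eval_xy H (s t) = t \<and> dist (s t0) (s t) < e"
proof -
  have "isCont (\<lambda>t. (fst (s t), snd (s t))) t0"
    using assms(1) by (intro isCont_Pair) (auto simp: section_at_def dest: DERIV_isCont)
  then have "isCont s t0"
    by simp
  then have "(s \<longlongrightarrow> s t0) (nhds t0)"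
    by (simp add: continuous_at tendsto_at_iff_tendsto_nhds)
  then have "\<forall>\<^sub>F t in nhds t0. dist (s t) (s t0) < e"
    using assms(2) by (simp add: tendsto_iff)
  moreover have "\<forall>\<^sub>F t in nhds t0. eval_xy H (s t) = t"
    using assms(1) by (simp add: section_at_def)
  ultimately show ?thesis
    by eventually_elim (simp add: dist_commute)
qed

definition mesh_point :: "((nat \<Rightarrow> real) \<Rightarrow> complex \<times> complex) \<Rightarrow> nat \<Rightarrow> nat \<Rightarrow> complex \<times> complex" where
  "mesh_point \<sigma> N k = path_of_simplex \<sigma> (real k / real N)"

text \<open>Near \<open>t0\<close> the transported mesh points are replaced by holomorphic sections through the
  original ones; the corrections cancel because the chain is a cycle.\<close>

lemma class_integral_local:
  assumes fam: "continuous_cycle_family H U \<delta>" and t0: "t0 \<in> U"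
  shows "\<exists>N c S A B. chain_boundary 1 c = 0 \<and>
    (\<forall>p\<in>level_curve H t0. section_at H (S p) t0 (A p) (B p) \<and> S p t0 = p) \<and>
    (\<forall>\<omega>. \<forall>\<^sub>F t in nhds t0. class_integral \<omega> (\<delta> t) =
      frag_linear (\<lambda>\<sigma>. \<Sum>k<N. fibre_diff H \<omega> (S (mesh_point \<sigma> N k) t) (S (mesh_point \<sigma> N (Suc k)) t)) c) \<and>
    (\<forall>\<sigma>\<in>Poly_Mapping.keys c. \<forall>k<N. \<exists>W F. exact_chart H W F \<and>
      mesh_point \<sigma> N k \<in> W \<and> mesh_point \<sigma> N (Suc k) \<in> W \<and>
      mesh_point \<sigma> N k \<in> level_curve H t0 \<and> mesh_point \<sigma> N (Suc k) \<in> level_curve H t0) \<and>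
    (\<forall>\<sigma>. mesh_point \<sigma> N 0 = path_of_simplex \<sigma> 0 \<and> mesh_point \<sigma> N N = path_of_simplex \<sigma> 1)"
proof -
  let ?X = "level_curve H t0"
  have "regular_value H t" if "t \<in> U" for t
    using fam that unfolding continuous_cycle_family_def by blast
  then have reg: "regular_point H z" if "t \<in> U" "z \<in> level_curve H t" for t z
    using that by (intro regular_value_regular_point[of H t])
  have \<delta>U: "\<delta> t \<in> carrier (H1_level H t)" if "t \<in> U" for t
    using fam that by (auto simp: continuous_cycle_family_def)
  obtain V \<Phi> where V: "V \<subseteq> U" "local_trivialization H V t0 \<Phi>" and
    \<delta>V: "\<And>t. t \<in> V \<Longrightarrow> \<delta> t = hom_induced 1 (top_of_set ?X) {} (top_of_set (level_curve H t)) {} (\<lambda>z. \<Phi> (t, z)) (\<delta> t0)"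
    using fam t0 unfolding continuous_cycle_family_def by blast
  have Vo: "open V" "t0 \<in> V" and \<Phi>lev: "\<And>t z. t \<in> V \<Longrightarrow> z \<in> ?X \<Longrightarrow> \<Phi> (t, z) \<in> level_curve H t"
    and \<Phi>0: "\<And>z. z \<in> ?X \<Longrightarrow> \<Phi> (t0, z) = z" and \<Phi>c: "continuous_on (V \<times> ?X) \<Phi>"
    using V(2) by (auto simp: local_trivialization_def level_curve_def homeomorphism_def)
  obtain c where c: "c \<in> \<delta> t0" "piecewise_C1_chain c"
    by (rule piecewise_C1_representative[OF reg[OF t0] \<delta>U[OF t0]])
  note cyc = homology_class_cycle[OF \<delta>U[OF t0] c(1)]
  have \<sigma>X: "singular_simplex 1 (top_of_set ?X) \<sigma>" if "\<sigma> \<in> Poly_Mapping.keys c" for \<sigma>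
    using cyc(1) that by (auto simp: singular_chain_def)
  note path = path_of_simplex_continuous[OF \<sigma>X]
  define K where "K = (\<Union>\<sigma>\<in>Poly_Mapping.keys c. path_of_simplex \<sigma> ` {0..1})"
  have K: "compact K" "K \<subseteq> ?X"
    unfolding K_def using path by (auto intro!: compact_UN compact_continuous_image)
  obtain e where e: "e > 0" "\<And>z. z \<in> K \<Longrightarrow> \<exists>W F. exact_chart H W F \<and> ball z e \<subseteq> W"
  proof (rule exact_charts_lebesgue[OF K(1)])
    show "regular_point H z" if "z \<in> K" for z
      using that K(2) reg[OF t0] by blast
  qed blast
  \<comment> \<open>One half of the Lebesgue number is spent on the mesh, the other on the
    displacement by transport or by a section; everything attached to one mesh interval then lies in
    one exact chart.\<close>
  have e2: "e / 2 > 0"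
    using e(1) by simp
  obtain N where N: "N > 0" "\<And>\<sigma> s s'. \<sigma> \<in> Poly_Mapping.keys c \<Longrightarrow> s \<in> {0..1} \<Longrightarrow> s' \<in> {0..1} \<Longrightarrow>
    dist s s' \<le> 1 / real N \<Longrightarrow> dist (path_of_simplex \<sigma> s) (path_of_simplex \<sigma> s') < e / 2"
    using uniform_mesh[of "Poly_Mapping.keys c" path_of_simplex "e / 2"] path(1) e2 by (metis finite_keys)
  have frac: "real k / real N \<in> {0..1}" "real (Suc k) / real N \<in> {0..1}"
    "real k / real N \<le> real (Suc k) / real N" "real (Suc k) / real N - real k / real N = 1 / real N" if "k < N" for k
    using that by (auto simp: divide_right_mono diff_divide_distrib[symmetric])
  have mK: "mesh_point \<sigma> N k \<in> K" if "\<sigma> \<in> Poly_Mapping.keys c" "k \<le> N" for \<sigma> k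
    using that N(1) unfolding K_def mesh_point_def by (intro UN_I[OF that(1)] imageI) simp
  have piece: "dist (mesh_point \<sigma> N k) (path_of_simplex \<sigma> s) < e / 2"
    if "\<sigma> \<in> Poly_Mapping.keys c" "k < N" "s \<in> {real k / real N..real (Suc k) / real N}" for \<sigma> k s
  proof -
    have "dist (real k / real N) s \<le> 1 / real N"
      using that(3) frac(4)[OF that(2)] by (simp only: dist_real_def) (simp add: abs_le_iff)
    moreover have "0 \<le> real k / real N" "real (Suc k) / real N \<le> 1"
      using frac(1,2)[OF that(2)] by simp_all
    then have "s \<in> {0..1}"
      using that(3) unfolding atLeastAtMost_iff by linarith
    ultimately show ?thesis
      unfolding mesh_point_def by (intro N(2)[OF that(1) frac(1)[OF that(2)]])
  qed
  have "\<forall>p\<in>?X. \<exists>q. section_at H (fst q) t0 (fst (snd q)) (snd (snd q)) \<and> fst q t0 = p"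
  proof
    fix p assume p: "p \<in> ?X"
    then have "eval_xy H p = t0"
      by (simp add: level_curve_def)
    then obtain s a b where "section_at H s t0 a b" "s t0 = p"
      using section_at_exists[OF reg[OF t0 p]] by metis
    then show "\<exists>q. section_at H (fst q) t0 (fst (snd q)) (snd (snd q)) \<and> fst q t0 = p"
      by (intro exI[of _ "(s, a, b)"]) simp
  qed
  from bchoice[OF this] obtain q where q: "\<And>p. p \<in> ?X \<Longrightarrow>
    section_at H (fst (q p)) t0 (fst (snd (q p))) (snd (snd (q p))) \<and> fst (q p) t0 = p"
    by auto
  \<comment> \<open>The section is attached to the point, not to a simplex and a mesh index:
    simplices with a common end point use the same section there, as the later cancellation
    demands.\<close>
  define S A B where "S p = fst (q p)" and "A p = fst (snd (q p))" and "B p = snd (snd (q p))" for p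
  have S: "section_at H (S p) t0 (A p) (B p)" "S p t0 = p" if "p \<in> ?X" for p
    using q[OF that] by (auto simp: S_def A_def B_def)
  define P where "P = (\<lambda>(\<sigma>, k). mesh_point \<sigma> N k) ` (Poly_Mapping.keys c \<times> {..N})"
  have P: "finite P" "P \<subseteq> K"
    using mK by (auto simp: P_def)
  have "\<forall>\<^sub>F t in nhds t0. \<forall>p\<in>P. eval_xy H (S p t) = t \<and> dist (S p t0) (S p t) < e / 2"
  proof (rule eventually_ball_finite[OF P(1)], rule ballI)
    fix p assume "p \<in> P"
    then have "p \<in> ?X"
      using P(2) K(2) by blast
    from section_at_near[OF S(1)[OF this] e2]
    show "\<forall>\<^sub>F t in nhds t0. eval_xy H (S p t) = t \<and> dist (S p t0) (S p t) < e / 2" .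
  qed
  moreover have "\<forall>\<^sub>F t in nhds t0. t \<in> V \<and> (\<forall>z\<in>K. dist z (\<Phi> (t, z)) < e / 2)"
    by (rule trivialization_near_identity[OF \<Phi>c \<Phi>0 Vo K e2])
  ultimately have near: "\<forall>\<^sub>F t in nhds t0. (\<forall>p\<in>P. eval_xy H (S p t) = t \<and> dist (S p t0) (S p t) < e / 2) \<and>
    (t \<in> V \<and> (\<forall>z\<in>K. dist z (\<Phi> (t, z)) < e / 2))"
    by (rule eventually_conj)
  have main: "class_integral \<omega> (\<delta> t) =
      frag_linear (\<lambda>\<sigma>. \<Sum>k<N. fibre_diff H \<omega> (S (mesh_point \<sigma> N k) t) (S (mesh_point \<sigma> N (Suc k)) t)) c"
    if near: "(\<forall>p\<in>P. eval_xy H (S p t) = t \<and> dist (S p t0) (S p t) < e / 2) \<and>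
      (t \<in> V \<and> (\<forall>z\<in>K. dist z (\<Phi> (t, z)) < e / 2))" for t \<omega>
  proof -
    let ?Xt = "level_curve H t" and ?\<phi> = "\<lambda>z. \<Phi> (t, z)" and ?D = "fibre_diff H \<omega>"
    have tV: "t \<in> V" and tU: "t \<in> U"
      using near V(1) by auto
    have \<phi>: "continuous_on ?X ?\<phi>" "\<And>z. z \<in> ?X \<Longrightarrow> ?\<phi> z \<in> ?Xt"
      using tV \<Phi>lev by (auto intro!: continuous_on_compose2[OF \<Phi>c] continuous_intros)
    have exact: "locally_exact ?Xt ?D"
      by (rule locally_exact_fibre_diff[OF reg[OF tU]])
    have "singular_relcycle 1 (top_of_set ?X) {} c"
      using cyc by (simp add: singular_cycle)
    then have "hom_induced (int 1) (top_of_set ?X) {} (top_of_set ?Xt) {} ?\<phi> (homologous_rel_set 1 (top_of_set ?X) {} c)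
      = homologous_rel_set 1 (top_of_set ?Xt) {} (chain_map 1 ?\<phi> c)"
      using \<phi> by (intro hom_induced_chain_map) auto
    then have cm: "chain_map 1 ?\<phi> c \<in> \<delta> t"
      using \<delta>V[OF tV] cyc(3) by simp
    have "class_integral \<omega> (\<delta> t) = chain_cocycle_integral ?D (chain_map 1 ?\<phi> c)"
      by (rule class_integral_cocycle[OF _ \<delta>U[OF tU] cm]) (rule reg[OF tU])
    also have "\<dots> = frag_linear (\<lambda>\<sigma>. cocycle_integral ?D (path_of_simplex (simplex_map 1 ?\<phi> \<sigma>))) c"
      by (simp add: chain_cocycle_integral_def chain_map_def frag_linear_extend)
    also have "\<dots> = frag_linear (\<lambda>\<sigma>. (\<Sum>k<N. ?D (S (mesh_point \<sigma> N k) t) (S (mesh_point \<sigma> N (Suc k)) t)) -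
      (?D (?\<phi> (path_of_simplex \<sigma> 1)) (S (path_of_simplex \<sigma> 1) t) - ?D (?\<phi> (path_of_simplex \<sigma> 0)) (S (path_of_simplex \<sigma> 0) t))) c"
    proof (rule frag_linear_cong)
      fix \<sigma> assume \<sigma>: "\<sigma> \<in> Poly_Mapping.keys c"
      let ?\<gamma> = "path_of_simplex \<sigma>" and ?m = "mesh_point \<sigma> N"
      let ?E = "\<lambda>p. ?D (?\<phi> p) (S p t)"
      have \<gamma>K: "?\<gamma> s \<in> K" if "s \<in> {0..1}" for s
        unfolding K_def by (rule UN_I[OF \<sigma> imageI[OF that]])
      have chart: "\<exists>F. (\<forall>u\<in>ball (?m k) e \<inter> ?Xt. \<forall>v\<in>ball (?m k) e \<inter> ?Xt. ?D u v = F v - F u)" if k: "k < N" for k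
      proof -
        obtain W F where W: "exact_chart H W F" "ball (?m k) e \<subseteq> W"
          using e(2)[OF mK[OF \<sigma> less_imp_le[OF k]]] by blast
        show ?thesis
        proof (intro exI ballI)
          fix u v assume "u \<in> ball (?m k) e \<inter> ?Xt" "v \<in> ball (?m k) e \<inter> ?Xt"
          then show "?D u v = F \<omega> v - F \<omega> u"
            using W(2) by (intro exact_chart_diff[OF W(1)]) (auto simp: level_curve_def)
        qed
      qed
      have in_ball: "?\<phi> (?\<gamma> s) \<in> ball (?m k) e \<inter> ?Xt"
        if "k < N" "s \<in> {real k / real N..real (Suc k) / real N}" for k s
      proof -
        have "0 \<le> real k / real N" "real (Suc k) / real N \<le> 1"
          using frac(1,2)[OF that(1)] by simp_all
        then have s: "s \<in> {0..1}"
          using that(2) unfolding atLeastAtMost_iff by linarith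
        have "dist (?m k) (?\<gamma> s) < e / 2"
          by (rule piece[OF \<sigma> that])
        moreover have "dist (?\<gamma> s) (?\<phi> (?\<gamma> s)) < e / 2"
          using near \<gamma>K[OF s] by blast
        ultimately have "dist (?m k) (?\<phi> (?\<gamma> s)) < e"
          using dist_triangle[of "?m k" "?\<phi> (?\<gamma> s)" "?\<gamma> s"] by linarith
        then show ?thesis
          using \<phi>(2)[of "?\<gamma> s"] \<gamma>K[OF s] K(2) by auto
      qed
      have "cocycle_integral ?D (path_of_simplex (simplex_map 1 ?\<phi> \<sigma>)) = cocycle_integral ?D (\<lambda>s. ?\<phi> (?\<gamma> s))"
      proof (rule cocycle_integral_cong)
        fix s :: real assume "s \<in> {0..1}"
        then show "path_of_simplex (simplex_map 1 ?\<phi> \<sigma>) s = ?\<phi> (?\<gamma> s)"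
          using segment_param_simplex[of s] by (simp add: path_of_simplex_param simplex_map_def)
      qed
      \<comment> \<open>The mesh number was fixed before \<open>t\<close>; the limit over finer
        meshes is avoided.\<close>
      also have "\<dots> = cocycle_sum ?D (\<lambda>s. ?\<phi> (?\<gamma> s)) N"
      proof (rule cocycle_integral_mesh[OF exact _ _ N(1)])
        show "continuous_on {0..1} (\<lambda>s. ?\<phi> (?\<gamma> s))"
          using path[OF \<sigma>] by (intro continuous_on_compose2[OF \<phi>(1)]) auto
        show "(\<lambda>s. ?\<phi> (?\<gamma> s)) ` {0..1} \<subseteq> ?Xt"
          using path(2)[OF \<sigma>] \<phi>(2) by blast
        fix k assume k: "k < N"
        obtain F where F: "\<forall>u\<in>ball (?m k) e \<inter> ?Xt. \<forall>v\<in>ball (?m k) e \<inter> ?Xt. ?D u v = F v - F u"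
          using chart[OF k] ..
        show "\<exists>F. \<forall>s\<in>{real k / real N..real (Suc k) / real N}.
          \<forall>s'\<in>{real k / real N..real (Suc k) / real N}. ?D (?\<phi> (?\<gamma> s)) (?\<phi> (?\<gamma> s')) = F (?\<phi> (?\<gamma> s')) - F (?\<phi> (?\<gamma> s))"
          by (intro exI[of _ F] ballI F[rule_format] in_ball k)
      qed
      \<comment> \<open>\<open>?E p\<close> is the short integral from the transported point to the
        section through \<open>p\<close>. Both pairs of consecutive points lie in one ball where
        \<open>?D\<close> is a coboundary, so exchanging them costs a difference of
        \<open>?E\<close>.\<close>
      also have "\<dots> = (\<Sum>k<N. ?D (S (?m k) t) (S (?m (Suc k)) t) - (?E (?m (Suc k)) - ?E (?m k)))"
        unfolding cocycle_sum_def
      proof (rule sum.cong[OF refl])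
        fix k assume "k \<in> {..<N}"
        then have k: "k < N" by simp
        obtain F where F: "\<forall>u\<in>ball (?m k) e \<inter> ?Xt. \<forall>v\<in>ball (?m k) e \<inter> ?Xt. ?D u v = F v - F u"
          using chart[OF k] ..
        have mem: "real k / real N \<in> {real k / real N..real (Suc k) / real N}"
          "real (Suc k) / real N \<in> {real k / real N..real (Suc k) / real N}"
          using frac(3)[OF k] by auto
        have \<phi>m: "?\<phi> (?m k) \<in> ball (?m k) e \<inter> ?Xt" "?\<phi> (?m (Suc k)) \<in> ball (?m k) e \<inter> ?Xt"
          using in_ball[OF k mem(1)] in_ball[OF k mem(2)] by (simp_all only: mesh_point_def)
        have Sm: "S (?m j) t \<in> ball (?m k) e \<inter> ?Xt" if "j \<in> {k, Suc k}" for j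
        proof -
          have "?m j \<in> P"
            using that k \<sigma> by (auto simp: P_def)
          then have "eval_xy H (S (?m j) t) = t" "dist (S (?m j) t0) (S (?m j) t) < e / 2" "?m j \<in> ?X"
            using near P(2) K(2) by auto
          moreover have "dist (?m k) (?m j) < e / 2"
            using that piece[OF \<sigma> k mem(1)] piece[OF \<sigma> k mem(2)] by (auto simp only: mesh_point_def)
          ultimately have "dist (?m k) (S (?m j) t) < e" "S (?m j) t \<in> ?Xt"
            using dist_triangle[of "?m k" "S (?m j) t" "?m j"] S(2)[of "?m j"] by (auto simp: level_curve_def)
          then show ?thesis
            by simp
        qed
        have "?D (?\<phi> (?m k)) (?\<phi> (?m (Suc k))) = F (?\<phi> (?m (Suc k))) - F (?\<phi> (?m k))"
          "?D (S (?m k) t) (S (?m (Suc k)) t) = F (S (?m (Suc k)) t) - F (S (?m k) t)"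
          "?E (?m (Suc k)) = F (S (?m (Suc k)) t) - F (?\<phi> (?m (Suc k)))"
          "?E (?m k) = F (S (?m k) t) - F (?\<phi> (?m k))"
          using F \<phi>m Sm by blast+
        then show "?D (?\<phi> (?\<gamma> (real k / real N))) (?\<phi> (?\<gamma> (real (Suc k) / real N))) =
          ?D (S (?m k) t) (S (?m (Suc k)) t) - (?E (?m (Suc k)) - ?E (?m k))"
          by (simp add: mesh_point_def)
      qed
      also have "\<dots> = (\<Sum>k<N. ?D (S (?m k) t) (S (?m (Suc k)) t)) - (?E (?m N) - ?E (?m 0))"
        using sum_lessThan_telescope[of "\<lambda>k. ?E (?m k)" N] by (simp add: sum_subtractf)
      finally show "cocycle_integral ?D (path_of_simplex (simplex_map 1 ?\<phi> \<sigma>)) =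
        (\<Sum>k<N. ?D (S (?m k) t) (S (?m (Suc k)) t)) - (?E (?\<gamma> 1) - ?E (?\<gamma> 0))"
        using N(1) by (simp add: mesh_point_def)
    qed
    also have "\<dots> = frag_linear (\<lambda>\<sigma>. \<Sum>k<N. ?D (S (mesh_point \<sigma> N k) t) (S (mesh_point \<sigma> N (Suc k)) t)) c -
      frag_linear (\<lambda>\<sigma>. ?D (?\<phi> (path_of_simplex \<sigma> 1)) (S (path_of_simplex \<sigma> 1) t) -
        ?D (?\<phi> (path_of_simplex \<sigma> 0)) (S (path_of_simplex \<sigma> 0) t)) c"
      by (simp add: frag_linear_def sum_subtractf right_diff_distrib)
    also have "frag_linear (\<lambda>\<sigma>. ?D (?\<phi> (path_of_simplex \<sigma> 1)) (S (path_of_simplex \<sigma> 1) t) -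
        ?D (?\<phi> (path_of_simplex \<sigma> 0)) (S (path_of_simplex \<sigma> 0) t)) c = 0"
      by (rule cycle_telescope[OF cyc(2), where E = "\<lambda>p. ?D (?\<phi> p) (S p t)"])
    finally show ?thesis
      by simp
  qed
  show ?thesis
  proof (rule exI[of _ N], rule exI[of _ c], rule exI[of _ S], rule exI[of _ A], rule exI[of _ B], intro conjI ballI allI impI)
    show "chain_boundary 1 c = 0" by (rule cyc(2))
    show "section_at H (S p) t0 (A p) (B p)" "S p t0 = p" if "p \<in> ?X" for p
      using S[OF that] by blast+
    show "\<forall>\<^sub>F t in nhds t0. class_integral \<omega> (\<delta> t) =
      frag_linear (\<lambda>\<sigma>. \<Sum>k<N. fibre_diff H \<omega> (S (mesh_point \<sigma> N k) t) (S (mesh_point \<sigma> N (Suc k)) t)) c" for \<omega>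
      using near by (rule eventually_mono) (rule main)
    show "\<exists>W F. exact_chart H W F \<and> mesh_point \<sigma> N k \<in> W \<and> mesh_point \<sigma> N (Suc k) \<in> W \<and>
      mesh_point \<sigma> N k \<in> ?X \<and> mesh_point \<sigma> N (Suc k) \<in> ?X"
      if \<sigma>: "\<sigma> \<in> Poly_Mapping.keys c" and k: "k < N" for \<sigma> k
    proof -
      obtain W F where W: "exact_chart H W F" "ball (mesh_point \<sigma> N k) e \<subseteq> W"
        using e(2)[OF mK[OF \<sigma> less_imp_le[OF k]]] by blast
      have "dist (mesh_point \<sigma> N k) (mesh_point \<sigma> N (Suc k)) < e / 2"
        unfolding mesh_point_def[of \<sigma> N "Suc k"] using frac(3)[OF k] by (intro piece[OF \<sigma> k]) auto
      then have "mesh_point \<sigma> N k \<in> W" "mesh_point \<sigma> N (Suc k) \<in> W"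
        using W(2) e(1) by auto
      moreover have "mesh_point \<sigma> N k \<in> ?X" "mesh_point \<sigma> N (Suc k) \<in> ?X"
        using mK[OF \<sigma>, of k] mK[OF \<sigma>, of "Suc k"] k K(2) by auto
      ultimately show ?thesis
        using W(1) by blast
    qed
    show "mesh_point \<sigma> N 0 = path_of_simplex \<sigma> 0" "mesh_point \<sigma> N N = path_of_simplex \<sigma> 1" for \<sigma>
      using N(1) by (simp_all add: mesh_point_def)
  qed
qed

section \<open>Differentiation of the integrals with respect to the level\<close>

lemma frag_linear_has_field_derivative:
  assumes "\<And>x. x \<in> Poly_Mapping.keys c \<Longrightarrow> (\<phi> x has_field_derivative d x) (at t)"
  shows "((\<lambda>t. frag_linear (\<lambda>x. \<phi> x t) c) has_field_derivative frag_linear d c) (at t)"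
  unfolding frag_linear_def by (intro DERIV_sum DERIV_cmult assms)

text \<open>Both sections run in the same chart on the same levels, so the short integral is a
  difference of one primitive and the constant of the chart drops out.\<close>

lemma fibre_diff_sections:
  assumes W: "exact_chart H W F"
    and p: "section_at H s t0 a b" "s t0 \<in> W" and q: "section_at H s' t0 a' b'" "s' t0 \<in> W"
  shows "(\<lambda>t. fibre_diff H \<omega> (s t) (s' t)) field_differentiable (at t0)"
    "ext_deriv \<omega> = wedge_dH H \<eta> \<Longrightarrow> ((\<lambda>t. fibre_diff H \<omega> (s t) (s' t)) has_field_derivative
      fibre_diff H \<eta> (s t0) (s' t0) + (eval_xy (fst \<omega>) (s' t0) * a' + eval_xy (snd \<omega>) (s' t0) * b') -
      (eval_xy (fst \<omega>) (s t0) * a + eval_xy (snd \<omega>) (s t0) * b)) (at t0)"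
proof -
  note chart = exact_chart_fibre_chart[OF W]
  have near: "\<forall>\<^sub>F t in nhds t0. eval_xy H (u t) = t \<and> u t \<in> W" if u: "section_at H u t0 x y" "u t0 \<in> W" for u x y
  proof -
    obtain e where "e > 0" "ball (u t0) e \<subseteq> W"
      using openE[OF fibre_chart_open[OF chart] u(2)] by blast
    then show ?thesis
      using section_at_near[OF u(1), of e] by (auto elim!: eventually_mono)
  qed
  have ev: "\<forall>\<^sub>F t in nhds t0. F \<omega> (s' t) - F \<omega> (s t) = fibre_diff H \<omega> (s t) (s' t)" for \<omega>
    using near[OF p] near[OF q]
    by eventually_elim (rule exact_chart_diff[OF W, symmetric], auto)
  note transfer = DERIV_cong_ev[OF refl ev refl, THEN iffD1]
  obtain d d' where "((\<lambda>t. F \<omega> (s t)) has_field_derivative d) (at t0)"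
    "((\<lambda>t. F \<omega> (s' t)) has_field_derivative d') (at t0)"
    using fibre_chart_differentiable[OF chart p] fibre_chart_differentiable[OF chart q]
    unfolding field_differentiable_def by blast
  from transfer[OF DERIV_diff[OF this(2,1)]]
  show "(\<lambda>t. fibre_diff H \<omega> (s t) (s' t)) field_differentiable (at t0)"
    unfolding field_differentiable_def by blast
  assume \<eta>: "ext_deriv \<omega> = wedge_dH H \<eta>"
  obtain k where k: "\<And>s a b. section_at H s t0 a b \<Longrightarrow> s t0 \<in> W \<Longrightarrow>
    ((\<lambda>t. F \<omega> (s t)) has_field_derivative
      F \<eta> (s t0) + (eval_xy (fst \<omega>) (s t0) * a + eval_xy (snd \<omega>) (s t0) * b) - k) (at t0)"
    by (rule fibre_chart_gelfand_leray[OF chart \<eta>]) blast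
  have fd: "fibre_diff H \<eta> (s t0) (s' t0) = F \<eta> (s' t0) - F \<eta> (s t0)"
    using eventually_nhds_x_imp_x[OF ev[of \<eta>]] by simp
  show "((\<lambda>t. fibre_diff H \<omega> (s t) (s' t)) has_field_derivative
      fibre_diff H \<eta> (s t0) (s' t0) + (eval_xy (fst \<omega>) (s' t0) * a' + eval_xy (snd \<omega>) (s' t0) * b') -
      (eval_xy (fst \<omega>) (s t0) * a + eval_xy (snd \<omega>) (s t0) * b)) (at t0)"
    by (rule DERIV_cong[OF transfer[OF DERIV_diff[OF k[OF q] k[OF p]]]]) (simp add: fd algebra_simps)
qed

text \<open>Differentiating the local finite sum gives the sum for \<open>\<eta>\<close> plus
  differences of \<open>\<omega>\<close> paired with section velocities; these telescope along each
  simplex and then vanish on the cycle.\<close>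

lemma class_integral_derivative:
  assumes fam: "continuous_cycle_family H U \<delta>" and t0: "t0 \<in> U"
  shows "(\<lambda>t. class_integral \<omega> (\<delta> t)) field_differentiable (at t0)"
    "ext_deriv \<omega> = wedge_dH H \<eta> \<Longrightarrow>
      ((\<lambda>t. class_integral \<omega> (\<delta> t)) has_field_derivative class_integral \<eta> (\<delta> t0)) (at t0)"
proof -
  from class_integral_local[OF fam t0] obtain N c S A B where
    cyc: "chain_boundary 1 c = 0" and
    S: "\<forall>p\<in>level_curve H t0. section_at H (S p) t0 (A p) (B p) \<and> S p t0 = p" and
    I: "\<forall>\<omega>. \<forall>\<^sub>F t in nhds t0. class_integral \<omega> (\<delta> t) =
      frag_linear (\<lambda>\<sigma>. \<Sum>k<N. fibre_diff H \<omega> (S (mesh_point \<sigma> N k) t) (S (mesh_point \<sigma> N (Suc k)) t)) c" and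
    W: "\<forall>\<sigma>\<in>Poly_Mapping.keys c. \<forall>k<N. \<exists>W F. exact_chart H W F \<and>
      mesh_point \<sigma> N k \<in> W \<and> mesh_point \<sigma> N (Suc k) \<in> W \<and>
      mesh_point \<sigma> N k \<in> level_curve H t0 \<and> mesh_point \<sigma> N (Suc k) \<in> level_curve H t0" and
    ends: "\<forall>\<sigma>. mesh_point \<sigma> N 0 = path_of_simplex \<sigma> 0 \<and> mesh_point \<sigma> N N = path_of_simplex \<sigma> 1"
    by (elim exE conjE)
  note S = S[rule_format] and I = I[rule_format] and W = W[rule_format] and ends = ends[rule_format]
  note transfer = DERIV_cong_ev[OF refl I refl, THEN iffD2]
  let ?m = "\<lambda>\<sigma>. mesh_point \<sigma> N"
  define d where "d \<sigma> k = deriv (\<lambda>t. fibre_diff H \<omega> (S (?m \<sigma> k) t) (S (?m \<sigma> (Suc k)) t)) t0" for \<sigma> k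
  have d: "((\<lambda>t. fibre_diff H \<omega> (S (?m \<sigma> k) t) (S (?m \<sigma> (Suc k)) t)) has_field_derivative d \<sigma> k) (at t0)"
    if \<sigma>k: "\<sigma> \<in> Poly_Mapping.keys c" "k < N" for \<sigma> k
  proof -
    obtain W F where W: "exact_chart H W F" "?m \<sigma> k \<in> W" "?m \<sigma> (Suc k) \<in> W"
      "?m \<sigma> k \<in> level_curve H t0" "?m \<sigma> (Suc k) \<in> level_curve H t0"
      using W[OF \<sigma>k] by blast
    have S0: "S (?m \<sigma> k) t0 = ?m \<sigma> k" "S (?m \<sigma> (Suc k)) t0 = ?m \<sigma> (Suc k)"
      using S[OF W(4)] S[OF W(5)] by auto
    show ?thesis
      unfolding d_def DERIV_deriv_iff_field_differentiable
      using W(2,3) by (intro fibre_diff_sections(1)[OF W(1) conjunct1[OF S[OF W(4)]] _ conjunct1[OF S[OF W(5)]]])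
        (simp_all add: S0)
  qed
  have "((\<lambda>t. frag_linear (\<lambda>\<sigma>. \<Sum>k<N. fibre_diff H \<omega> (S (?m \<sigma> k) t) (S (?m \<sigma> (Suc k)) t)) c) has_field_derivative
    frag_linear (\<lambda>\<sigma>. \<Sum>k<N. d \<sigma> k) c) (at t0)"
    by (intro frag_linear_has_field_derivative DERIV_sum d) auto
  from transfer[OF this] show "(\<lambda>t. class_integral \<omega> (\<delta> t)) field_differentiable (at t0)"
    unfolding field_differentiable_def by blast
  assume \<eta>: "ext_deriv \<omega> = wedge_dH H \<eta>"
  \<comment> \<open>The form \<open>\<omega>\<close> on the velocity of the chosen section; a
    function of the point alone.\<close>
  define E where "E p = eval_xy (fst \<omega>) p * A p + eval_xy (snd \<omega>) p * B p" for p
  have D: "((\<lambda>t. fibre_diff H \<omega> (S (?m \<sigma> k) t) (S (?m \<sigma> (Suc k)) t)) has_field_derivative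
    fibre_diff H \<eta> (?m \<sigma> k) (?m \<sigma> (Suc k)) + (E (?m \<sigma> (Suc k)) - E (?m \<sigma> k))) (at t0)"
    if \<sigma>k: "\<sigma> \<in> Poly_Mapping.keys c" "k < N" for \<sigma> k
  proof -
    obtain W F where W: "exact_chart H W F" "?m \<sigma> k \<in> W" "?m \<sigma> (Suc k) \<in> W"
      "?m \<sigma> k \<in> level_curve H t0" "?m \<sigma> (Suc k) \<in> level_curve H t0"
      using W[OF \<sigma>k] by blast
    have S0: "S (?m \<sigma> k) t0 = ?m \<sigma> k" "S (?m \<sigma> (Suc k)) t0 = ?m \<sigma> (Suc k)"
      using S[OF W(4)] S[OF W(5)] by auto
    have S1: "S (?m \<sigma> k) t0 \<in> W" "S (?m \<sigma> (Suc k)) t0 \<in> W"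
      using W(2,3) by (simp_all add: S0)
    from fibre_diff_sections(2)[OF W(1) conjunct1[OF S[OF W(4)]] S1(1) conjunct1[OF S[OF W(5)]] S1(2) \<eta>]
    show ?thesis
      by (rule DERIV_cong) (simp add: S0 E_def algebra_simps)
  qed
  have "((\<lambda>t. frag_linear (\<lambda>\<sigma>. \<Sum>k<N. fibre_diff H \<omega> (S (?m \<sigma> k) t) (S (?m \<sigma> (Suc k)) t)) c) has_field_derivative
    frag_linear (\<lambda>\<sigma>. \<Sum>k<N. fibre_diff H \<eta> (?m \<sigma> k) (?m \<sigma> (Suc k)) + (E (?m \<sigma> (Suc k)) - E (?m \<sigma> k))) c) (at t0)"
    by (intro frag_linear_has_field_derivative DERIV_sum D) auto
  note der = transfer[OF this]
  have "frag_linear (\<lambda>\<sigma>. \<Sum>k<N. fibre_diff H \<eta> (?m \<sigma> k) (?m \<sigma> (Suc k)) + (E (?m \<sigma> (Suc k)) - E (?m \<sigma> k))) c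
    = frag_linear (\<lambda>\<sigma>. (\<Sum>k<N. fibre_diff H \<eta> (S (?m \<sigma> k) t0) (S (?m \<sigma> (Suc k)) t0)) +
      (E (path_of_simplex \<sigma> 1) - E (path_of_simplex \<sigma> 0))) c"
  proof (rule frag_linear_cong)
    fix \<sigma> assume \<sigma>: "\<sigma> \<in> Poly_Mapping.keys c"
    have "(\<Sum>k<N. fibre_diff H \<eta> (?m \<sigma> k) (?m \<sigma> (Suc k))) =
      (\<Sum>k<N. fibre_diff H \<eta> (S (?m \<sigma> k) t0) (S (?m \<sigma> (Suc k)) t0))"
    proof (rule sum.cong[OF refl])
      fix k assume "k \<in> {..<N}"
      then obtain W F where "?m \<sigma> k \<in> level_curve H t0" "?m \<sigma> (Suc k) \<in> level_curve H t0"
        using W[OF \<sigma>, of k] by blast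
      then show "fibre_diff H \<eta> (?m \<sigma> k) (?m \<sigma> (Suc k)) = fibre_diff H \<eta> (S (?m \<sigma> k) t0) (S (?m \<sigma> (Suc k)) t0)"
        using S by simp
    qed
    moreover have "(\<Sum>k<N. E (?m \<sigma> (Suc k)) - E (?m \<sigma> k)) = E (path_of_simplex \<sigma> 1) - E (path_of_simplex \<sigma> 0)"
      using sum_lessThan_telescope[of "\<lambda>k. E (?m \<sigma> k)" N] ends[of \<sigma>] by simp
    ultimately show "(\<Sum>k<N. fibre_diff H \<eta> (?m \<sigma> k) (?m \<sigma> (Suc k)) + (E (?m \<sigma> (Suc k)) - E (?m \<sigma> k))) =
      (\<Sum>k<N. fibre_diff H \<eta> (S (?m \<sigma> k) t0) (S (?m \<sigma> (Suc k)) t0)) + (E (path_of_simplex \<sigma> 1) - E (path_of_simplex \<sigma> 0))"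
      by (simp only: sum.distrib)
  qed
  also have "\<dots> = frag_linear (\<lambda>\<sigma>. \<Sum>k<N. fibre_diff H \<eta> (S (?m \<sigma> k) t0) (S (?m \<sigma> (Suc k)) t0)) c +
    frag_linear (\<lambda>\<sigma>. E (path_of_simplex \<sigma> 1) - E (path_of_simplex \<sigma> 0)) c"
    by (simp add: frag_linear_def sum.distrib distrib_left)
  also have "\<dots> = class_integral \<eta> (\<delta> t0)"
    using cycle_telescope[OF cyc, of E] eventually_nhds_x_imp_x[OF I[of \<eta>]] by simp
  finally show "((\<lambda>t. class_integral \<omega> (\<delta> t)) has_field_derivative class_integral \<eta> (\<delta> t0)) (at t0)"
    using der by simp
qed

lemma path_integral_exact:
  assumes \<gamma>: "valid_path \<gamma>"
  shows "(form_along (deriv_x G, deriv_y G) \<gamma> has_integral eval_xy G (\<gamma> 1) - eval_xy G (\<gamma> 0)) {0..1}"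
proof -
  obtain S where S: "finite S"
    "\<And>s. s \<in> {0..1} - S \<Longrightarrow> (\<gamma> has_vector_derivative vector_derivative \<gamma> (at s within {0..1})) (at s within {0..1})"
    using valid_path_derivative[OF \<gamma>] by blast
  show ?thesis
  proof (rule fundamental_theorem_of_calculus_interior_strong[OF S(1)])
    show "continuous_on {0..1} (\<lambda>s. eval_xy G (\<gamma> s))"
      using valid_path_imp_path[OF \<gamma>] by (intro continuous_on_eval_xy) (simp add: path_def)
    fix s :: real assume s: "s \<in> {0<..<1} - S"
    let ?v = "vector_derivative \<gamma> (at s within {0..1})"
    have "at s within {0..1} = at s"
      using s by (intro at_within_interior) auto
    then have "(\<gamma> has_vector_derivative ?v) (at s)"
      using S(2)[of s] s by simp
    from has_derivative_compose[OF this[unfolded has_vector_derivative_def] eval_xy_has_derivative[of G]]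
    show "((\<lambda>s. eval_xy G (\<gamma> s)) has_vector_derivative form_along (deriv_x G, deriv_y G) \<gamma> s) (at s)"
      unfolding has_vector_derivative_def form_along_def
      by (rule has_derivative_eq_rhs) (auto simp: algebra_simps scaleR_conv_of_real)
  qed simp
qed

text \<open>Coefficients are compared on the curve \<open>H = t\<close> only, which permits
  replacing \<open>H\<close> by the number \<open>t\<close>. The exact part contributes end point
  values, which cancel on a cycle.\<close>

lemma class_integral_combination:
  assumes fam: "continuous_cycle_family H U \<delta>" and t: "t \<in> U"
    and eq: "\<And>z. eval_xy H z = t \<Longrightarrow> eval_xy (fst \<theta>) z = (\<Sum>j\<in>J. b j * eval_xy (fst (\<omega> j)) z) + eval_dx G z"
      "\<And>z. eval_xy H z = t \<Longrightarrow> eval_xy (snd \<theta>) z = (\<Sum>j\<in>J. b j * eval_xy (snd (\<omega> j)) z) + eval_dy G z"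
    and J: "finite J"
  shows "class_integral \<theta> (\<delta> t) = (\<Sum>j\<in>J. b j * class_integral (\<omega> j) (\<delta> t))"
proof -
  have "regular_value H t" and \<delta>: "\<delta> t \<in> carrier (H1_level H t)"
    using fam t unfolding continuous_cycle_family_def by blast+
  then have reg: "\<And>z. z \<in> level_curve H t \<Longrightarrow> regular_point H z"
    by (intro regular_value_regular_point)
  obtain c where c: "c \<in> \<delta> t" "piecewise_C1_chain c"
    by (rule piecewise_C1_representative[OF reg \<delta>])
  note cyc = homology_class_cycle[OF \<delta> c(1)]
  have I: "class_integral \<omega> (\<delta> t) = frag_linear (\<lambda>\<sigma>. path_integral \<omega> (path_of_simplex \<sigma>)) c" for \<omega>
    using class_integral_representative[OF reg \<delta> c] by (simp add: chain_integral_frag_linear)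
  have "frag_linear (\<lambda>\<sigma>. path_integral \<theta> (path_of_simplex \<sigma>)) c =
    frag_linear (\<lambda>\<sigma>. (\<Sum>j\<in>J. b j * path_integral (\<omega> j) (path_of_simplex \<sigma>)) +
      (eval_xy G (path_of_simplex \<sigma> 1) - eval_xy G (path_of_simplex \<sigma> 0))) c"
  proof (rule frag_linear_cong)
    fix \<sigma> assume \<sigma>: "\<sigma> \<in> Poly_Mapping.keys c"
    let ?\<gamma> = "path_of_simplex \<sigma>"
    have \<gamma>: "valid_path ?\<gamma>" and s: "singular_simplex 1 (top_of_set (level_curve H t)) \<sigma>"
      using \<sigma> c(2) cyc(1) by (auto simp: piecewise_C1_chain_def singular_chain_def)
    have lev: "?\<gamma> s \<in> level_curve H t" if "s \<in> {0..1}" for s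
      by (rule path_of_simplex_continuous(2)[OF s that])
    have int: "(form_along \<omega> ?\<gamma> has_integral path_integral \<omega> ?\<gamma>) {0..1}" for \<omega>
      using form_along_has_integral[OF \<gamma> lev reg, of \<omega>] integral_unique
      unfolding path_integral_form_along by blast
    have "((\<lambda>s. (\<Sum>j\<in>J. b j * form_along (\<omega> j) ?\<gamma> s) + form_along (deriv_x G, deriv_y G) ?\<gamma> s) has_integral
      (\<Sum>j\<in>J. b j * path_integral (\<omega> j) ?\<gamma>) + (eval_xy G (?\<gamma> 1) - eval_xy G (?\<gamma> 0))) {0..1}"
      by (intro has_integral_add has_integral_sum J has_integral_mult_right int path_integral_exact \<gamma>)
    moreover have "(\<Sum>j\<in>J. b j * form_along (\<omega> j) ?\<gamma> s) + form_along (deriv_x G, deriv_y G) ?\<gamma> s = form_along \<theta> ?\<gamma> s"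
      if "s \<in> {0..1}" for s
    proof -
      have "eval_xy H (?\<gamma> s) = t"
        using lev[OF that] by (simp add: level_curve_def)
      then show ?thesis
        unfolding form_along_def eq[OF \<open>eval_xy H (?\<gamma> s) = t\<close>]
        by (simp add: algebra_simps sum.distrib sum_distrib_left sum_distrib_right)
    qed
    ultimately have "(form_along \<theta> ?\<gamma> has_integral
      (\<Sum>j\<in>J. b j * path_integral (\<omega> j) ?\<gamma>) + (eval_xy G (?\<gamma> 1) - eval_xy G (?\<gamma> 0))) {0..1}"
      using has_integral_cong[of "{0..1}"] by (metis (no_types, lifting))
    then show "path_integral \<theta> ?\<gamma> = (\<Sum>j\<in>J. b j * path_integral (\<omega> j) ?\<gamma>) + (eval_xy G (?\<gamma> 1) - eval_xy G (?\<gamma> 0))"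
      unfolding path_integral_form_along[of \<theta>] by (rule integral_unique)
  qed
  also have "\<dots> = (\<Sum>j\<in>J. b j * frag_linear (\<lambda>\<sigma>. path_integral (\<omega> j) (path_of_simplex \<sigma>)) c) +
    frag_linear (\<lambda>\<sigma>. eval_xy G (path_of_simplex \<sigma> 1) - eval_xy G (path_of_simplex \<sigma> 0)) c"
    unfolding frag_linear_def
    by (simp add: sum.distrib distrib_left sum_distrib_left sum.swap[of _ J] mult.left_commute)
  also have "frag_linear (\<lambda>\<sigma>. eval_xy G (path_of_simplex \<sigma> 1) - eval_xy G (path_of_simplex \<sigma> 0)) c = 0"
    by (rule cycle_telescope[OF cyc(2)])
  finally show ?thesis
    by (simp add: I)
qed

section \<open>The Picard--Fuchs system\<close>

lemma sum_delta_mult: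
  fixes f :: "nat \<Rightarrow> complex"
  assumes "i < \<nu>"
  shows "(\<Sum>j<\<nu>. (if j = i then s else 0) * f j) = s * f i"
proof -
  have "(\<Sum>j<\<nu>. (if j = i then s else 0) * f j) = (\<Sum>j<\<nu>. if j = i then s * f j else 0)"
    by (rule sum.cong) auto
  also have "\<dots> = s * f i"
    using assms by (subst sum.delta) auto
  finally show ?thesis .
qed

text \<open>The integral of \<open>\<theta>\<close> over the cycle at level \<open>s\<close> is
  \<open>s * I_i - \<Sum> a_j I_j\<close>. Its derivative is computed twice, by the Gelfand--Leray
  formula and by the product rule, and the results are compared.\<close>

lemma picard_fuchs_row:
  fixes i \<nu> :: nat
  assumes fam: "continuous_cycle_family H U \<delta>" and t: "t \<in> U" and i: "i < \<nu>"
    and a: "H * ext_deriv (\<omega> i) = deriv_x H * u + deriv_y H * v +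
      (\<Sum>j<\<nu>. Poly_Mapping.single 0 (a j) * ext_deriv (\<omega> j))"
    and b: "- v = (\<Sum>j<\<nu>. Poly_Mapping.single 0 (b j) * fst (\<omega> j)) + deriv_x G"
      "u = (\<Sum>j<\<nu>. Poly_Mapping.single 0 (b j) * snd (\<omega> j)) + deriv_y G"
  shows "(\<Sum>j<\<nu>. ((if j = i then t else 0) - a j) * deriv (\<lambda>s. class_integral (\<omega> j) (\<delta> s)) t) =
    (\<Sum>j<\<nu>. b j * class_integral (\<omega> j) (\<delta> t))"
proof -
  let ?C = "\<lambda>c. Poly_Mapping.single (0 :: nat \<times> nat) (c :: complex)"
  let ?I = "\<lambda>j s. class_integral (\<omega> j) (\<delta> s)"
  have U: "open U"
    using fam unfolding continuous_cycle_family_def by blast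
  define \<theta> :: one_form where "\<theta> = (H * fst (\<omega> i) - (\<Sum>j<\<nu>. ?C (a j) * fst (\<omega> j)),
    H * snd (\<omega> i) - (\<Sum>j<\<nu>. ?C (a j) * snd (\<omega> j)))"
  define \<eta> :: one_form where "\<eta> = (fst (\<omega> i) - v, snd (\<omega> i) + u)"
  have dC: "deriv_x (?C k) = 0" "deriv_y (?C k) = 0" for k
    by (simp_all add: deriv_xy_single)
  have "ext_deriv \<theta> = deriv_x H * snd (\<omega> i) - deriv_y H * fst (\<omega> i) +
    (H * ext_deriv (\<omega> i) - (\<Sum>j<\<nu>. ?C (a j) * ext_deriv (\<omega> j)))"
    by (simp add: \<theta>_def ext_deriv_def deriv_xy_mult deriv_xy_sum dC right_diff_distrib sum_subtractf)
  also have "\<dots> = wedge_dH H \<eta>"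
    unfolding a by (simp add: wedge_dH_def \<eta>_def algebra_simps)
  finally have der1: "((\<lambda>s. class_integral \<theta> (\<delta> s)) has_field_derivative class_integral \<eta> (\<delta> t)) (at t)"
    by (rule class_integral_derivative(2)[OF fam t])
  have \<theta>: "class_integral \<theta> (\<delta> s) = (\<Sum>j<\<nu>. ((if j = i then s else 0) - a j) * ?I j s)" if s: "s \<in> U" for s
  proof (rule class_integral_combination[OF fam s, where G = 0])
    have d: "(\<Sum>j<\<nu>. ((if j = i then s else 0) - a j) * f j) = s * f i - (\<Sum>j<\<nu>. a j * f j)" for f :: "nat \<Rightarrow> complex"
      using sum_delta_mult[OF i, of s f] by (simp add: left_diff_distrib sum_subtractf)
    show "eval_xy (fst \<theta>) z = (\<Sum>j<\<nu>. ((if j = i then s else 0) - a j) * eval_xy (fst (\<omega> j)) z) + eval_dx 0 z"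
      "eval_xy (snd \<theta>) z = (\<Sum>j<\<nu>. ((if j = i then s else 0) - a j) * eval_xy (snd (\<omega> j)) z) + eval_dy 0 z"
      if "eval_xy H z = s" for z
      unfolding d by (simp_all add: \<theta>_def eval_xy_sum that)
  qed simp
  have \<eta>: "class_integral \<eta> (\<delta> t) = (\<Sum>j<\<nu>. ((if j = i then 1 else 0) + b j) * ?I j t)"
  proof (rule class_integral_combination[OF fam t, where G = G])
    have d: "(\<Sum>j<\<nu>. ((if j = i then 1 else 0) + b j) * f j) = f i + (\<Sum>j<\<nu>. b j * f j)" for f :: "nat \<Rightarrow> complex"
      using sum_delta_mult[OF i, of 1 f] by (simp add: distrib_right sum.distrib)
    have "fst \<eta> = fst (\<omega> i) + - v"
      by (simp add: \<eta>_def)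
    then show "eval_xy (fst \<eta>) z = (\<Sum>j<\<nu>. ((if j = i then 1 else 0) + b j) * eval_xy (fst (\<omega> j)) z) + eval_dx G z" for z
      unfolding d b(1) by (simp add: eval_xy_sum)
    have "snd \<eta> = snd (\<omega> i) + u"
      by (simp add: \<eta>_def)
    then show "eval_xy (snd \<eta>) z = (\<Sum>j<\<nu>. ((if j = i then 1 else 0) + b j) * eval_xy (snd (\<omega> j)) z) + eval_dy G z" for z
      unfolding d b(2) by (simp add: eval_xy_sum)
  qed simp
  have I: "(?I j has_field_derivative deriv (?I j) t) (at t)" for j
    using class_integral_derivative(1)[OF fam t] by (simp add: DERIV_deriv_iff_field_differentiable)
  have "((\<lambda>s. (if j = i then s else 0) - a j) has_field_derivative (if j = i then 1 else 0)) (at t)" for j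
    by (cases "j = i") (auto intro!: derivative_eq_intros)
  from DERIV_mult[OF this I]
  have "((\<lambda>s. \<Sum>j<\<nu>. ((if j = i then s else 0) - a j) * ?I j s) has_field_derivative
    (\<Sum>j<\<nu>. (if j = i then 1 else 0) * ?I j t + deriv (?I j) t * ((if j = i then t else 0) - a j))) (at t)"
    by (rule DERIV_sum)
  moreover have "\<forall>\<^sub>F s in nhds t. class_integral \<theta> (\<delta> s) = (\<Sum>j<\<nu>. ((if j = i then s else 0) - a j) * ?I j s)"
    using eventually_nhds_in_open[OF U t] by (rule eventually_mono) (rule \<theta>)
  ultimately have "((\<lambda>s. class_integral \<theta> (\<delta> s)) has_field_derivative
    (\<Sum>j<\<nu>. (if j = i then 1 else 0) * ?I j t + deriv (?I j) t * ((if j = i then t else 0) - a j))) (at t)"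
    using DERIV_cong_ev[OF refl _ refl] by fast
  from DERIV_unique[OF der1 this]
  have "(\<Sum>j<\<nu>. ((if j = i then 1 else 0) + b j) * ?I j t) =
    (\<Sum>j<\<nu>. (if j = i then 1 else 0) * ?I j t + deriv (?I j) t * ((if j = i then t else 0) - a j))"
    unfolding \<eta> .
  \<comment> \<open>The common first sum is \<open>I_i\<close>: on the left it comes from the
    summand \<open>\<omega> i\<close> of \<open>\<eta>\<close>, on the right from differentiating
    the factor \<open>s\<close>.\<close>
  then have "(\<Sum>j<\<nu>. (if j = i then 1 else 0) * ?I j t) + (\<Sum>j<\<nu>. b j * ?I j t) =
    (\<Sum>j<\<nu>. (if j = i then 1 else 0) * ?I j t) + (\<Sum>j<\<nu>. deriv (?I j) t * ((if j = i then t else 0) - a j))"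
    by (simp only: distrib_right sum.distrib)
  then have "(\<Sum>j<\<nu>. b j * ?I j t) = (\<Sum>j<\<nu>. deriv (?I j) t * ((if j = i then t else 0) - a j))"
    by (rule add_left_imp_eq)
  then show ?thesis
    by (simp only: mult.commute)
qed

theorem theorem2:
  fixes n \<nu> :: nat
    and H :: poly_xy
    and \<Omega> :: "nat \<Rightarrow> two_form"
    and \<omega> :: "nat \<Rightarrow> one_form"
  assumes "n \<ge> 1"
    and "balanced n H"
    and "\<nu> = n * (2 * n - 1)"
    and "bij_betw \<Omega> {..<\<nu>} (monomial_two_forms (2 * n))"
    and "\<And>i. i < \<nu> \<Longrightarrow> unit_monomial_one_form (\<omega> i)"
    and "\<And>i. i < \<nu> \<Longrightarrow> deg_one_form (\<omega> i) \<le> 2 * n"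
    and "\<And>i. i < \<nu> \<Longrightarrow> \<exists>c. c \<noteq> 0 \<and> ext_deriv (\<omega> i) = Poly_Mapping.single 0 c * \<Omega> i"
  shows "\<exists>A B. A \<in> carrier_mat \<nu> \<nu> \<and> B \<in> carrier_mat \<nu> \<nu> \<and>
    (\<forall>U \<delta>. continuous_cycle_family H U \<delta> \<longrightarrow>
      (\<forall>i<\<nu>. (\<lambda>t. class_integral (\<omega> i) (\<delta> t)) holomorphic_on U) \<and>
      (\<forall>t\<in>U.
        (t \<cdot>\<^sub>m 1\<^sub>m \<nu> - A) *\<^sub>v vec \<nu> (\<lambda>i. deriv (\<lambda>s. class_integral (\<omega> i) (\<delta> s)) t) =
        B *\<^sub>v vec \<nu> (\<lambda>i. class_integral (\<omega> i) (\<delta> t)))) \<and>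
    mat_norm A + mat_norm B \<le> 6 * real n * (real n + 1) ^ (n + 1)"
proof (rule picard_fuchs_coefficients[OF assms(1-5) assms(7)])
  fix a b :: "nat \<Rightarrow> nat \<Rightarrow> complex" and u v G :: "nat \<Rightarrow> poly_xy"
  assume a: "\<And>i. i < \<nu> \<Longrightarrow> H * ext_deriv (\<omega> i) = deriv_x H * u i + deriv_y H * v i +
      (\<Sum>j<\<nu>. Poly_Mapping.single 0 (a i j) * ext_deriv (\<omega> j))"
    and b: "\<And>i. i < \<nu> \<Longrightarrow> - v i = (\<Sum>j<\<nu>. Poly_Mapping.single 0 (b i j) * fst (\<omega> j)) + deriv_x (G i)"
      "\<And>i. i < \<nu> \<Longrightarrow> u i = (\<Sum>j<\<nu>. Poly_Mapping.single 0 (b i j) * snd (\<omega> j)) + deriv_y (G i)"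
    and bound: "mat_norm (mat \<nu> \<nu> (\<lambda>(i, j). a i j)) + mat_norm (mat \<nu> \<nu> (\<lambda>(i, j). b i j))
      \<le> 6 * real n * (real n + 1) ^ (n + 1)"
  let ?A = "mat \<nu> \<nu> (\<lambda>(i, j). a i j)" and ?B = "mat \<nu> \<nu> (\<lambda>(i, j). b i j)"
  show ?thesis
  proof (rule exI[of _ ?A], rule exI[of _ ?B], intro conjI allI impI ballI)
    fix U \<delta> assume fam: "continuous_cycle_family H U \<delta>"
    show "(\<lambda>t. class_integral (\<omega> i) (\<delta> t)) holomorphic_on U" for i
      using class_integral_derivative(1)[OF fam] field_differentiable_at_within
      unfolding holomorphic_on_def by blast
    fix t assume t: "t \<in> U"
    let ?d = "\<lambda>i. deriv (\<lambda>s. class_integral (\<omega> i) (\<delta> s)) t" and ?I = "\<lambda>i. class_integral (\<omega> i) (\<delta> t)"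
    show "(t \<cdot>\<^sub>m 1\<^sub>m \<nu> - ?A) *\<^sub>v vec \<nu> ?d = ?B *\<^sub>v vec \<nu> ?I"
    proof (rule eq_vecI)
      fix i assume "i < dim_vec (?B *\<^sub>v vec \<nu> ?I)"
      then have i: "i < \<nu>" by simp
      have "((t \<cdot>\<^sub>m 1\<^sub>m \<nu> - ?A) *\<^sub>v vec \<nu> ?d) $ i = (\<Sum>j<\<nu>. ((if j = i then t else 0) - a i j) * ?d j)"
        using i by (auto simp: scalar_prod_def atLeast0LessThan intro!: sum.cong)
      also have "\<dots> = (\<Sum>j<\<nu>. b i j * ?I j)"
        by (rule picard_fuchs_row[OF fam t i a[OF i] b[OF i]])
      also have "\<dots> = (?B *\<^sub>v vec \<nu> ?I) $ i"
        using i by (auto simp: scalar_prod_def atLeast0LessThan intro!: sum.cong)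
      finally show "((t \<cdot>\<^sub>m 1\<^sub>m \<nu> - ?A) *\<^sub>v vec \<nu> ?d) $ i = (?B *\<^sub>v vec \<nu> ?I) $ i" .
    qed simp
  qed (use bound in auto)
qed

end
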